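(* Let $p$ be a prime number. Let $\mathbf{f}=(f_1,\ldots,f_t):\mathbf{Q}_p^n\to\mathbf{Q}_p^t$ be a nonconstant polynomial mapping, with $f_1,\ldots,f_t\in\mathbf{Z}_p[x_1,\ldots,x_n]$, satisfying $f_i(0)=0$ for all $i$, and suppose that $n\geqslant t+1$. Let $g$ be a nonconstant polynomial in $\mathbf{Z}_p[x_1,\ldots,x_n]$ with $g(0)=0$, and suppose that $g$ is non-degenerated over $\mathbf{F}_p$ with respect to its Newton polyhedron. Suppose also that $\mathbf{f}$ and $(\mathbf{f},g)$ are strongly non-degenerated over $\mathbf{F}_p$ with respect to the Newton polyhedron $\Gamma_{\mathbf{f}}$ and the partition $\Delta_{\mathbf{f},g}$ of $\mathbf{R}_{\geqslant0}^n$, respectively. For $s\in\mathbf{C}$ with $\Re(s)>0$ put $$Z_{\mathbf{f},gdx}(s)=\int_{\mathbf{Z}_p^n}\|\mathbf{f}(x)\|^s|g(x)||dx|.$$ Then $$Z_{\mathbf{f},gdx}(s)=\sum_{\delta\in\Delta_{\mathbf{f},g}}L_\delta S_\delta,$$ with $$L_\delta=p^{-n}\left((p-1)^n-p^tN_\delta\frac{p^s-1}{p^{s+t}-1}-P_\delta\frac{p}{p+1}-pQ_\delta\frac{p^{t-1}\left(p^s(p+1)-1\right)-1}{(p^{s+t}-1)(p+1)}\right)$$ and $$S_\delta=\sum_{k\in\mathbf{Z}_{\geqslant0}^n\cap\delta}p^{-m_{\mathbf{f}}(k)s-m_g(k)-\sigma(k)},$$ for every cone $\delta$ in $\Delta_{\mathbf{f},g}$.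 Moreover, there exists a closed, rational expression for the $S_\delta$: given a partition of $\delta$ into rational simplicial cones $\delta_i$, $i\in I$, without the introduction of new rays, where $\delta_i$ is the cone strictly positively spanned by the linearly independent, primitive vectors $k_{i,1},\ldots,k_{i,r_i}\in\mathbf{Z}_{\geqslant0}^n\setminus\{0\}$, one has $$S_\delta=\sum_{i\in I}\frac{\sum_h p^{m_{\mathbf{f}}(h)s+m_g(h)+\sigma(h)}}{\prod_{j=1}^{r_i}\left(p^{m_{\mathbf{f}}(k_{i,j})s+m_g(k_{i,j})+\sigma(k_{i,j})}-1\right)},$$ where $h$ runs through the elements of the set $\mathbf{Z}^n\cap\left\{\sum_{j=1}^{r_i}\lambda_jk_{i,j}\mid 0\leqslant\lambda_j<1\text{ for }j=1,\ldots,r_i\right\}$. This shows that the real parts of the candidate poles for $Z_{\mathbf{f},gdx}$ are given by the rational numbers $-1$ and $$-\frac{m_g(k)+\sigma(k)}{m_{\mathbf{f}}(k)}$$ for $k$ a primitive generator of a ray in $\Delta_{\mathbf{f},g}$.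
   Context: $|\cdot|$ is the $p$-adic norm on $\mathbf{Q}_p$ (with $|p|=p^{-1}$), $\|\mathbf{f}(x)\|=\max_i|f_i(x)|$, and $|dx|$ is the Haar measure on $\mathbf{Q}_p^n$ normalized so that $\mathbf{Z}_p^n$ has measure one. The function $Z_{\mathbf{f},gdx}$ is a rational function of $p^{-s}$ and hence has a meromorphic continuation to $\mathbf{C}$, denoted by the same symbol. A bar denotes reduction of coefficients modulo $p\mathbf{Z}_p$ (componentwise for mappings). For $\omega\in\mathbf{Z}_{\geqslant0}^n$, $x^\omega=x_1^{\omega_1}\cdots x_n^{\omega_n}$. The support of a polynomial is the set of exponents of monomials with nonzero coefficient; $\mathrm{supp}(\mathbf{f})=\bigcup_i\mathrm{supp}(f_i)$. Newton polyhedra: $\Gamma_g$ (resp. $\Gamma_{\mathbf{f}}$) is the convex hull of $\bigcup_{\omega}(\omega+\mathbf{R}_{\geqslant0}^n)$, with $\omega$ running over $\mathrm{supp}(g)$ (resp. $\mathrm{supp}(\mathbf{f})$). A face of a polyhedron $\Gamma$ is $\Gamma$ itself or the intersection of $\Gamma$ with a supporting hyperplane. For a polynomial $h=\sum_\omega a_\omega x^\omega$ and a face $\tau$ put $h_\tau=\sum_{\omega\in\tau}a_\omega x^\omega$; for a face $\tau$ of $\Gamma_{\mathbf{f}}$ put $\mathbf{f}_\tau=(f_{1,\tau},\ldots,f_{t,\tau})$. The polynomial $g$ is non-degenerated over $\mathbf{F}_p$ with respect to $\Gamma_g$ if for every face $\tau'$ of $\Gamma_g$ (including $\Gamma_g$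 itself) there is no $a\in(\mathbf{F}_p^\times)^n$ with $\overline{g_{\tau'}}(a)=0$ and $\frac{\partial\overline{g_{\tau'}}}{\partial x_i}(a)=0$ for all $i$. The mapping $\mathbf{f}$ is strongly non-degenerated over $\mathbf{F}_p$ with respect to $\Gamma_{\mathbf{f}}$ if for every face $\tau$ of $\Gamma_{\mathbf{f}}$ and all $a\in(\mathbf{F}_p^\times)^n$ with $\overline{\mathbf{f}_\tau}(a)=0$, the Jacobian matrix $\left((\partial\overline{f_{i,\tau}}/\partial x_j)(a)\right)_{i,j}$ over $\mathbf{F}_p$ has maximal rank $\min(t,n)$. For $k\in\mathbf{R}_{\geqslant0}^n$ put $m_{\mathbf{f}}(k)=\inf_{x\in\Gamma_{\mathbf{f}}}k\cdot x$, $m_g(k)=\inf_{x\in\Gamma_g}k\cdot x$, $F_{\mathbf{f}}(k)=\{x\in\Gamma_{\mathbf{f}}\mid k\cdot x=m_{\mathbf{f}}(k)\}$, $F_g(k)=\{x\in\Gamma_g\mid k\cdot x=m_g(k)\}$ and $\sigma(k)=k_1+\cdots+k_n$. For faces $\tau$ of $\Gamma_{\mathbf{f}}$ and $\tau'$ of $\Gamma_g$ put $\Delta_{\mathbf{f}}(\tau)=\{k\in\mathbf{R}_{\geqslant0}^n\mid F_{\mathbf{f}}(k)=\tau\}$ and $\Delta_g(\tau')=\{k\in\mathbf{R}_{\geqslant0}^n\mid F_g(k)=\tau'\}$. The partition $\Delta_{\mathbf{f},g}$ of $\mathbf{R}_{\geqslant0}^n$ is the set of all nonempty intersections $\delta=\Delta_{\mathbf{f}}(\tau)\cap\Delta_g(\tau')$.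 Each $\delta\in\Delta_{\mathbf{f},g}$ determines $\tau$ and $\tau'$ uniquely; put $\mathbf{f}_\delta=\mathbf{f}_\tau$, $f_{i,\delta}=f_{i,\tau}$, $g_\delta=g_{\tau'}$ and $N_\delta=\#\{a\in(\mathbf{F}_p^\times)^n\mid\overline{\mathbf{f}_\delta}(a)=0,\ \overline{g_\delta}(a)\neq0\}$, $P_\delta=\#\{a\in(\mathbf{F}_p^\times)^n\mid\overline{\mathbf{f}_\delta}(a)\neq0,\ \overline{g_\delta}(a)=0\}$, $Q_\delta=\#\{a\in(\mathbf{F}_p^\times)^n\mid\overline{\mathbf{f}_\delta}(a)=0,\ \overline{g_\delta}(a)=0\}$. The pair $(\mathbf{f},g)$ is strongly non-degenerated over $\mathbf{F}_p$ with respect to $\Delta_{\mathbf{f},g}$ if for every $\delta\in\Delta_{\mathbf{f},g}$ and all $a\in(\mathbf{F}_p^\times)^n$ with $\overline{f_{1,\delta}}(a)=\cdots=\overline{f_{t,\delta}}(a)=\overline{g_\delta}(a)=0$, the $(t+1)\times n$ Jacobian matrix of $(\overline{f_{1,\delta}},\ldots,\overline{f_{t,\delta}},\overline{g_\delta})$ at $a$ has maximal rank $t+1$. Cones: the cone strictly positively spanned by $k_1,\ldots,k_r$ is $\{\lambda_1k_1+\cdots+\lambda_rk_r\mid\lambda_i>0\}$ (equal to $\{0\}$ if $r=0$). It is rational if the spanning vectors can be chosen in $\mathbf{Z}^n$, and simplicial if they can be chosen linearly independent over $\mathbf{R}$. A vector is primitive if its components are integers with greatest common divisor one. A ray is a cone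 of dimension one. Each $\delta\in\Delta_{\mathbf{f},g}$ is a rational cone strictly positively spanned by the primitive generators of the one-dimensional faces of its closure (which give rays in $\Delta_{\mathbf{f},g}$); a partition of $\delta$ into simplicial cones is without introducing new rays if each of its cones is strictly positively spanned by a linearly independent subset of these generators. For $\delta=\{0\}$ the trivial partition ($r=0$, $h=0$, empty product equal to $1$) is used.
   Formalization: In the list of real parts of candidate poles, -1 is replaced by -t (same for t=1), since -1 fails for t≥2, e.g. f=(x-y,y-z), g=z has poles with real part -2; primitive ray generators k with m_f(k)=0, where the quotient is undefined, are left out. *)

theory Defs
  imports
    "HOL-Analysis.Analysis"
    "HOL-Complex_Analysis.Meromorphic"
    "HOL-Computational_Algebra.Fraction_Field"
    "HOL-Library.Poly_Mapping"
    "Berlekamp_Zassenhaus.Finite_Field"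
begin

unbundle no fps_syntax

section \<open>The \<open>p\<close>-adic numbers\<close>

text \<open>
  The prime \<open>p\<close> is the cardinality of a type of class \<open>prime_card\<close>, so that \<open>'p mod_ring\<close> is the
  field \<open>F\<^sub>p\<close>. A \<open>p\<close>-adic integer is a coherent sequence of residues: the \<open>n\<close>-th component is the
  representative in \<open>{0..<p^n}\<close> of the class modulo \<open>p^n\<close>.
\<close>

typedef ('p::prime_card) padic_int =
  "{x :: nat \<Rightarrow> int. \<forall>n. x n \<in> {0..<int CARD('p) ^ n} \<and> x (Suc n) mod int CARD('p) ^ n = x n}"
proof -
  have "int CARD('p) > 0" by (simp add: prime_card prime_gt_0_nat)
  thus ?thesis by (intro exI[of _ "\<lambda>_. 0"]) auto
qed

setup_lifting type_definition_padic_int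

lemma int_card_pos: "int CARD('p::prime_card) > 0"
  using prime_card[where 'a='p] prime_gt_0_nat by simp

lemma int_card_gt_1: "int CARD('p::prime_card) > 1"
  using prime_card[where 'a='p] prime_gt_1_nat by simp

lemma coherent_mod:
  fixes x :: "nat \<Rightarrow> int"
  assumes "(q::int) > 0"
    and "\<And>n. x n \<in> {0..<q ^ n} \<and> x (Suc n) mod q ^ n = x n" and "m \<le> n"
  shows "x n mod q ^ m = x m"
  using \<open>m \<le> n\<close>
proof (induction n rule: dec_induct)
  case base
  show ?case using assms(2)[of m] by simp
next
  case (step n)
  have "x (Suc n) mod q ^ m = (x (Suc n) mod q ^ n) mod q ^ m"
    using step.hyps by (simp add: mod_mod_cancel le_imp_power_dvd)
  also have "\<dots> = x n mod q ^ m" using assms(2)[of n] by simp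
  finally show ?case using step.IH by simp
qed

lemma coherent_modI:
  assumes "(q::int) > 0" and "y (Suc n) mod q ^ n = y n mod q ^ n"
  shows "y n mod q ^ n \<in> {0..<q ^ n} \<and> (y (Suc n) mod q ^ Suc n) mod q ^ n = y n mod q ^ n"
  using assms mod_mod_cancel[of "q ^ n" "q ^ Suc n" "y (Suc n)"] by (simp add: le_imp_power_dvd)

instantiation padic_int :: (prime_card) comm_ring_1
begin

lift_definition zero_padic_int :: "'a padic_int" is "\<lambda>_. 0"
  using int_card_pos[where 'p='a] by simp

lift_definition one_padic_int :: "'a padic_int" is "\<lambda>n. 1 mod int CARD('a) ^ n"
  subgoal for n
    using coherent_modI[OF int_card_pos[where 'p='a], of "\<lambda>_. 1" n] by simp
  done

lift_definition plus_padic_int :: "'a padic_int \<Rightarrow> 'a padic_int \<Rightarrow> 'a padic_int"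
  is "\<lambda>x y n. (x n + y n) mod int CARD('a) ^ n"
  subgoal for x y n
    by (rule coherent_modI[OF int_card_pos[where 'p='a], of "\<lambda>n. x n + y n" n], rule mod_add_cong) auto
  done

lift_definition minus_padic_int :: "'a padic_int \<Rightarrow> 'a padic_int \<Rightarrow> 'a padic_int"
  is "\<lambda>x y n. (x n - y n) mod int CARD('a) ^ n"
  subgoal for x y n
    by (rule coherent_modI[OF int_card_pos[where 'p='a], of "\<lambda>n. x n - y n" n], rule mod_diff_cong) auto
  done

lift_definition times_padic_int :: "'a padic_int \<Rightarrow> 'a padic_int \<Rightarrow> 'a padic_int"
  is "\<lambda>x y n. (x n * y n) mod int CARD('a) ^ n"
  subgoal for x y n
    by (rule coherent_modI[OF int_card_pos[where 'p='a], of "\<lambda>n. x n * y n" n], rule mod_mult_cong) auto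
  done

lift_definition uminus_padic_int :: "'a padic_int \<Rightarrow> 'a padic_int"
  is "\<lambda>x n. (- x n) mod int CARD('a) ^ n"
  subgoal for x n
    by (rule coherent_modI[OF int_card_pos[where 'p='a], of "\<lambda>n. - x n" n], rule mod_minus_cong) auto
  done

instance
proof
  fix a b c :: "'a padic_int"
  show "a * b * c = a * (b * c)"
    by transfer (auto simp: mod_simps algebra_simps)
  show "a * b = b * a" by transfer (simp add: mult.commute)
  show "1 * a = a" by transfer (auto simp: mod_simps)
  show "a + b + c = a + (b + c)"
    by transfer (auto simp: mod_simps algebra_simps)
  show "a + b = b + a" by transfer (simp add: add.commute)
  show "0 + a = a" by transfer auto
  show "- a + a = 0" by transfer (auto simp: mod_simps)
  show "a - b = a + - b" by transfer (auto simp: mod_simps)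
  show "(a + b) * c = a * c + b * c"
    by transfer (auto simp: mod_simps algebra_simps)
  show "(0::'a padic_int) \<noteq> 1"
  proof (transfer, rule notI)
    assume "(\<lambda>_. 0) = (\<lambda>n. 1 mod int CARD('a) ^ n)"
    from fun_cong[OF this, of 1] show False
      using int_card_gt_1[where 'p='a] by simp
  qed
qed

end

lift_definition padic_digits :: "'p::prime_card padic_int \<Rightarrow> nat \<Rightarrow> int" is "\<lambda>x. x" .

definition padic_val :: "'p::prime_card padic_int \<Rightarrow> nat" where
  "padic_val x = (LEAST n. padic_digits x (Suc n) \<noteq> 0)"

definition padic_int_norm :: "'p::prime_card padic_int \<Rightarrow> real" where
  "padic_int_norm x = (if x = 0 then 0 else (1 / real CARD('p)) ^ padic_val x)"

definition residue :: "'p::prime_card padic_int \<Rightarrow> 'p mod_ring" where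
  "residue x = of_int (padic_digits x 1)"

lemma padic_digits_eq_0_iff:
  fixes x :: "'p::prime_card padic_int"
  assumes "m \<le> n"
  shows "padic_digits x m = 0 \<longleftrightarrow> int CARD('p) ^ m dvd padic_digits x n"
proof -
  have "padic_digits x n mod int CARD('p) ^ m = padic_digits x m"
    using assms
    by transfer (rule coherent_mod, use int_card_pos[where 'p='p] in auto)
  thus ?thesis by (simp add: dvd_eq_mod_eq_0)
qed

lemma padic_digits_0 [simp]: "padic_digits (x :: 'p::prime_card padic_int) 0 = 0"
proof transfer
  fix x :: "nat \<Rightarrow> int"
  assume "\<forall>n. x n \<in> {0..<int CARD('p) ^ n} \<and> x (Suc n) mod int CARD('p) ^ n = x n"
  hence "x 0 \<in> {0..<int CARD('p) ^ 0}" by blast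
  thus "x 0 = 0" by simp
qed

lemma padic_digits_zero: "padic_digits (0 :: 'p::prime_card padic_int) n = 0"
  by transfer simp

lemma padic_eq_0_iff: "(x :: 'p::prime_card padic_int) = 0 \<longleftrightarrow> (\<forall>n. padic_digits x n = 0)"
  by transfer auto

lemma digits_eq_0_iff_le_val:
  fixes x :: "'p::prime_card padic_int"
  assumes "x \<noteq> 0"
  shows "padic_digits x m = 0 \<longleftrightarrow> m \<le> padic_val x"
proof -
  obtain k where "padic_digits x k \<noteq> 0" using assms padic_eq_0_iff by blast
  hence ex: "\<exists>n. padic_digits x (Suc n) \<noteq> 0" by (cases k) auto
  have a: "padic_digits x (Suc (padic_val x)) \<noteq> 0"
    unfolding padic_val_def by (rule LeastI_ex[OF ex])
  have mono: "padic_digits x i = 0" if "i \<le> j" "padic_digits x j = 0" for i j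
    using padic_digits_eq_0_iff[OF that(1), of x] that(2) by simp
  show ?thesis
  proof
    assume "padic_digits x m = 0"
    with a mono[of "Suc (padic_val x)" m] show "m \<le> padic_val x" by force
  next
    assume le: "m \<le> padic_val x"
    show "padic_digits x m = 0"
    proof (cases m)
      case (Suc k)
      with le have "k < padic_val x" by simp
      from not_less_Least[OF this[unfolded padic_val_def]] Suc show ?thesis by simp
    qed simp
  qed
qed

lemma multiplicity_digits:
  fixes x :: "'p::prime_card padic_int"
  assumes "x \<noteq> 0" "n > padic_val x"
  shows "multiplicity (int CARD('p)) (padic_digits x n) = padic_val x"
proof (rule multiplicity_eqI)
  show "int CARD('p) ^ padic_val x dvd padic_digits x n"
    using padic_digits_eq_0_iff[of "padic_val x" n x] digits_eq_0_iff_le_val[OF assms(1)] assms(2)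
    by simp
  show "\<not> int CARD('p) ^ Suc (padic_val x) dvd padic_digits x n"
    using padic_digits_eq_0_iff[of "Suc (padic_val x)" n x] digits_eq_0_iff_le_val[OF assms(1)] assms(2)
    by (simp del: power_Suc)
qed

lemma padic_digits_times:
  "padic_digits (x * y :: 'p::prime_card padic_int) n
     = (padic_digits x n * padic_digits y n) mod int CARD('p) ^ n"
  by transfer simp

lemma padic_digits_plus:
  "padic_digits (x + y :: 'p::prime_card padic_int) n
     = (padic_digits x n + padic_digits y n) mod int CARD('p) ^ n"
  by transfer simp

lemma padic_times_digit_eq_0_iff:
  fixes x y :: "'p::prime_card padic_int"
  assumes "x \<noteq> 0" "y \<noteq> 0"
  shows "padic_digits (x * y) m = 0 \<longleftrightarrow> m \<le> padic_val x + padic_val y"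
proof -
  define n where "n = m + padic_val x + padic_val y + 1"
  have p: "prime (int CARD('p))" using prime_card[where 'a='p] by simp
  have nz: "padic_digits x n \<noteq> 0" "padic_digits y n \<noteq> 0"
    using digits_eq_0_iff_le_val[OF assms(1), of n] digits_eq_0_iff_le_val[OF assms(2), of n]
    by (auto simp: n_def)
  have "padic_digits (x * y) m = 0 \<longleftrightarrow> int CARD('p) ^ m dvd padic_digits (x * y) n"
    by (rule padic_digits_eq_0_iff) (simp add: n_def)
  also have "\<dots> \<longleftrightarrow> int CARD('p) ^ m dvd padic_digits x n * padic_digits y n"
    unfolding padic_digits_times by (rule dvd_mod_iff) (simp add: n_def le_imp_power_dvd)
  also have "\<dots> \<longleftrightarrow> m \<le> multiplicity (int CARD('p)) (padic_digits x n * padic_digits y n)"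
    by (rule power_dvd_iff_le_multiplicity)
       (use nz p in \<open>auto simp: prime_elem_multiplicity_mult_distrib\<close>)
  also have "multiplicity (int CARD('p)) (padic_digits x n * padic_digits y n)
      = padic_val x + padic_val y"
    using nz p multiplicity_digits[OF assms(1), of n] multiplicity_digits[OF assms(2), of n]
    by (simp add: prime_elem_multiplicity_mult_distrib n_def)
  finally show ?thesis .
qed

instance padic_int :: (prime_card) idom
proof
  fix x y :: "'a padic_int"
  assume "x \<noteq> 0" "y \<noteq> 0"
  from padic_times_digit_eq_0_iff[OF this, of "Suc (padic_val x + padic_val y)"]
  show "x * y \<noteq> 0" using padic_digits_zero by (metis not_less_eq_eq order_refl)
qed

lemma padic_val_times:
  fixes x y :: "'p::prime_card padic_int"
  assumes "x \<noteq> 0" "y \<noteq> 0"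
  shows "padic_val (x * y) = padic_val x + padic_val y"
proof -
  have "m \<le> padic_val (x * y) \<longleftrightarrow> m \<le> padic_val x + padic_val y" for m
    using padic_times_digit_eq_0_iff[OF assms] digits_eq_0_iff_le_val[of "x * y"] assms by simp
  thus ?thesis by (meson le_antisym order_refl)
qed

lemma padic_int_norm_times:
  "padic_int_norm (x * y) = padic_int_norm x * padic_int_norm y"
  by (auto simp: padic_int_norm_def padic_val_times power_add)

lemma padic_int_norm_eq_0_iff [simp]: "padic_int_norm x = 0 \<longleftrightarrow> x = 0"
  for x :: "'p::prime_card padic_int"
  using int_card_pos[where 'p='p] by (auto simp: padic_int_norm_def)

lemma padic_int_norm_nonneg [simp]: "padic_int_norm x \<ge> 0"
  by (auto simp: padic_int_norm_def)

lemma padic_int_norm_ultra: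
  "padic_int_norm (x + y) \<le> max (padic_int_norm x) (padic_int_norm y)"
  for x y :: "'p::prime_card padic_int"
proof (cases "x = 0 \<or> y = 0 \<or> x + y = 0")
  case True
  thus ?thesis by (auto simp: padic_int_norm_def[of "0 :: 'p padic_int"] max_def)
next
  case False
  hence nz: "x \<noteq> 0" "y \<noteq> 0" "x + y \<noteq> 0" by auto
  let ?m = "min (padic_val x) (padic_val y)"
  have "padic_digits (x + y) ?m = 0"
    using digits_eq_0_iff_le_val[OF nz(1), of ?m] digits_eq_0_iff_le_val[OF nz(2), of ?m]
    by (simp add: padic_digits_plus)
  hence "?m \<le> padic_val (x + y)" using digits_eq_0_iff_le_val[OF nz(3)] by simp
  hence "(1 / real CARD('p)) ^ padic_val (x + y) \<le> (1 / real CARD('p)) ^ ?m"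
    using int_card_pos[where 'p='p] by (intro power_decreasing) auto
  thus ?thesis using nz by (auto simp: padic_int_norm_def min_def max_def split: if_splits)
qed

lemma padic_int_norm_minus: "padic_int_norm (- x) = padic_int_norm x"
proof -
  have "padic_int_norm (-1 :: 'a padic_int) ^ 2 = padic_int_norm ((-1) * (-1) :: 'a padic_int)"
    by (simp only: padic_int_norm_times power2_eq_square)
  also have "\<dots> = padic_int_norm (1 :: 'a padic_int)" by simp
  also have "padic_int_norm (1 :: 'a padic_int) = 1"
    using padic_int_norm_times[of 1 "1 :: 'a padic_int"]
    by (metis mult_cancel_right2 mult_1 padic_int_norm_eq_0_iff one_neq_zero)
  finally have "padic_int_norm (-1 :: 'a padic_int) = 1"
    using padic_int_norm_nonneg[of "-1 :: 'a padic_int"] by (simp add: power2_eq_1_iff)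
  thus ?thesis using padic_int_norm_times[of "-1" x] by simp
qed

definition fract_norm :: "'p::prime_card padic_int fract \<Rightarrow> real" where
  "fract_norm x = (THE r. \<exists>a b. b \<noteq> 0 \<and> x = Fract a b \<and> r = padic_int_norm a / padic_int_norm b)"

lemma fract_norm_Fract:
  assumes "b \<noteq> 0"
  shows "fract_norm (Fract a b) = padic_int_norm a / padic_int_norm b"
  unfolding fract_norm_def
proof (rule the_equality)
  show "\<exists>a' b'. b' \<noteq> 0 \<and> Fract a b = Fract a' b'
          \<and> padic_int_norm a / padic_int_norm b = padic_int_norm a' / padic_int_norm b'"
    using assms by blast
next
  fix r
  assume "\<exists>a' b'. b' \<noteq> 0 \<and> Fract a b = Fract a' b' \<and> r = padic_int_norm a' / padic_int_norm b'"
  then obtain a' b' where b': "b' \<noteq> 0" "Fract a b = Fract a' b'"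
    and r: "r = padic_int_norm a' / padic_int_norm b'" by blast
  have "a * b' = a' * b" using b' assms by (simp add: eq_fract)
  hence "padic_int_norm a * padic_int_norm b' = padic_int_norm a' * padic_int_norm b"
    by (metis padic_int_norm_times)
  thus "r = padic_int_norm a / padic_int_norm b"
    using assms b'(1) r by (simp add: frac_eq_eq)
qed

lemma fract_norm_eq_0_iff: "fract_norm x = 0 \<longleftrightarrow> x = 0"
  by (cases x) (auto simp: fract_norm_Fract eq_fract Zero_fract_def)

lemma fract_norm_minus: "fract_norm (- x) = fract_norm x"
  by (cases x) (simp add: fract_norm_Fract padic_int_norm_minus)

lemma fract_norm_nonneg: "fract_norm x \<ge> 0"
  by (cases x) (simp add: fract_norm_Fract)

lemma fract_norm_ultra: "fract_norm (x + y) \<le> max (fract_norm x) (fract_norm y)"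
proof (cases x, cases y)
  fix a b c d
  assume x: "x = Fract a b" "b \<noteq> 0" and y: "y = Fract c d" "d \<noteq> 0"
  have pos: "padic_int_norm b > 0" "padic_int_norm d > 0"
    using x(2) y(2) padic_int_norm_nonneg padic_int_norm_eq_0_iff by (metis less_eq_real_def)+
  have "fract_norm (x + y) = padic_int_norm (a * d + c * b) / (padic_int_norm b * padic_int_norm d)"
    using x y by (simp add: fract_norm_Fract padic_int_norm_times)
  also have "\<dots> \<le> max (padic_int_norm a * padic_int_norm d) (padic_int_norm c * padic_int_norm b)
      / (padic_int_norm b * padic_int_norm d)"
    using pos padic_int_norm_ultra[of "a * d" "c * b"]
    by (intro divide_right_mono) (auto simp: padic_int_norm_times)
  also have "\<dots> = max (fract_norm x) (fract_norm y)"
    using x y pos by (simp add: fract_norm_Fract max_def field_simps)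
  finally show ?thesis .
qed

text \<open>\<open>Q\<^sub>p\<close>, a copy of the fraction field of \<open>Z\<^sub>p\<close> that can carry its own norm and topology.\<close>

typedef (overloaded) ('p::prime_card) padic = "UNIV :: 'p padic_int fract set" by simp

setup_lifting type_definition_padic

instantiation padic :: (prime_card) field
begin

lift_definition zero_padic :: "'a padic" is 0 .
lift_definition one_padic :: "'a padic" is 1 .
lift_definition plus_padic :: "'a padic \<Rightarrow> 'a padic \<Rightarrow> 'a padic" is plus .
lift_definition minus_padic :: "'a padic \<Rightarrow> 'a padic \<Rightarrow> 'a padic" is minus .
lift_definition uminus_padic :: "'a padic \<Rightarrow> 'a padic" is uminus .
lift_definition times_padic :: "'a padic \<Rightarrow> 'a padic \<Rightarrow> 'a padic" is times .
lift_definition inverse_padic :: "'a padic \<Rightarrow> 'a padic" is inverse .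
lift_definition divide_padic :: "'a padic \<Rightarrow> 'a padic \<Rightarrow> 'a padic" is divide .

instance
  by standard (transfer; simp add: algebra_simps divide_inverse)+

end

lift_definition padic_norm :: "'p::prime_card padic \<Rightarrow> real" is fract_norm .

instantiation padic :: (prime_card) metric_space
begin

definition dist_padic :: "'a padic \<Rightarrow> 'a padic \<Rightarrow> real" where
  "dist_padic x y = padic_norm (x - y)"

definition uniformity_padic :: "('a padic \<times> 'a padic) filter" where
  "uniformity_padic = (INF e\<in>{0<..}. principal {(x, y). dist x y < e})"

definition open_padic :: "'a padic set \<Rightarrow> bool" where
  "open_padic U \<longleftrightarrow> (\<forall>x\<in>U. \<forall>\<^sub>F (x', y) in uniformity. x' = x \<longrightarrow> y \<in> U)"

instance
proof
  fix x y z :: "'a padic"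
  show "dist x y = 0 \<longleftrightarrow> x = y"
    unfolding dist_padic_def by transfer (simp add: fract_norm_eq_0_iff)
  have "padic_norm (x - y) \<le> max (padic_norm (x - z)) (padic_norm (y - z))"
  proof transfer
    fix x y z :: "'a padic_int fract"
    have "x - y = (x - z) + - (y - z)" by simp
    thus "fract_norm (x - y) \<le> max (fract_norm (x - z)) (fract_norm (y - z))"
      using fract_norm_ultra[of "x - z" "- (y - z)"] by (simp only: fract_norm_minus)
  qed
  also have "\<dots> \<le> padic_norm (x - z) + padic_norm (y - z)"
    by (transfer, simp add: fract_norm_nonneg)
  finally show "dist x y \<le> dist x z + dist y z" unfolding dist_padic_def .
qed (rule uniformity_padic_def open_padic_def)+

end

definition of_padic_int :: "'p::prime_card padic_int \<Rightarrow> 'p padic" where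
  "of_padic_int a = Abs_padic (Fract a 1)"

definition Zp_cube :: "('p::prime_card padic ^ 'n) set" where
  "Zp_cube = {x. \<forall>i. x $ i \<in> range of_padic_int}"

definition max_norm :: "'p::prime_card padic ^ 't::finite \<Rightarrow> real" where
  "max_norm y = Max (range (\<lambda>i. padic_norm (y $ i)))"

text \<open>These properties determine the Haar measure uniquely among Borel measures on \<open>Q\<^sub>p\<^sup>n\<close>.\<close>

definition normalized_haar :: "('p::prime_card padic ^ 'n::finite) measure \<Rightarrow> bool" where
  "normalized_haar \<mu> \<longleftrightarrow>
     sets \<mu> = sets borel \<and>
     (\<forall>a. \<forall>A\<in>sets borel. emeasure \<mu> ((+) a ` A) = emeasure \<mu> A) \<and>
     emeasure \<mu> Zp_cube = 1"


section \<open>Polynomials in several variables\<close>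

type_synonym ('n, 'a) mpolynomial = "('n \<Rightarrow>\<^sub>0 nat) \<Rightarrow>\<^sub>0 'a"

definition mp_eval :: "('n::finite, 'a::comm_ring_1) mpolynomial \<Rightarrow> 'a ^ 'n \<Rightarrow> 'a" where
  "mp_eval h x = (\<Sum>\<omega>\<in>Poly_Mapping.keys h.
     Poly_Mapping.lookup h \<omega> * (\<Prod>i\<in>UNIV. (x $ i) ^ Poly_Mapping.lookup \<omega> i))"

definition mp_pderiv ::
    "'n::finite \<Rightarrow> ('n, 'a::comm_ring_1) mpolynomial \<Rightarrow> ('n, 'a) mpolynomial" where
  "mp_pderiv j h = (\<Sum>\<omega>\<in>Poly_Mapping.keys h.
     Poly_Mapping.single (\<omega> - Poly_Mapping.single j 1)
       (of_nat (Poly_Mapping.lookup \<omega> j) * Poly_Mapping.lookup h \<omega>))"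

definition exponent_vec :: "('n \<Rightarrow>\<^sub>0 nat) \<Rightarrow> real ^ 'n::finite" where
  "exponent_vec \<omega> = (\<chi> i. real (Poly_Mapping.lookup \<omega> i))"

lift_definition mp_part ::
    "(real ^ 'n::finite) set \<Rightarrow> ('n, 'a::zero) mpolynomial \<Rightarrow> ('n, 'a) mpolynomial"
  is "\<lambda>\<tau> h \<omega>. if exponent_vec \<omega> \<in> \<tau> then h \<omega> else 0"
  by (erule finite_subset[rotated]) auto

definition map_part ::
    "(real ^ 'n::finite) set \<Rightarrow> ('n, 'a::zero) mpolynomial ^ 't \<Rightarrow> ('n, 'a) mpolynomial ^ 't" where
  "map_part \<tau> f = (\<chi> i. mp_part \<tau> (f $ i))"

definition padic_eval :: "('n::finite, 'p::prime_card padic_int) mpolynomial \<Rightarrow> 'p padic ^ 'n \<Rightarrow> 'p padic" where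
  "padic_eval h = mp_eval (Poly_Mapping.map of_padic_int h)"

definition padic_map ::
    "('n::finite, 'p::prime_card padic_int) mpolynomial ^ 't \<Rightarrow> 'p padic ^ 'n \<Rightarrow> 'p padic ^ 't" where
  "padic_map f x = (\<chi> i. padic_eval (f $ i) x)"

definition mp_reduce :: "('n, 'p::prime_card padic_int) mpolynomial \<Rightarrow> ('n, 'p mod_ring) mpolynomial" where
  "mp_reduce h = Poly_Mapping.map residue h"

definition map_reduce ::
    "('n, 'p::prime_card padic_int) mpolynomial ^ 't \<Rightarrow> ('n, 'p mod_ring) mpolynomial ^ 't" where
  "map_reduce f = (\<chi> i. mp_reduce (f $ i))"

definition map_eval :: "('n::finite, 'a::comm_ring_1) mpolynomial ^ 't \<Rightarrow> 'a ^ 'n \<Rightarrow> 'a ^ 't" where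
  "map_eval f a = (\<chi> i. mp_eval (f $ i) a)"

definition jacobian :: "('n::finite, 'a::comm_ring_1) mpolynomial ^ 't \<Rightarrow> 'a ^ 'n \<Rightarrow> 'a ^ 'n ^ 't" where
  "jacobian f a = (\<chi> i j. mp_eval (mp_pderiv j (f $ i)) a)"

definition torus :: "('a::zero ^ 'n) set" where
  "torus = {a. \<forall>i. a $ i \<noteq> 0}"


section \<open>Newton polyhedra and the associated partition\<close>

definition orthant :: "(real ^ 'n) set" where
  "orthant = {k. \<forall>i. 0 \<le> k $ i}"

definition newton_polyhedron :: "('n \<Rightarrow>\<^sub>0 nat) set \<Rightarrow> (real ^ 'n::finite) set" where
  "newton_polyhedron \<Omega> = convex hull (\<Union>\<omega>\<in>\<Omega>. (\<lambda>y. exponent_vec \<omega> + y) ` orthant)"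

definition Gam_g :: "('n::finite, 'a::zero) mpolynomial \<Rightarrow> (real ^ 'n) set" where
  "Gam_g g = newton_polyhedron (Poly_Mapping.keys g)"

definition Gam_f :: "('n::finite, 'a::zero) mpolynomial ^ 't \<Rightarrow> (real ^ 'n) set" where
  "Gam_f f = newton_polyhedron (\<Union>i. Poly_Mapping.keys (f $ i))"

text \<open>
  \<open>exposed_face_of\<close> allows the normal vector \<open>0\<close>, which yields the polyhedron itself, but also the
  empty set, which is not the intersection with a supporting hyperplane.
\<close>

definition is_face :: "(real ^ 'n::finite) set \<Rightarrow> (real ^ 'n) set \<Rightarrow> bool" where
  "is_face \<tau> \<Gamma> \<longleftrightarrow> \<tau> exposed_face_of \<Gamma> \<and> \<tau> \<noteq> {}"

definition min_val :: "(real ^ 'n::finite) set \<Rightarrow> real ^ 'n \<Rightarrow> real" where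
  "min_val \<Gamma> k = (INF x\<in>\<Gamma>. k \<bullet> x)"

definition first_meet :: "(real ^ 'n::finite) set \<Rightarrow> real ^ 'n \<Rightarrow> (real ^ 'n) set" where
  "first_meet \<Gamma> k = {x \<in> \<Gamma>. k \<bullet> x = min_val \<Gamma> k}"

definition sigma :: "real ^ 'n::finite \<Rightarrow> real" where
  "sigma k = (\<Sum>i\<in>UNIV. k $ i)"

definition dual_cone :: "(real ^ 'n::finite) set \<Rightarrow> (real ^ 'n) set \<Rightarrow> (real ^ 'n) set" where
  "dual_cone \<Gamma> \<tau> = {k \<in> orthant. first_meet \<Gamma> k = \<tau>}"

definition Delta ::
    "('n::finite, 'a::zero) mpolynomial ^ 't \<Rightarrow> ('n, 'a) mpolynomial \<Rightarrow> (real ^ 'n) set set" where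
  "Delta f g = {dual_cone (Gam_f f) \<tau> \<inter> dual_cone (Gam_g g) \<tau>' | \<tau> \<tau>'.
      is_face \<tau> (Gam_f f) \<and> is_face \<tau>' (Gam_g g)} - {{}}"

text \<open>The unique face \<open>\<tau>\<close> of \<open>\<Gamma>\<close> whose dual cone contains the nonempty cell \<open>\<delta>\<close>.\<close>

definition cell_face :: "(real ^ 'n::finite) set \<Rightarrow> (real ^ 'n) set \<Rightarrow> (real ^ 'n) set" where
  "cell_face \<Gamma> \<delta> = (THE \<tau>. is_face \<tau> \<Gamma> \<and> \<delta> \<subseteq> dual_cone \<Gamma> \<tau>)"

definition f_cell ::
    "('n::finite, 'a::zero) mpolynomial ^ 't \<Rightarrow> (real ^ 'n) set \<Rightarrow> ('n, 'a) mpolynomial ^ 't" where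
  "f_cell f \<delta> = map_part (cell_face (Gam_f f) \<delta>) f"

definition g_cell ::
    "('n::finite, 'a::zero) mpolynomial \<Rightarrow> (real ^ 'n) set \<Rightarrow> ('n, 'a) mpolynomial" where
  "g_cell g \<delta> = mp_part (cell_face (Gam_g g) \<delta>) g"


section \<open>Non-degeneracy\<close>

definition nondegenerate :: "('n::finite, 'p::prime_card padic_int) mpolynomial \<Rightarrow> bool" where
  "nondegenerate g \<longleftrightarrow> (\<forall>\<tau>'. is_face \<tau>' (Gam_g g) \<longrightarrow>
     (let h = mp_reduce (mp_part \<tau>' g)
      in \<not> (\<exists>a\<in>torus. mp_eval h a = 0 \<and> (\<forall>i. mp_eval (mp_pderiv i h) a = 0))))"

definition strongly_nondegenerate ::
    "('n::finite, 'p::prime_card padic_int) mpolynomial ^ 't::finite \<Rightarrow> bool" where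
  "strongly_nondegenerate f \<longleftrightarrow> (\<forall>\<tau>. is_face \<tau> (Gam_f f) \<longrightarrow>
     (let h = map_reduce (map_part \<tau> f)
      in \<forall>a\<in>torus. map_eval h a = 0 \<longrightarrow> rank (jacobian h a) = min CARD('t) CARD('n)))"

text \<open>The mapping \<open>(f\<^sub>1, \<dots>, f\<^sub>t, g)\<close>, with \<open>None\<close> as the index of the last component.\<close>

definition adjoin :: "'a ^ 't \<Rightarrow> 'a \<Rightarrow> 'a ^ ('t::finite) option" where
  "adjoin f g = (\<chi> i. case i of None \<Rightarrow> g | Some j \<Rightarrow> f $ j)"

definition pair_strongly_nondegenerate ::
    "('n::finite, 'p::prime_card padic_int) mpolynomial ^ 't::finite
       \<Rightarrow> ('n, 'p padic_int) mpolynomial \<Rightarrow> bool" where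
  "pair_strongly_nondegenerate f g \<longleftrightarrow> (\<forall>\<delta>\<in>Delta f g.
     (let h = map_reduce (adjoin (f_cell f \<delta>) (g_cell g \<delta>))
      in \<forall>a\<in>torus. map_eval h a = 0 \<longrightarrow> rank (jacobian h a) = CARD('t) + 1))"


section \<open>The zeta function and the terms of the formula\<close>

definition zeta_integrand ::
    "('n::finite, 'p::prime_card padic_int) mpolynomial ^ 't::finite \<Rightarrow> ('n, 'p padic_int) mpolynomial
       \<Rightarrow> complex \<Rightarrow> 'p padic ^ 'n \<Rightarrow> complex" where
  "zeta_integrand f g s x =
     complex_of_real (max_norm (padic_map f x)) powr s * complex_of_real (padic_norm (padic_eval g x))"

definition zeta ::
    "('p::prime_card padic ^ 'n) measure \<Rightarrow> ('n::finite, 'p padic_int) mpolynomial ^ 't::finite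
       \<Rightarrow> ('n, 'p padic_int) mpolynomial \<Rightarrow> complex \<Rightarrow> complex" where
  "zeta \<mu> f g s = (LINT x:Zp_cube|\<mu>. zeta_integrand f g s x)"

definition N_cell ::
    "('n::finite, 'p::prime_card padic_int) mpolynomial ^ 't \<Rightarrow> ('n, 'p padic_int) mpolynomial
       \<Rightarrow> (real ^ 'n) set \<Rightarrow> nat" where
  "N_cell f g \<delta> = card {a \<in> torus.
     map_eval (map_reduce (f_cell f \<delta>)) a = 0 \<and> mp_eval (mp_reduce (g_cell g \<delta>)) a \<noteq> 0}"

definition P_cell ::
    "('n::finite, 'p::prime_card padic_int) mpolynomial ^ 't \<Rightarrow> ('n, 'p padic_int) mpolynomial
       \<Rightarrow> (real ^ 'n) set \<Rightarrow> nat" where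
  "P_cell f g \<delta> = card {a \<in> torus.
     map_eval (map_reduce (f_cell f \<delta>)) a \<noteq> 0 \<and> mp_eval (mp_reduce (g_cell g \<delta>)) a = 0}"

definition Q_cell ::
    "('n::finite, 'p::prime_card padic_int) mpolynomial ^ 't \<Rightarrow> ('n, 'p padic_int) mpolynomial
       \<Rightarrow> (real ^ 'n) set \<Rightarrow> nat" where
  "Q_cell f g \<delta> = card {a \<in> torus.
     map_eval (map_reduce (f_cell f \<delta>)) a = 0 \<and> mp_eval (mp_reduce (g_cell g \<delta>)) a = 0}"

definition L_cell ::
    "('n::finite, 'p::prime_card padic_int) mpolynomial ^ 't::finite \<Rightarrow> ('n, 'p padic_int) mpolynomial
       \<Rightarrow> complex \<Rightarrow> (real ^ 'n) set \<Rightarrow> complex" where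
  "L_cell f g s \<delta> =
    (let p = of_nat CARD('p) :: complex; n = CARD('n); t = CARD('t) in
      1 / p ^ n *
        ((p - 1) ^ n
         - p ^ t * of_nat (N_cell f g \<delta>) * ((p powr s - 1) / (p powr (s + of_nat t) - 1))
         - of_nat (P_cell f g \<delta>) * (p / (p + 1))
         - p * of_nat (Q_cell f g \<delta>) *
             ((p ^ (t - 1) * (p powr s * (p + 1) - 1) - 1) / ((p powr (s + of_nat t) - 1) * (p + 1)))))"

definition weight ::
    "('n::finite, 'a::zero) mpolynomial ^ 't \<Rightarrow> ('n, 'a) mpolynomial \<Rightarrow> complex \<Rightarrow> real ^ 'n \<Rightarrow> complex" where
  "weight f g s k = of_real (min_val (Gam_f f) k) * s + of_real (min_val (Gam_g g) k) + of_real (sigma k)"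

definition S_cell ::
    "('n::finite, 'p::prime_card padic_int) mpolynomial ^ 't \<Rightarrow> ('n, 'p padic_int) mpolynomial
       \<Rightarrow> complex \<Rightarrow> (real ^ 'n) set \<Rightarrow> complex" where
  "S_cell f g s \<delta> =
     (\<Sum>\<^sub>\<infinity>k\<in>{k \<in> \<delta>. \<forall>i. k $ i \<in> \<nat>}. of_nat CARD('p) powr (- weight f g s k))"


section \<open>Cones\<close>

definition strict_cone :: "(real ^ 'n::finite) set \<Rightarrow> (real ^ 'n) set" where
  "strict_cone K = {\<Sum>k\<in>K. l k *\<^sub>R k | l. \<forall>k\<in>K. 0 < l k}"

definition half_open_box :: "(real ^ 'n::finite) set \<Rightarrow> (real ^ 'n) set" where
  "half_open_box K = {\<Sum>k\<in>K. l k *\<^sub>R k | l. \<forall>k\<in>K. 0 \<le> l k \<and> l k < 1}"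

definition primitive :: "real ^ 'n::finite \<Rightarrow> bool" where
  "primitive k \<longleftrightarrow> (\<exists>m :: int ^ 'n. k = (\<chi> i. of_int (m $ i)) \<and> Gcd (range (\<lambda>i. m $ i)) = 1)"

definition edge_generators :: "(real ^ 'n::finite) set \<Rightarrow> (real ^ 'n) set" where
  "edge_generators \<delta> = {k. primitive k \<and> (\<exists>F. is_face F (closure \<delta>) \<and> dim F = 1 \<and> k \<in> F)}"

text \<open>
  A partition of \<open>\<delta>\<close> into rational simplicial cones without introducing new rays, each cone being
  given by its set \<open>K\<close> of primitive generators; \<open>\<delta> = {0}\<close> has the partition \<open>{{}}\<close>.
\<close>

definition simplicial_partition :: "(real ^ 'n::finite) set \<Rightarrow> (real ^ 'n) set set \<Rightarrow> bool" where
  "simplicial_partition \<delta> \<K> \<longleftrightarrow>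
     finite \<K> \<and>
     (\<forall>K\<in>\<K>. K \<subseteq> edge_generators \<delta> \<and> independent K) \<and>
     disjoint_family_on strict_cone \<K> \<and>
     (\<Union>K\<in>\<K>. strict_cone K) = \<delta>"

definition ray_generators ::
    "('n::finite, 'a::zero) mpolynomial ^ 't \<Rightarrow> ('n, 'a) mpolynomial \<Rightarrow> (real ^ 'n) set" where
  "ray_generators f g = {k. primitive k \<and> (\<exists>\<delta>\<in>Delta f g. dim \<delta> = 1 \<and> k \<in> \<delta>)}"

text \<open>
  The value coming from \<open>L\<^sub>\<delta>\<close> is \<open>-t\<close>, where its denominator \<open>p^(s+t) - 1\<close> vanishes; it equals
  \<open>-1\<close> exactly when \<open>t = 1\<close>, and \<open>-1\<close> would be wrong in general: for \<open>t = 2\<close>,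
  \<open>f = (x - y, y - z)\<close> and \<open>g = z\<close> the zeta function has poles with real part \<open>-2\<close>, while \<open>(1,1,1)\<close>
  is the only ray generator with \<open>m\<^sub>f \<noteq> 0\<close> and contributes \<open>-4\<close>. A ray generator with
  \<open>m\<^sub>f = 0\<close> contributes a constant factor and hence no candidate.
\<close>

definition candidate_real_parts ::
    "('n::finite, 'a::zero) mpolynomial ^ 't::finite \<Rightarrow> ('n, 'a) mpolynomial \<Rightarrow> real set" where
  "candidate_real_parts f g = insert (- real CARD('t))
     ((\<lambda>k. - (min_val (Gam_g g) k + sigma k) / min_val (Gam_f f) k) `
        {k \<in> ray_generators f g. min_val (Gam_f f) k \<noteq> 0})"

definition meromorphic_continuation ::
    "(complex \<Rightarrow> complex) \<Rightarrow> (complex \<Rightarrow> complex) \<Rightarrow> bool" where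
  "meromorphic_continuation Z W \<longleftrightarrow> W meromorphic_on UNIV \<and> (\<forall>s. Re s > 0 \<longrightarrow> W s = Z s)"

end

(*
  For k in N^n and a in the torus over F_p, consider the points x = p^k u with u congruent to a
  modulo p. On this box f(x) = p^m(k) F(u) and g(x) = p^m'(k) G(u), where F and G reduce modulo p to
  the face parts of f and g belonging to the cell of k. By non-degeneracy the Jacobian of those of
  F, G that vanish at a is onto, and translating by multiples of p^N shows, one digit at a time, that
  their values are equidistributed. Hence the joint distribution of the orders of F and G is
  geometric; summing it over a gives L, and the boxes fill up the measure, so that the zeta function
  is the sum of L(cell of k) p^(-weight of k) over all k.

  The weight is linear on the closure of a cell, so that the sum over the lattice points of an open
  simplicial cone is a product of geometric series. A cell is a relatively open face of a rational
  polyhedral cone in the orthant; its closure is generated by primitive vectors on the rays of the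
  partition, and adding these generators one at a time triangulates it without new rays. The
  resulting finite sum of quotients of exponentials continues the zeta function, and it is
  analytic wherever no denominator vanishes.
*)

theory Submission
  imports Defs
begin

no_notation fps_nth (infixl \<open>$\<close> 75)
no_notation Infinite_Set_Sum.abs_summable_on (infix \<open>abs'_summable'_on\<close> 50)

section \<open>Divisibility and reduction in the \<open>p\<close>-adic integers\<close>

text \<open>Every set that is measured is cut out by congruences, so translation invariance and
  counting replace a change of variables formula. The induction on digits starts at precision 1,
  where the residue of u decides everything: the quadratic Taylor remainder, a multiple of p^(2N),
  is negligible modulo p^(N+1) only for N >= 1. This is why t components that vanish modulo p have
  order at least j >= 1 with probability p^(-t(j-1)) instead of p^(-tj). The weight is linear on the
  closure of a cell but not beyond, and the generators and the points h of the boxes lie in the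
  closure without lying in the cell in general; hence the minima have to be followed to the closure.
  The continuation must exist without any partition being given, so a triangulation has to be
  constructed, and its generators must lie on rays of the partition itself because the candidate
  real parts are defined by these. Finally, a meromorphic continuation is determined only up to its
  values at isolated points, so poles of two continuations are compared on punctured
  neighbourhoods.\<close>

lemma padic_digits_mod:
  fixes x :: "'p::prime_card padic_int"
  assumes "m \<le> n"
  shows "padic_digits x n mod int CARD('p) ^ m = padic_digits x m"
  using assms by transfer (rule coherent_mod, use int_card_pos[where 'p='p] in auto)

lemma padic_digits_range:
  "padic_digits x n \<in> {0..<int CARD('p) ^ n}" for x :: "'p::prime_card padic_int"
  by transfer blast

lemma padic_int_eqI: "(\<And>n. padic_digits x n = padic_digits y n) \<Longrightarrow> x = y"
  by transfer auto

lemma padic_digits_one: "padic_digits (1 :: 'p::prime_card padic_int) n = 1 mod int CARD('p) ^ n"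
  by transfer simp

lemma padic_digits_minus:
  "padic_digits (x - y :: 'p::prime_card padic_int) n
     = (padic_digits x n - padic_digits y n) mod int CARD('p) ^ n"
  by transfer simp

lemma padic_digits_of_nat:
  "padic_digits (of_nat m :: 'p::prime_card padic_int) n = int m mod int CARD('p) ^ n"
  by (induction m) (auto simp: padic_digits_zero padic_digits_plus padic_digits_one mod_simps)

lemma padic_digits_of_int:
  "padic_digits (of_int m :: 'p::prime_card padic_int) n = m mod int CARD('p) ^ n"
proof -
  obtain a b where "m = int a - int b" by (rule int_diff_cases)
  then show ?thesis by (simp add: padic_digits_minus padic_digits_of_nat mod_simps)
qed

text \<open>The uniformizer: the prime p as an element of Z_p. Norm bounds and congruences modulo
  p^e are all expressed as divisibility by \<open>unif ^ e\<close>.\<close>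

definition unif :: "'p::prime_card padic_int" where
  "unif = of_nat CARD('p)"

lemma unif_power: "unif ^ m = (of_nat (CARD('p) ^ m) :: 'p::prime_card padic_int)"
  by (simp add: unif_def)

lemma padic_digits_unif_power:
  "padic_digits (unif ^ m :: 'p::prime_card padic_int) n = int CARD('p) ^ m mod int CARD('p) ^ n"
  unfolding unif_power padic_digits_of_nat by simp

lemma padic_coherentI:
  fixes z :: "nat \<Rightarrow> int"
  assumes "\<And>n. z n \<in> {0..<int CARD('p) ^ n}"
    and "\<And>n. z (Suc n) mod int CARD('p) ^ n = z n"
  obtains y :: "'p::prime_card padic_int" where "\<And>n. padic_digits y n = z n"
proof -
  have "\<forall>n. z n \<in> {0..<int CARD('p) ^ n} \<and> z (Suc n) mod int CARD('p) ^ n = z n"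
    using assms by blast
  then have "padic_digits (Abs_padic_int z :: 'p padic_int) n = z n" for n
    by (simp add: padic_digits.rep_eq Abs_padic_int_inverse)
  then show ?thesis using that by blast
qed

text \<open>If the m-th digit vanishes, p^m divides all later ones, and dividing them yields the
  digits of the quotient. The shift by m appears because the quotient modulo p^n depends on x modulo
  p^(n+m).\<close>

lemma unif_power_dvd_iff:
  fixes x :: "'p::prime_card padic_int"
  shows "unif ^ m dvd x \<longleftrightarrow> padic_digits x m = 0"
proof
  assume "unif ^ m dvd x"
  then show "padic_digits x m = 0"
    by (auto simp: dvd_def padic_digits_times padic_digits_unif_power)
next
  let ?p = "int CARD('p)"
  assume 0: "padic_digits x m = 0"
  have dvd: "?p ^ m dvd padic_digits x (n + m)" for n
    using padic_digits_eq_0_iff[of m "n + m" x] 0 by simp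
  have p: "?p > 0" by (rule int_card_pos)
  define z where "z n = padic_digits x (n + m) div ?p ^ m" for n
  have "z n \<in> {0..<?p ^ n}" for n
  proof -
    have "z n * ?p ^ m = padic_digits x (n + m)"
      using dvd[of n] by (simp add: z_def)
    then have "z n * ?p ^ m < ?p ^ n * ?p ^ m"
      using padic_digits_range[of x "n + m"] by (simp add: power_add)
    moreover have "0 \<le> z n"
      using padic_digits_range[of x "n + m"] p by (simp add: z_def pos_imp_zdiv_nonneg_iff)
    ultimately show ?thesis using p by simp
  qed
  moreover have "z (Suc n) mod ?p ^ n = z n" for n
  proof -
    obtain q where q: "padic_digits x (Suc n + m) = ?p ^ m * q" using dvd by blast
    have "padic_digits x (n + m) = padic_digits x (Suc n + m) mod ?p ^ (n + m)"
      using padic_digits_mod[of "n + m" "Suc n + m" x] by simp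
    also have "\<dots> = ?p ^ m * (q mod ?p ^ n)"
      unfolding q by (metis mult_mod_right power_add mult.commute)
    finally show ?thesis unfolding z_def q using p by simp
  qed
  ultimately obtain y :: "'p padic_int" where y: "\<And>n. padic_digits y n = z n"
    using padic_coherentI[of z] by blast
  have "x = unif ^ m * y"
  proof (rule padic_int_eqI)
    fix n
    have "padic_digits (unif ^ m * y) n = (?p ^ m * z n) mod ?p ^ n"
      by (simp add: padic_digits_times padic_digits_unif_power y mod_simps)
    also have "?p ^ m * z n = padic_digits x (n + m)"
      using dvd[of n] by (simp add: z_def)
    also have "\<dots> mod ?p ^ n = padic_digits x n" by (rule padic_digits_mod) simp
    finally show "padic_digits x n = padic_digits (unif ^ m * y) n" by simp
  qed
  then show "unif ^ m dvd x" by simp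
qed

lemma unif_power_dvd_iff_val:
  fixes x :: "'p::prime_card padic_int"
  assumes "x \<noteq> 0"
  shows "unif ^ m dvd x \<longleftrightarrow> m \<le> padic_val x"
  using digits_eq_0_iff_le_val[OF assms] by (simp add: unif_power_dvd_iff)

lemma unif_nonzero [simp]: "(unif :: 'p::prime_card padic_int) \<noteq> 0"
proof
  assume "(unif :: 'p padic_int) = 0"
  \<comment> \<open>The digit at index 1 is the class modulo p and vanishes, so index 2 is the first
    at which p is visible.\<close>
  then have "padic_digits (unif :: 'p padic_int) 2 = 0" by (simp add: padic_digits_zero)
  moreover have "int CARD('p) mod (int CARD('p))\<^sup>2 = int CARD('p)"
    using int_card_gt_1[where 'p='p] by (intro mod_pos_pos_trivial) (auto simp: power2_eq_square)
  ultimately show False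
    using int_card_pos[where 'p='p] by (simp add: unif_def padic_digits_of_nat)
qed

lemma padic_int_norm_le_power_iff:
  fixes x :: "'p::prime_card padic_int"
  shows "padic_int_norm x \<le> (1 / real CARD('p)) ^ j \<longleftrightarrow> unif ^ j dvd x"
proof (cases "x = 0")
  case False
  define q where "q = 1 / real CARD('p)"
  have "0 < q" "q < 1" using int_card_gt_1[where 'p='p] by (auto simp: q_def)
  then have "q ^ padic_val x \<le> q ^ j \<longleftrightarrow> j \<le> padic_val x"
    by (rule power_decreasing_iff)
  moreover have "padic_int_norm x = q ^ padic_val x" using False by (simp add: padic_int_norm_def q_def)
  ultimately show ?thesis
    using unif_power_dvd_iff_val[OF False] unfolding q_def by metis
qed (simp add: padic_int_norm_def)

lemma padic_int_norm_eq_power_iff: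
  fixes x :: "'p::prime_card padic_int"
  shows "padic_int_norm x = (1 / real CARD('p)) ^ j \<longleftrightarrow> unif ^ j dvd x \<and> \<not> unif ^ Suc j dvd x"
proof (cases "x = 0")
  case False
  define q where "q = 1 / real CARD('p)"
  have "0 < q" "q < 1" using int_card_gt_1[where 'p='p] by (auto simp: q_def)
  then have "q ^ padic_val x = q ^ j \<longleftrightarrow> padic_val x = j"
    by (metis power_decreasing_iff le_antisym order_refl)
  moreover have "padic_int_norm x = q ^ padic_val x" using False by (simp add: padic_int_norm_def q_def)
  moreover have "unif ^ j dvd x \<and> \<not> unif ^ Suc j dvd x \<longleftrightarrow> padic_val x = j"
    unfolding unif_power_dvd_iff_val[OF False] by linarith
  ultimately show ?thesis unfolding q_def by metis
next
  case True
  then show ?thesis using int_card_pos[where 'p='p] by (simp add: padic_int_norm_def)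
qed

lemma of_int_mod_ring_mod:
  "(of_int (m mod int CARD('p)) :: 'p::prime_card mod_ring) = of_int m"
  by transfer simp

lemma of_int_mod_ring_eq_0_iff:
  "(of_int m :: 'p::prime_card mod_ring) = 0 \<longleftrightarrow> int CARD('p) dvd m"
  by transfer (simp add: dvd_eq_mod_eq_0)

lemma residue_add: "residue (x + y) = residue x + residue y"
  by (simp add: residue_def padic_digits_plus of_int_mod_ring_mod)

lemma residue_mult: "residue (x * y) = residue x * residue y"
  by (simp add: residue_def padic_digits_times of_int_mod_ring_mod)

lemma residue_0 [simp]: "residue 0 = 0"
  by (simp add: residue_def padic_digits_zero)

lemma residue_1 [simp]: "residue 1 = 1"
  using of_int_mod_ring_mod[of 1] by (simp add: residue_def padic_digits_one)

lemma residue_of_int: "residue (of_int m) = of_int m"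
  by (simp add: residue_def padic_digits_of_int of_int_mod_ring_mod)

lemma residue_of_nat: "residue (of_nat m) = of_nat m"
  using residue_of_int[of "int m"] by simp

lemma residue_diff: "residue (x - y) = residue x - residue y"
  by (simp add: residue_def padic_digits_minus of_int_mod_ring_mod)

lemma residue_power: "residue (x ^ m) = residue x ^ m"
  by (induction m) (auto simp: residue_mult)

lemma residue_sum: "residue (\<Sum>i\<in>A. h i) = (\<Sum>i\<in>A. residue (h i))"
  by (induction A rule: infinite_finite_induct) (auto simp: residue_add)

lemma residue_prod: "residue (\<Prod>i\<in>A. h i) = (\<Prod>i\<in>A. residue (h i))"
  by (induction A rule: infinite_finite_induct) (auto simp: residue_mult)

lemma residue_eq_0_iff: "residue x = 0 \<longleftrightarrow> unif dvd x" for x :: "'p::prime_card padic_int"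
proof -
  have "int CARD('p) dvd padic_digits x 1 \<longleftrightarrow> padic_digits x 1 = 0"
    using padic_digits_range[of x 1] zdvd_imp_le[of "int CARD('p)" "padic_digits x 1"] by force
  then show ?thesis
    using unif_power_dvd_iff[of 1 x] by (simp add: residue_def of_int_mod_ring_eq_0_iff)
qed

lemma residue_unif [simp]: "residue unif = 0"
  by (simp add: residue_eq_0_iff)

lemma residue_eq_iff: "residue x = residue y \<longleftrightarrow> unif dvd x - y"
  using residue_diff[of x y] residue_eq_0_iff[of "x - y"] by auto

lemma residue_surj: obtains x :: "'p::prime_card padic_int" where "residue x = a"
proof -
  have "\<exists>m. a = of_int m"
    by (metis of_int_mod_ring_to_int_mod_ring of_int_of_int_mod_ring)
  then show ?thesis using that residue_of_int by metis
qed

text \<open>Existence makes the cosets of p^e cover Z_p, uniqueness makes them disjoint; both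
  partitions into cosets below need the two halves.\<close>

lemma ex1_residue_mod_power:
  fixes x :: "'p::prime_card padic_int"
  shows "\<exists>!r. r < CARD('p) ^ e \<and> unif ^ e dvd x - of_nat r"
proof -
  have eq: "unif ^ e dvd x - of_nat r \<longleftrightarrow> padic_digits x e = int r" if "r < CARD('p) ^ e" for r
  proof -
    have r: "int r < int CARD('p) ^ e" using that by (metis of_nat_less_iff of_nat_power)
    have "unif ^ e dvd x - of_nat r \<longleftrightarrow> (padic_digits x e - int r) mod int CARD('p) ^ e = 0"
      by (simp add: unif_power_dvd_iff padic_digits_minus padic_digits_of_nat mod_simps)
    also have "\<dots> \<longleftrightarrow> padic_digits x e mod int CARD('p) ^ e = int r mod int CARD('p) ^ e"
      by (metis mod_eq_dvd_iff dvd_eq_mod_eq_0)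
    also have "\<dots> \<longleftrightarrow> padic_digits x e = int r"
      using padic_digits_range[of x e] r by simp
    finally show ?thesis .
  qed
  have "nat (padic_digits x e) < CARD('p) ^ e"
    using padic_digits_range[of x e] by (simp add: nat_less_iff)
  moreover have "padic_digits x e = int (nat (padic_digits x e))"
    using padic_digits_range[of x e] by simp
  ultimately show ?thesis using eq by (metis nat_int)
qed

section \<open>Polynomials in several variables\<close>

definition mp_monom :: "('n::finite \<Rightarrow>\<^sub>0 nat) \<Rightarrow> 'a::comm_ring_1 ^ 'n \<Rightarrow> 'a" where
  "mp_monom \<omega> x = (\<Prod>i\<in>UNIV. (x $ i) ^ Poly_Mapping.lookup \<omega> i)"

text \<open>Addition, reduction and rescaling change the support, so evaluations are compared over a
  common finite set of exponents; the additional coefficients are 0.\<close>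

lemma mp_eval_superset:
  assumes "finite A" "Poly_Mapping.keys h \<subseteq> A"
  shows "mp_eval h x = (\<Sum>\<omega>\<in>A. Poly_Mapping.lookup h \<omega> * mp_monom \<omega> x)"
  unfolding mp_eval_def mp_monom_def
  by (intro sum.mono_neutral_left) (use assms in \<open>auto simp: in_keys_iff\<close>)

lemma mp_eval_keys:
  "mp_eval h x = (\<Sum>\<omega>\<in>Poly_Mapping.keys h. Poly_Mapping.lookup h \<omega> * mp_monom \<omega> x)"
  by (rule mp_eval_superset) auto

lemma mp_eval_zero [simp]: "mp_eval 0 x = 0"
  by (simp add: mp_eval_def)

lemma mp_eval_add: "mp_eval (h + k) x = mp_eval h x + mp_eval k x"
proof -
  let ?A = "Poly_Mapping.keys h \<union> Poly_Mapping.keys k"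
  have "mp_eval (h + k) x = (\<Sum>\<omega>\<in>?A. Poly_Mapping.lookup (h + k) \<omega> * mp_monom \<omega> x)"
    by (rule mp_eval_superset) (use keys_add[of h k] in auto)
  also have "\<dots> = (\<Sum>\<omega>\<in>?A. Poly_Mapping.lookup h \<omega> * mp_monom \<omega> x)
      + (\<Sum>\<omega>\<in>?A. Poly_Mapping.lookup k \<omega> * mp_monom \<omega> x)"
    by (simp add: lookup_add algebra_simps sum.distrib)
  also have "\<dots> = mp_eval h x + mp_eval k x"
    by (simp add: mp_eval_superset[of ?A])
  finally show ?thesis .
qed

lemma mp_eval_sum: "mp_eval (\<Sum>i\<in>A. h i) x = (\<Sum>i\<in>A. mp_eval (h i) x)"
  by (induction A rule: infinite_finite_induct) (auto simp: mp_eval_add)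

lemma mp_eval_single: "mp_eval (Poly_Mapping.single \<omega> c) x = c * mp_monom \<omega> x"
  by (subst mp_eval_superset[of "{\<omega>}"]) auto

lemma mp_eval_pderiv:
  assumes "finite A" "Poly_Mapping.keys h \<subseteq> A"
  shows "mp_eval (mp_pderiv j h) x = (\<Sum>\<omega>\<in>A. Poly_Mapping.lookup h \<omega> *
     (of_nat (Poly_Mapping.lookup \<omega> j) * mp_monom (\<omega> - Poly_Mapping.single j 1) x))"
proof -
  have "mp_eval (mp_pderiv j h) x = (\<Sum>\<omega>\<in>Poly_Mapping.keys h. Poly_Mapping.lookup h \<omega> *
     (of_nat (Poly_Mapping.lookup \<omega> j) * mp_monom (\<omega> - Poly_Mapping.single j 1) x))"
    by (simp add: mp_pderiv_def mp_eval_sum mp_eval_single mult_ac)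
  also have "\<dots> = (\<Sum>\<omega>\<in>A. Poly_Mapping.lookup h \<omega> *
     (of_nat (Poly_Mapping.lookup \<omega> j) * mp_monom (\<omega> - Poly_Mapping.single j 1) x))"
    by (intro sum.mono_neutral_left) (use assms in \<open>auto simp: in_keys_iff\<close>)
  finally show ?thesis .
qed

text \<open>The remainder is only claimed to exist in the ring, so nothing is divided by a factorial
  and the expansion is available over Z_p.\<close>

lemma power_add_taylor:
  fixes u v e :: "'a::comm_ring_1"
  shows "\<exists>R. (u + e * v) ^ m = u ^ m + e * (of_nat m * u ^ (m - 1) * v) + e\<^sup>2 * R"
proof (induction m)
  case (Suc m)
  then obtain R where R: "(u + e * v) ^ m = u ^ m + e * (of_nat m * u ^ (m - 1) * v) + e\<^sup>2 * R"
    by blast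
  \<comment> \<open>For m = 0 the exponent \<open>m - 1\<close> is truncated, but then the factor
    \<open>of_nat m\<close> is 0.\<close>
  have um: "of_nat m * u ^ (m - 1) * u = of_nat m * u ^ m"
    by (cases m) (simp_all add: mult_ac)
  have "(u + e * v) ^ Suc m = (u + e * v) * (u ^ m + e * (of_nat m * u ^ (m - 1) * v) + e\<^sup>2 * R)"
    by (simp add: R)
  also have "\<dots> = u ^ Suc m + e * (of_nat m * u ^ (m - 1) * u * v + u ^ m * v)
      + e\<^sup>2 * (R * u + e * R * v + of_nat m * u ^ (m - 1) * v * v)"
    by (simp add: algebra_simps power2_eq_square)
  also have "\<dots> = u ^ Suc m + e * (of_nat (Suc m) * u ^ (Suc m - 1) * v)
      + e\<^sup>2 * (R * u + e * R * v + of_nat m * u ^ (m - 1) * v * v)"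
    unfolding um by (simp add: algebra_simps)
  finally show ?case by blast
qed (auto intro: exI[of _ 0])

text \<open>The product rule modulo e^2. The terms \<open>C i\<close> absorb the remainders of the
  single powers in a monomial.\<close>

lemma prod_add_taylor:
  fixes A B C :: "'i \<Rightarrow> 'a::comm_ring_1"
  assumes "finite S"
  shows "\<exists>R. (\<Prod>i\<in>S. A i + e * B i + e\<^sup>2 * C i)
     = (\<Prod>i\<in>S. A i) + e * (\<Sum>j\<in>S. B j * (\<Prod>i\<in>S - {j}. A i)) + e\<^sup>2 * R"
  using assms
proof (induction S)
  case (insert s S)
  then obtain R where R: "(\<Prod>i\<in>S. A i + e * B i + e\<^sup>2 * C i)
     = (\<Prod>i\<in>S. A i) + e * (\<Sum>j\<in>S. B j * (\<Prod>i\<in>S - {j}. A i)) + e\<^sup>2 * R" by blast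
  define P D where "P = (\<Prod>i\<in>S. A i)" and "D = (\<Sum>j\<in>S. B j * (\<Prod>i\<in>S - {j}. A i))"
  have D': "(\<Sum>j\<in>insert s S. B j * (\<Prod>i\<in>insert s S - {j}. A i)) = B s * P + A s * D"
  proof -
    have "(\<Sum>j\<in>S. B j * (\<Prod>i\<in>insert s S - {j}. A i)) = (\<Sum>j\<in>S. A s * (B j * (\<Prod>i\<in>S - {j}. A i)))"
    proof (rule sum.cong)
      fix j assume "j \<in> S"
      then have "insert s S - {j} = insert s (S - {j})" using insert.hyps by auto
      then show "B j * (\<Prod>i\<in>insert s S - {j}. A i) = A s * (B j * (\<Prod>i\<in>S - {j}. A i))"
        using insert.hyps by (simp add: mult_ac)
    qed simp
    then show ?thesis using insert.hyps by (simp add: P_def D_def sum_distrib_left)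
  qed
  have "(\<Prod>i\<in>insert s S. A i + e * B i + e\<^sup>2 * C i) = (A s + e * B s + e\<^sup>2 * C s) * (P + e * D + e\<^sup>2 * R)"
    using insert.hyps by (simp add: R P_def D_def)
  also have "\<dots> = A s * P + e * (B s * P + A s * D)
      + e\<^sup>2 * (A s * R + B s * D + e * B s * R + C s * (P + e * D + e\<^sup>2 * R))"
    by (simp add: algebra_simps power2_eq_square)
  finally show ?case
    unfolding D' using insert.hyps by (auto simp: P_def)
qed (auto intro: exI[of _ 0])

lemma mp_monom_taylor:
  fixes u v :: "'a::comm_ring_1 ^ 'n::finite"
  shows "\<exists>R. mp_monom \<omega> (u + e *s v) = mp_monom \<omega> u
     + e * (\<Sum>j\<in>UNIV. of_nat (Poly_Mapping.lookup \<omega> j) * mp_monom (\<omega> - Poly_Mapping.single j 1) u * v $ j)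
     + e\<^sup>2 * R"
proof -
  let ?m = "Poly_Mapping.lookup \<omega>"
  define B where "B i = of_nat (?m i) * (u $ i) ^ (?m i - 1) * v $ i" for i
  have "\<forall>i. \<exists>R. (u $ i + e * v $ i) ^ ?m i = (u $ i) ^ ?m i + e * B i + e\<^sup>2 * R"
    unfolding B_def using power_add_taylor by blast
  then obtain C where C: "\<And>i. (u $ i + e * v $ i) ^ ?m i = (u $ i) ^ ?m i + e * B i + e\<^sup>2 * C i"
    by metis
  obtain R where R: "(\<Prod>i\<in>UNIV. (u $ i) ^ ?m i + e * B i + e\<^sup>2 * C i)
     = (\<Prod>i\<in>UNIV. (u $ i) ^ ?m i) + e * (\<Sum>j\<in>UNIV. B j * (\<Prod>i\<in>UNIV - {j}. (u $ i) ^ ?m i)) + e\<^sup>2 * R"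
    using prod_add_taylor[of UNIV "\<lambda>i. (u $ i) ^ ?m i" e B C] by auto
  have "B j * (\<Prod>i\<in>UNIV - {j}. (u $ i) ^ ?m i)
      = of_nat (?m j) * mp_monom (\<omega> - Poly_Mapping.single j 1) u * v $ j" for j
  proof -
    have "mp_monom (\<omega> - Poly_Mapping.single j 1) u
        = (u $ j) ^ (?m j - 1) * (\<Prod>i\<in>UNIV - {j}. (u $ i) ^ ?m i)"
      unfolding mp_monom_def
      by (subst prod.remove[of UNIV j]) (auto simp: lookup_minus lookup_single)
    then show ?thesis by (simp add: B_def mult_ac)
  qed
  then show ?thesis
    using R by (auto simp: mp_monom_def C)
qed

lemma mp_eval_taylor:
  fixes u v :: "'a::comm_ring_1 ^ 'n::finite"
  shows "\<exists>R. mp_eval h (u + e *s v) = mp_eval h u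
     + e * (\<Sum>j\<in>UNIV. mp_eval (mp_pderiv j h) u * v $ j) + e\<^sup>2 * R"
proof -
  let ?K = "Poly_Mapping.keys h" and ?c = "Poly_Mapping.lookup h"
  let ?d = "\<lambda>\<omega> j. of_nat (Poly_Mapping.lookup \<omega> j) * mp_monom (\<omega> - Poly_Mapping.single j 1) u"
  have "\<forall>\<omega>. \<exists>R. mp_monom \<omega> (u + e *s v)
     = mp_monom \<omega> u + e * (\<Sum>j\<in>UNIV. ?d \<omega> j * v $ j) + e\<^sup>2 * R"
    by (intro allI mp_monom_taylor)
  then obtain R where R: "\<And>\<omega>. mp_monom \<omega> (u + e *s v)
     = mp_monom \<omega> u + e * (\<Sum>j\<in>UNIV. ?d \<omega> j * v $ j) + e\<^sup>2 * R \<omega>"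
    using that by (elim choice[THEN exE]) blast
  have "mp_eval h (u + e *s v) = (\<Sum>\<omega>\<in>?K. ?c \<omega> * mp_monom \<omega> u)
      + e * (\<Sum>\<omega>\<in>?K. \<Sum>j\<in>UNIV. ?c \<omega> * ?d \<omega> j * v $ j) + e\<^sup>2 * (\<Sum>\<omega>\<in>?K. ?c \<omega> * R \<omega>)"
  proof -
    have "?c \<omega> * mp_monom \<omega> (u + e *s v) = ?c \<omega> * mp_monom \<omega> u
        + e * (\<Sum>j\<in>UNIV. ?c \<omega> * ?d \<omega> j * v $ j) + e\<^sup>2 * (?c \<omega> * R \<omega>)" for \<omega>
      unfolding R distrib_left
      by (simp add: sum_distrib_left mult.assoc mult.left_commute[of "?c \<omega>"])
    then show ?thesis
      unfolding mp_eval_keys by (simp only: sum.distrib sum_distrib_left[symmetric])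
  qed
  also have "(\<Sum>\<omega>\<in>?K. \<Sum>j\<in>UNIV. ?c \<omega> * ?d \<omega> j * v $ j) = (\<Sum>j\<in>UNIV. mp_eval (mp_pderiv j h) u * v $ j)"
    unfolding mp_eval_pderiv[OF finite_keys order_refl] sum_distrib_right by (rule sum.swap)
  finally show ?thesis by (auto simp: mp_eval_keys)
qed

text \<open>Both Taylor terms beyond the constant one contain the factor e. This turns a congruence
  for a value of a polynomial into a condition on cosets of its argument.\<close>

lemma mp_eval_diff_dvd:
  fixes u w :: "'a::comm_ring_1 ^ 'n::finite"
  assumes "\<And>i. e dvd w $ i - u $ i"
  shows "e dvd mp_eval h w - mp_eval h u"
proof -
  have "\<forall>i. \<exists>q. w $ i - u $ i = e * q" using assms by (auto simp: dvd_def)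
  then obtain q where "\<forall>i. w $ i - u $ i = e * q i" by metis
  then have "w = u + e *s (\<chi> i. q i)" by (simp add: vec_eq_iff algebra_simps)
  then obtain R where "mp_eval h w = mp_eval h u
     + e * (\<Sum>j\<in>UNIV. mp_eval (mp_pderiv j h) u * q j) + e\<^sup>2 * R"
    using mp_eval_taylor[of h u e "\<chi> i. q i"] by auto
  then have "mp_eval h w - mp_eval h u = e * ((\<Sum>j\<in>UNIV. mp_eval (mp_pderiv j h) u * q j) + e * R)"
    by (simp add: algebra_simps power2_eq_square)
  then show ?thesis by simp
qed

definition residue_vec :: "'p::prime_card padic_int ^ 'n \<Rightarrow> 'p mod_ring ^ 'n" where
  "residue_vec u = (\<chi> i. residue (u $ i))"

lemma residue_vec_nth [simp]: "residue_vec u $ i = residue (u $ i)"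
  by (simp add: residue_vec_def)

lemma residue_vec_surj: obtains u where "residue_vec u = a"
proof -
  have "\<forall>i. \<exists>x. residue x = a $ i" using residue_surj by metis
  then obtain u where "\<forall>i. residue (u i) = a $ i" by metis
  then have "residue_vec (\<chi> i. u i) = a" by (simp add: vec_eq_iff)
  then show ?thesis by (rule that)
qed

lemma residue_mp_monom: "residue (mp_monom \<omega> u) = mp_monom \<omega> (residue_vec u)"
  by (simp add: mp_monom_def residue_prod residue_power)

lemma lookup_mp_reduce: "Poly_Mapping.lookup (mp_reduce h) \<omega> = residue (Poly_Mapping.lookup h \<omega>)"
  by (simp add: mp_reduce_def map.rep_eq when_def in_keys_iff)

lemma keys_mp_reduce: "Poly_Mapping.keys (mp_reduce h) \<subseteq> Poly_Mapping.keys h"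
  by (auto simp: in_keys_iff lookup_mp_reduce)

lemma residue_mp_eval: "residue (mp_eval h u) = mp_eval (mp_reduce h) (residue_vec u)"
  by (subst (2) mp_eval_superset[of "Poly_Mapping.keys h"])
     (auto simp: keys_mp_reduce mp_eval_keys residue_sum residue_mult residue_mp_monom lookup_mp_reduce)

lemma residue_mp_eval_pderiv:
  "residue (mp_eval (mp_pderiv j h) u) = mp_eval (mp_pderiv j (mp_reduce h)) (residue_vec u)"
  unfolding mp_eval_pderiv[OF finite_keys order_refl, of j h] mp_eval_pderiv[OF finite_keys keys_mp_reduce]
  by (simp add: residue_sum residue_mult residue_mp_monom lookup_mp_reduce residue_of_nat)

section \<open>The embedding of Z_p into Q_p\<close>

lemma of_padic_int_add: "of_padic_int (a + b) = of_padic_int a + of_padic_int b"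
  unfolding of_padic_int_def by (simp add: plus_padic.abs_eq eq_onp_def)

lemma of_padic_int_mult: "of_padic_int (a * b) = of_padic_int a * of_padic_int b"
  unfolding of_padic_int_def by (simp add: times_padic.abs_eq eq_onp_def)

lemma of_padic_int_diff: "of_padic_int (a - b) = of_padic_int a - of_padic_int b"
  unfolding of_padic_int_def by (simp add: minus_padic.abs_eq eq_onp_def)

lemma of_padic_int_0 [simp]: "of_padic_int 0 = 0"
  unfolding of_padic_int_def zero_padic_def by (simp add: Zero_fract_def)

lemma of_padic_int_1: "of_padic_int 1 = 1"
  unfolding of_padic_int_def one_padic_def by (simp add: One_fract_def)

lemma of_padic_int_power: "of_padic_int (a ^ m) = of_padic_int a ^ m"
  by (induction m) (auto simp: of_padic_int_mult of_padic_int_1)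

lemma of_padic_int_sum: "of_padic_int (\<Sum>i\<in>A. h i) = (\<Sum>i\<in>A. of_padic_int (h i))"
  by (induction A rule: infinite_finite_induct) (auto simp: of_padic_int_add)

lemma of_padic_int_prod: "of_padic_int (\<Prod>i\<in>A. h i) = (\<Prod>i\<in>A. of_padic_int (h i))"
  by (induction A rule: infinite_finite_induct) (auto simp: of_padic_int_mult of_padic_int_1)

lemma padic_norm_of_padic_int: "padic_norm (of_padic_int a) = padic_int_norm a"
proof -
  have "padic_int_norm (1 :: 'a padic_int) = 1"
    using padic_int_norm_eq_power_iff[of "1 :: 'a padic_int" 0] residue_eq_0_iff[of "1 :: 'a padic_int"]
    by simp
  then show ?thesis
    by (simp add: of_padic_int_def padic_norm.abs_eq fract_norm_Fract)
qed

lemma of_padic_int_eq_iff: "of_padic_int a = of_padic_int b \<longleftrightarrow> a = b"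
proof
  assume "of_padic_int a = of_padic_int b"
  then have "padic_int_norm (a - b) = padic_int_norm (0 :: 'a padic_int)"
    by (metis padic_norm_of_padic_int of_padic_int_diff diff_self of_padic_int_0)
  then show "a = b" by (simp add: padic_int_norm_def[of 0])
qed simp

definition of_padic_vec :: "'p::prime_card padic_int ^ 'n \<Rightarrow> 'p padic ^ 'n" where
  "of_padic_vec u = (\<chi> i. of_padic_int (u $ i))"

lemma of_padic_vec_nth [simp]: "of_padic_vec u $ i = of_padic_int (u $ i)"
  by (simp add: of_padic_vec_def)

lemma of_padic_vec_eq_iff: "of_padic_vec u = of_padic_vec v \<longleftrightarrow> u = v"
  by (simp add: vec_eq_iff of_padic_int_eq_iff)

lemma of_padic_vec_add: "of_padic_vec (u + v) = of_padic_vec u + of_padic_vec v"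
  by (simp add: vec_eq_iff of_padic_int_add)

lemma range_of_padic_vec: "range of_padic_vec = Zp_cube"
proof -
  have "\<exists>u. x = of_padic_vec u" if "\<forall>i. x $ i \<in> range of_padic_int" for x :: "'p::prime_card padic ^ 'n"
  proof -
    have "\<forall>i. \<exists>y. x $ i = of_padic_int y" using that by blast
    then obtain y where "\<forall>i. x $ i = of_padic_int (y i)" by metis
    then have "x = of_padic_vec (\<chi> i. y i)" by (simp add: vec_eq_iff)
    then show ?thesis ..
  qed
  then show ?thesis unfolding Zp_cube_def image_def by auto
qed

lemma padic_eval_of_padic_vec: "padic_eval h (of_padic_vec u) = of_padic_int (mp_eval h u)"
proof -
  have monom: "of_padic_int (mp_monom \<omega> u) = mp_monom \<omega> (of_padic_vec u)" for \<omega>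
    by (simp add: mp_monom_def of_padic_int_prod of_padic_int_power)
  have l: "Poly_Mapping.lookup (Poly_Mapping.map of_padic_int h) \<omega> = of_padic_int (Poly_Mapping.lookup h \<omega>)" for \<omega>
    by (simp add: map.rep_eq when_def in_keys_iff)
  have "Poly_Mapping.keys (Poly_Mapping.map of_padic_int h) \<subseteq> Poly_Mapping.keys h"
    by (auto simp: in_keys_iff l)
  then show ?thesis
    unfolding padic_eval_def
    by (subst mp_eval_superset[of "Poly_Mapping.keys h"])
       (auto simp: mp_eval_keys of_padic_int_sum of_padic_int_mult monom l)
qed

section \<open>Matrices of full row rank\<close>

text \<open>\<open>rows A\<close> is a set, in which equal rows would be merged. Its dimension is at
  most its cardinality, which is at most the number of rows; by the rank hypothesis both are
  equalities, so the rows are distinct and independent, and this is equivalent to having a right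
  inverse.\<close>

lemma full_row_rank_surj:
  fixes A :: "'a::field ^ 'n ^ 'm"
  assumes "rank A = CARD('m)"
  shows "\<exists>v. A *v v = w"
proof -
  have rows: "rows A = range (\<lambda>i. row i A)" by (auto simp: rows_def)
  have dim: "vec.dim (rows A) = CARD('m)" using assms by (simp add: row_rank_def_gen)
  have fin: "finite (rows A)" unfolding rows by simp
  have "vec.dim (rows A) \<le> card (rows A)"
    by (rule vec.dim_le_card) (auto simp: fin vec.span_base)
  moreover have "card (rows A) \<le> CARD('m)" unfolding rows by (rule card_image_le) simp
  ultimately have card: "card (rows A) = CARD('m)" using dim by simp
  then have inj: "inj (\<lambda>i. row i A)" unfolding rows by (simp add: eq_card_imp_inj_on)
  have indep: "vec.independent (rows A)"
    by (rule vec.card_le_dim_spanning[of _ "rows A"]) (auto simp: fin vec.span_base card dim)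
  have "\<forall>i. c i = 0" if "(\<Sum>i\<in>UNIV. c i *s row i A) = 0" for c
  proof -
    define d where "d = c \<circ> the_inv (\<lambda>i. row i A)"
    have d: "d (row j A) = c j" for j
      using the_inv_f_f[OF inj, of j] by (simp add: d_def)
    have "(\<Sum>v\<in>rows A. d v *s v) = (\<Sum>i\<in>UNIV. c i *s row i A)"
      unfolding rows using inj by (simp add: sum.reindex d)
    then have "d v = 0" if "v \<in> rows A" for v
      using vec.independentD[OF indep fin order_refl, of d v] that \<open>(\<Sum>i\<in>UNIV. c i *s row i A) = 0\<close> by simp
    then have "d (row i A) = 0" for i by (simp add: rows)
    then show ?thesis by (simp add: d)
  qed
  then have "surj (\<lambda>x. A *v x)"
    unfolding matrix_right_invertible_surjective[symmetric] matrix_right_invertible_independent_rows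
    by blast
  then show ?thesis by (metis surjD)
qed

section \<open>Open sets of \<open>p\<close>-adic integer vectors\<close>

text \<open>Each digit is coprime to its modulus and can be inverted there; cancellation shows that
  the chosen inverses are coherent.\<close>

lemma padic_int_unit:
  fixes x :: "'p::prime_card padic_int"
  assumes "\<not> unif dvd x"
  shows "\<exists>y. x * y = 1"
proof -
  let ?p = "int CARD('p)"
  have prime: "prime ?p" using prime_card[where 'a='p] by simp
  have p: "?p > 0" by (rule int_card_pos)
  have cop: "coprime (padic_digits x n) (?p ^ n)" for n
  proof (cases n)
    case (Suc m)
    have "\<not> ?p dvd padic_digits x n"
      using padic_digits_eq_0_iff[of 1 n x] unif_power_dvd_iff[of 1 x] assms Suc by simp
    then have "coprime ?p (padic_digits x n)" using prime by (simp add: prime_imp_coprime)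
    then show ?thesis by (simp add: coprime_commute)
  qed simp
  have ex: "\<exists>r. r \<in> {0..<?p ^ n} \<and> [padic_digits x n * r = 1] (mod ?p ^ n)" for n
  proof -
    obtain r where r: "[padic_digits x n * r = 1] (mod ?p ^ n)"
      using cop cong_solve_coprime_int by blast
    have "[padic_digits x n * (r mod ?p ^ n) = 1] (mod ?p ^ n)"
      using r by (simp add: cong_def mod_simps)
    moreover have "r mod ?p ^ n \<in> {0..<?p ^ n}" using p by simp
    ultimately show ?thesis by blast
  qed
  then obtain r where r: "\<And>n. r n \<in> {0..<?p ^ n}" "\<And>n. [padic_digits x n * r n = 1] (mod ?p ^ n)"
    by metis
  have coh: "r (Suc n) mod ?p ^ n = r n" for n
  proof -
    have "[padic_digits x (Suc n) * r (Suc n) = 1] (mod ?p ^ n)"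
      using r(2)[of "Suc n"] by (rule cong_dvd_modulus) simp
    moreover have "[padic_digits x (Suc n) * r (Suc n) = padic_digits x n * r (Suc n)] (mod ?p ^ n)"
      using padic_digits_mod[of n "Suc n" x] padic_digits_mod[of n n x] by (intro cong_mult) (auto simp: cong_def)
    ultimately have "[padic_digits x n * r (Suc n) = padic_digits x n * r n] (mod ?p ^ n)"
      using r(2)[of n] by (meson cong_trans cong_sym)
    then have "[r (Suc n) = r n] (mod ?p ^ n)"
      using cong_mult_lcancel[OF cop] by blast
    then show ?thesis using r(1)[of n] by (simp add: cong_def)
  qed
  obtain y :: "'p padic_int" where y: "\<And>n. padic_digits y n = r n"
    using padic_coherentI[of r] r(1) coh by blast
  have "x * y = 1"
    using r(2) by (intro padic_int_eqI) (simp add: padic_digits_times y padic_digits_one cong_def)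
  then show ?thesis ..
qed

text \<open>The numerator is divisible by the exact power of p in the denominator, and what remains
  of the denominator is a unit. So the closed unit ball is Z_p, which is needed to recognize open
  sets.\<close>

lemma padic_norm_le_1_imp:
  fixes z :: "'p::prime_card padic"
  assumes "padic_norm z \<le> 1"
  shows "z \<in> range of_padic_int"
proof -
  obtain a b where ab: "Rep_padic z = Fract a b" "b \<noteq> 0" by (cases "Rep_padic z") auto
  then have z: "z = Abs_padic (Fract a b)" by (metis Rep_padic_inverse)
  have "padic_int_norm a / padic_int_norm b \<le> 1"
    using assms ab by (simp add: padic_norm.rep_eq fract_norm_Fract)
  moreover have "padic_int_norm b > 0"
    using ab(2) padic_int_norm_nonneg[of b] by (metis less_eq_real_def padic_int_norm_eq_0_iff)
  ultimately have "padic_int_norm a \<le> (1 / real CARD('p)) ^ padic_val b"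
    using ab(2) by (simp add: padic_int_norm_def[of b] field_simps)
  then obtain a' where a': "a = unif ^ padic_val b * a'"
    unfolding padic_int_norm_le_power_iff by auto
  obtain b' where b': "b = unif ^ padic_val b * b'"
    using unif_power_dvd_iff_val[OF ab(2), of "padic_val b"] by (auto simp: dvd_def)
  have "\<not> unif dvd b'"
  proof
    assume "unif dvd b'"
    then have "unif ^ Suc (padic_val b) dvd b" by (subst b') (auto simp: mult.commute)
    then show False using unif_power_dvd_iff_val[OF ab(2)] by (metis Suc_n_not_le_n)
  qed
  then obtain y where y: "b' * y = 1" using padic_int_unit by blast
  have "a * 1 = (a' * y) * b"
    by (subst (1) a', subst (2) b') (use y in \<open>simp add: mult_ac\<close>)
  then have "Fract a b = Fract (a' * y) 1" using ab(2) by (simp add: eq_fract)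
  then show ?thesis by (simp add: z of_padic_int_def)
qed

text \<open>A union of cosets of p^N Z_p^n. Sets of this kind have open images in Q_p^n, hence Borel
  ones, and are preserved by Boolean operations, translations and rescaling.\<close>

definition cylinder :: "nat \<Rightarrow> ('p::prime_card padic_int ^ 'n) set \<Rightarrow> bool" where
  "cylinder N A \<longleftrightarrow> (\<forall>x\<in>A. \<forall>y. (\<forall>i. unif ^ N dvd y $ i - x $ i) \<longrightarrow> y \<in> A)"

lemma cylinderD: "cylinder N A \<Longrightarrow> x \<in> A \<Longrightarrow> (\<And>i. unif ^ N dvd y $ i - x $ i) \<Longrightarrow> y \<in> A"
  by (auto simp: cylinder_def)

lemma cylinder_mono: "cylinder N A \<Longrightarrow> N \<le> M \<Longrightarrow> cylinder M A"
  unfolding cylinder_def by (meson le_imp_power_dvd dvd_trans)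

lemma cylinder_Int:
  assumes "cylinder N A" "cylinder M B"
  shows "cylinder (max N M) (A \<inter> B)"
  using cylinder_mono[OF assms(1), of "max N M"] cylinder_mono[OF assms(2), of "max N M"]
  unfolding cylinder_def by simp blast

lemma cylinder_INT: "(\<And>i. i \<in> I \<Longrightarrow> cylinder N (A i)) \<Longrightarrow> cylinder N (\<Inter>i\<in>I. A i)"
  unfolding cylinder_def by blast

lemma cylinder_Compl: "cylinder N A \<Longrightarrow> cylinder N (- A)"
  unfolding cylinder_def by (metis Compl_iff minus_diff_eq dvd_minus_iff)

lemma cylinder_Un: "cylinder N A \<Longrightarrow> cylinder M B \<Longrightarrow> cylinder (max N M) (A \<union> B)"
  using cylinder_Compl[OF cylinder_Int[OF cylinder_Compl cylinder_Compl, of N A M B]] by simp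

lemma cylinder_Diff: "cylinder N A \<Longrightarrow> cylinder M B \<Longrightarrow> cylinder (max N M) (A - B)"
  using cylinder_Int[OF _ cylinder_Compl, of N A M B] by (simp add: Diff_eq)

lemma cylinder_UNIV: "cylinder N UNIV"
  by (simp add: cylinder_def)

lemma cylinder_translate: "cylinder N A \<Longrightarrow> cylinder N ((+) c ` A)"
  unfolding cylinder_def
proof (intro ballI allI impI)
  fix x y assume *: "\<forall>x\<in>A. \<forall>y. (\<forall>i. unif ^ N dvd y $ i - x $ i) \<longrightarrow> y \<in> A"
    "x \<in> (+) c ` A" "\<forall>i. unif ^ N dvd y $ i - x $ i"
  then obtain z where z: "z \<in> A" "x = c + z" by auto
  have "y - c \<in> A" using *(1)[rule_format, OF z(1), of "y - c"] *(3) z(2) by (simp add: algebra_simps)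
  then show "y \<in> (+) c ` A" by (force intro: image_eqI[of _ _ "y - c"])
qed

lemma open_cylinder_image:
  fixes A :: "('p::prime_card padic_int ^ 'n::finite) set"
  assumes "cylinder N A"
  shows "open (of_padic_vec ` A)"
  unfolding open_vec_def
proof (intro ballI)
  fix x assume "x \<in> of_padic_vec ` A"
  then obtain u where u: "u \<in> A" "x = of_padic_vec u" by blast
  let ?e = "(1 / real CARD('p)) ^ N"
  have "real CARD('p) > 1" using int_card_gt_1[where 'p='p] by simp
  then have e: "0 < ?e" "?e \<le> 1" by (auto intro: power_le_one)
  have "y \<in> of_padic_vec ` A" if y: "\<forall>i. y $ i \<in> ball (x $ i) ?e" for y
  proof -
    have "\<exists>w. y $ i = of_padic_int w \<and> unif ^ N dvd w - u $ i" for i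
    proof -
      have d: "padic_norm (y $ i - x $ i) < ?e"
        using y by (auto simp: mem_ball dist_padic_def[symmetric] dist_commute)
      \<comment> \<open>The radius is at most 1, so the difference is itself a p-adic integer and
        its divisibility by p^N can be read off from its norm.\<close>
      then have "padic_norm (y $ i - x $ i) \<le> 1" using e by linarith
      then obtain w where w: "y $ i - x $ i = of_padic_int w" using padic_norm_le_1_imp by blast
      then have "y $ i = of_padic_int (w + u $ i)" by (simp add: of_padic_int_add u(2) diff_eq_eq)
      moreover have "padic_int_norm w \<le> ?e" using d w padic_norm_of_padic_int[of w] by simp
      then have "unif ^ N dvd w" by (simp add: padic_int_norm_le_power_iff)
      ultimately show ?thesis by (intro exI[of _ "w + u $ i"]) simp
    qed
    then obtain w where w: "\<And>i. y $ i = of_padic_int (w i)" "\<And>i. unif ^ N dvd w i - u $ i" by metis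
    have "(\<chi> i. w i) \<in> A" using cylinderD[OF assms u(1)] w(2) by simp
    moreover have "y = of_padic_vec (\<chi> i. w i)" by (simp add: vec_eq_iff w(1))
    ultimately show ?thesis by blast
  qed
  then show "\<exists>B. (\<forall>i. open (B i) \<and> x $ i \<in> B i) \<and> (\<forall>y. (\<forall>i. y $ i \<in> B i) \<longrightarrow> y \<in> of_padic_vec ` A)"
    using e by (intro exI[of _ "\<lambda>i. ball (x $ i) ?e"]) simp
qed

definition vshift :: "('n \<Rightarrow> nat) \<Rightarrow> 'p::prime_card padic_int ^ 'n \<Rightarrow> 'p padic_int ^ 'n" where
  "vshift k u = (\<chi> i. unif ^ k i * u $ i)"

lemma vshift_nth [simp]: "vshift k u $ i = unif ^ k i * u $ i"
  by (simp add: vshift_def)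

lemma vshift_eq_iff: "vshift k u = vshift k v \<longleftrightarrow> u = v"
  by (simp add: vec_eq_iff)

lemma vshift_add: "vshift k (u + v) = vshift k u + vshift k v"
  by (simp add: vec_eq_iff algebra_simps)

text \<open>Any modulus exceeding N by at least every \<open>k i\<close> works; the sum of the
  \<open>k i\<close> is a convenient choice.\<close>

lemma cylinder_vshift:
  fixes A :: "('p::prime_card padic_int ^ 'n::finite) set"
  assumes "cylinder N A"
  shows "cylinder (N + sum k UNIV) (vshift k ` A)"
  unfolding cylinder_def
proof (intro ballI allI impI)
  fix x y assume x: "x \<in> vshift k ` A" and d: "\<forall>i. unif ^ (N + sum k UNIV) dvd y $ i - x $ i"
  then obtain u where u: "u \<in> A" "x = vshift k u" by blast
  have "\<exists>w. y $ i = unif ^ k i * w \<and> unif ^ N dvd w - u $ i" for i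
  proof -
    have "k i \<le> sum k UNIV" by (simp add: member_le_sum)
    then have "unif ^ (k i + N) dvd (unif ^ (N + sum k UNIV) :: 'p padic_int)"
      by (intro le_imp_power_dvd) simp
    then obtain q where "y $ i - x $ i = unif ^ (k i + N) * q" using d by (meson dvd_trans dvdE)
    then have "y $ i = unif ^ k i * (u $ i + unif ^ N * q)"
      using u(2) by (simp add: diff_eq_eq algebra_simps power_add)
    then show ?thesis by (intro exI[of _ "u $ i + unif ^ N * q"]) simp
  qed
  then obtain w where w: "\<And>i. y $ i = unif ^ k i * w i" "\<And>i. unif ^ N dvd w i - u $ i" by metis
  have "(\<chi> i. w i) \<in> A" using cylinderD[OF assms u(1)] w(2) by simp
  moreover have "y = vshift k (\<chi> i. w i)" by (simp add: vec_eq_iff w(1))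
  ultimately show "y \<in> vshift k ` A" by blast
qed

lemma cylinder_residue: "cylinder 1 {u. residue_vec u = a}"
  by (auto simp: cylinder_def vec_eq_iff residue_eq_iff[symmetric])

lemma cylinder_mp_eval: "cylinder N {u. unif ^ N dvd mp_eval h u - y}"
  unfolding cylinder_def
proof safe
  fix u w assume "unif ^ N dvd mp_eval h u - y" "\<forall>i. unif ^ N dvd w $ i - u $ i"
  then have "unif ^ N dvd (mp_eval h w - mp_eval h u) + (mp_eval h u - y)"
    by (intro dvd_add mp_eval_diff_dvd) auto
  then show "unif ^ N dvd mp_eval h w - y" by simp
qed

section \<open>Haar measure of sets defined by congruences\<close>

locale haar_measure =
  fixes \<mu> :: "('p::prime_card padic ^ 'n::finite) measure"
  assumes haar: "normalized_haar \<mu>"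
begin

definition pmeas :: "('p padic_int ^ 'n) set \<Rightarrow> real" where
  "pmeas A = measure \<mu> (of_padic_vec ` A)"

lemma sets_haar: "sets \<mu> = sets borel"
  using haar by (simp add: normalized_haar_def)

lemma cylinder_sets: "cylinder N A \<Longrightarrow> of_padic_vec ` A \<in> sets \<mu>"
  using open_cylinder_image sets_haar by (metis borel_open)

lemma emeasure_cube: "emeasure \<mu> Zp_cube = 1"
  using haar by (simp add: normalized_haar_def)

lemma Zp_cube_sets: "Zp_cube \<in> sets \<mu>"
  using cylinder_sets[OF cylinder_UNIV] by (simp add: range_of_padic_vec)

lemma pmeas_UNIV: "pmeas UNIV = 1"
  by (simp add: pmeas_def range_of_padic_vec measure_def emeasure_cube)

lemma emeasure_padic_finite: "emeasure \<mu> (of_padic_vec ` A) \<noteq> \<infinity>"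
proof -
  have "emeasure \<mu> (of_padic_vec ` A) \<le> emeasure \<mu> Zp_cube"
    by (rule emeasure_mono) (use range_of_padic_vec Zp_cube_sets in auto)
  then show ?thesis by (auto simp: emeasure_cube top_unique)
qed

lemma emeasure_eq_pmeas: "emeasure \<mu> (of_padic_vec ` A) = ennreal (pmeas A)"
  using emeasure_padic_finite by (simp add: pmeas_def emeasure_eq_ennreal_measure)

text \<open>Translation invariance of the Haar measure enters here; the masses of boxes and slabs
  follow from it by counting.\<close>

lemma pmeas_translate:
  assumes "cylinder N A"
  shows "pmeas ((+) c ` A) = pmeas A"
proof -
  have "of_padic_vec ` (+) c ` A = (+) (of_padic_vec c) ` of_padic_vec ` A"
    by (simp add: image_image of_padic_vec_add)
  moreover have "of_padic_vec ` A \<in> sets borel" using cylinder_sets[OF assms] sets_haar by simp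
  ultimately have "emeasure \<mu> (of_padic_vec ` (+) c ` A) = emeasure \<mu> (of_padic_vec ` A)"
    using haar by (simp add: normalized_haar_def)
  then show ?thesis by (simp add: pmeas_def measure_def)
qed

lemma pmeas_mono:
  assumes "A \<subseteq> B" "cylinder N A" "cylinder M B"
  shows "pmeas A \<le> pmeas B"
proof -
  have "emeasure \<mu> (of_padic_vec ` A) \<le> emeasure \<mu> (of_padic_vec ` B)"
    by (rule emeasure_mono) (use assms cylinder_sets in auto)
  then show ?thesis
    by (simp add: emeasure_eq_pmeas) (simp add: pmeas_def)
qed

lemma pmeas_UN:
  assumes "finite I" "disjoint_family_on A I" "\<And>i. i \<in> I \<Longrightarrow> \<exists>N. cylinder N (A i)"
  shows "pmeas (\<Union>i\<in>I. A i) = (\<Sum>i\<in>I. pmeas (A i))"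
proof -
  have inj: "inj_on of_padic_vec (X :: ('p padic_int ^ 'n) set)" for X
    by (auto simp: inj_on_def of_padic_vec_eq_iff)
  have "disjoint_family_on (\<lambda>i. of_padic_vec ` A i) I"
    using assms(2) unfolding disjoint_family_on_def
    by (metis image_Int inj image_empty inj_on_image_Int[OF inj Un_upper1 Un_upper2])
  then show ?thesis
    unfolding pmeas_def image_UN
    by (intro measure_finite_Union)
       (use assms cylinder_sets emeasure_padic_finite in \<open>auto simp: image_subset_iff\<close>)
qed

lemma pmeas_Diff:
  assumes "B \<subseteq> A" "cylinder N A" "cylinder M B"
  shows "pmeas (A - B) = pmeas A - pmeas B"
proof -
  have "of_padic_vec ` (A - B) = of_padic_vec ` A - of_padic_vec ` B"
    by (rule image_set_diff) (auto simp: inj_on_def of_padic_vec_eq_iff)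
  then show ?thesis
    unfolding pmeas_def
    by (simp, intro measure_Diff)
       (use assms cylinder_sets emeasure_padic_finite in \<open>auto simp: image_subset_iff\<close>)
qed

text \<open>The translates of the box by representatives of the residues partition Z_p^n and all
  have the same mass, so this mass is one over their number.\<close>

lemma pmeas_box:
  "pmeas {x. \<forall>i. unif ^ e i dvd x $ i} = (\<Prod>i\<in>UNIV. (1 / real CARD('p)) ^ e i)"
proof -
  let ?D = "{x :: 'p padic_int ^ 'n. \<forall>i. unif ^ e i dvd x $ i}"
  let ?I = "\<Pi>\<^sub>E i\<in>(UNIV :: 'n set). {..<CARD('p) ^ e i}"
  let ?c = "\<lambda>r :: 'n \<Rightarrow> nat. (\<chi> i. of_nat (r i)) :: 'p padic_int ^ 'n"
  have fin: "finite ?I" by (intro finite_PiE) auto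
  have cyl: "cylinder (sum e UNIV) ?D"
    unfolding cylinder_def
  proof safe
    fix x y :: "'p padic_int ^ 'n" and i
    assume x: "\<forall>i. unif ^ e i dvd x $ i" and y: "\<forall>i. unif ^ sum e UNIV dvd y $ i - x $ i"
    have "unif ^ e i dvd y $ i - x $ i"
      using y le_imp_power_dvd[of "e i" "sum e UNIV"] by (meson dvd_trans finite member_le_sum UNIV_I zero_le)
    then show "unif ^ e i dvd y $ i" using x dvd_add[of "unif ^ e i" "y $ i - x $ i" "x $ i"] by simp
  qed
  have mem: "x \<in> (+) (?c r) ` ?D \<longleftrightarrow> (\<forall>i. unif ^ e i dvd x $ i - of_nat (r i))" for x r
  proof
    assume "\<forall>i. unif ^ e i dvd x $ i - of_nat (r i)"
    then have "x - ?c r \<in> ?D" by simp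
    then have "?c r + (x - ?c r) \<in> (+) (?c r) ` ?D" by (rule imageI)
    then show "x \<in> (+) (?c r) ` ?D" by simp
  qed auto
  have un: "(\<Union>r\<in>?I. (+) (?c r) ` ?D) = UNIV"
  proof -
    have "\<exists>r\<in>?I. x \<in> (+) (?c r) ` ?D" for x
    proof -
      have "\<forall>i. \<exists>r. r < CARD('p) ^ e i \<and> unif ^ e i dvd x $ i - of_nat r"
        using ex1_residue_mod_power by blast
      then obtain r where r: "\<forall>i. r i < CARD('p) ^ e i \<and> unif ^ e i dvd x $ i - of_nat (r i)"
        by metis
      have "x \<in> (+) (?c r) ` ?D" unfolding mem using r by blast
      moreover have "r \<in> ?I" using r by (simp add: PiE_iff)
      ultimately show ?thesis by (rule bexI)
    qed
    then show ?thesis by blast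
  qed
  have dis: "disjoint_family_on (\<lambda>r. (+) (?c r) ` ?D) ?I"
    unfolding disjoint_family_on_def
  proof (intro ballI impI, rule ccontr)
    fix r s assume rs: "r \<in> ?I" "s \<in> ?I" "r \<noteq> s" "(+) (?c r) ` ?D \<inter> (+) (?c s) ` ?D \<noteq> {}"
    then obtain x where "x \<in> (+) (?c r) ` ?D" "x \<in> (+) (?c s) ` ?D" by blast
    then have "r i = s i" for i
      using ex1_residue_mod_power[of "e i" "x $ i"] rs(1,2) unfolding mem by (auto simp: PiE_iff)
    then show False using rs(3) by auto
  qed
  have "1 = pmeas (\<Union>r\<in>?I. (+) (?c r) ` ?D)" unfolding un by (simp add: pmeas_UNIV)
  also have "\<dots> = (\<Sum>r\<in>?I. pmeas ((+) (?c r) ` ?D))"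
    by (rule pmeas_UN[OF fin dis]) (use cylinder_translate[OF cyl] in blast)
  also have "\<dots> = real (card ?I) * pmeas ?D" by (simp add: pmeas_translate[OF cyl])
  also have "real (card ?I) = (\<Prod>i\<in>UNIV. real CARD('p) ^ e i)" by (simp add: card_PiE)
  finally have "(\<Prod>i\<in>UNIV. real CARD('p) ^ e i) * pmeas ?D = 1" by simp
  moreover have "(\<Prod>i\<in>UNIV. real CARD('p) ^ e i) \<noteq> 0" using int_card_pos[where 'p='p] by simp
  ultimately have "pmeas ?D = 1 / (\<Prod>i\<in>UNIV. real CARD('p) ^ e i)" by (simp add: field_simps)
  also have "\<dots> = (\<Prod>i\<in>UNIV. (1 / real CARD('p)) ^ e i)"
    by (simp add: power_one_over prod_dividef)
  finally show ?thesis .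
qed

lemma cylinder_shift_congruences:
  "\<exists>N. cylinder N (vshift k ` {u. residue_vec u = a \<and> (\<forall>i\<in>R. unif ^ e i dvd mp_eval (h i) u - y i)})"
  if "finite R" for R :: "'r set" and y :: "'r \<Rightarrow> 'p padic_int" and k :: "'n \<Rightarrow> nat"
proof -
  have "cylinder (sum e R) {u. unif ^ e i dvd mp_eval (h i) u - y i}" if "i \<in> R" for i
    by (rule cylinder_mono[OF cylinder_mp_eval]) (use that \<open>finite R\<close> in \<open>simp add: member_le_sum\<close>)
  then have "cylinder (sum e R) (\<Inter>i\<in>R. {u. unif ^ e i dvd mp_eval (h i) u - y i})"
    by (rule cylinder_INT)
  from cylinder_Int[OF cylinder_residue this]
  have "cylinder (max 1 (sum e R)) ({u. residue_vec u = a} \<inter> (\<Inter>i\<in>R. {u. unif ^ e i dvd mp_eval (h i) u - y i}))" .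
  also have "{u. residue_vec u = a} \<inter> (\<Inter>i\<in>R. {u. unif ^ e i dvd mp_eval (h i) u - y i})
      = {u. residue_vec u = a \<and> (\<forall>i\<in>R. unif ^ e i dvd mp_eval (h i) u - y i)}" by auto
  finally show ?thesis using cylinder_vshift by blast
qed

text \<open>Fix a lift \<open>u0\<close> of a. The set is the translate by p^k \<open>u0\<close> of
  a product of ideals; the extra factor p in each coordinate comes from fixing the residue.\<close>

lemma pmeas_residue_box:
  "pmeas (vshift k ` {u. residue_vec u = a}) = (\<Prod>i\<in>UNIV. (1 / real CARD('p)) ^ Suc (k i))"
proof -
  obtain u0 :: "'p padic_int ^ 'n" where u0: "residue_vec u0 = a" using residue_vec_surj by blast
  let ?D = "{x :: 'p padic_int ^ 'n. \<forall>i. unif ^ Suc (k i) dvd x $ i}"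
  have "vshift k ` {u. residue_vec u = a} = (+) (vshift k u0) ` ?D"
  proof (intro Set.set_eqI iffI)
    fix x assume "x \<in> vshift k ` {u. residue_vec u = a}"
    then obtain u where u: "residue_vec u = a" "x = vshift k u" by blast
    have "unif dvd u $ i - u0 $ i" for i
      using u(1) u0 by (metis residue_eq_iff residue_vec_nth)
    then have "vshift k (u - u0) \<in> ?D" by (simp add: mult.commute[of unif] mult_dvd_mono)
    moreover have "x = vshift k u0 + vshift k (u - u0)" by (simp add: u(2) flip: vshift_add)
    ultimately show "x \<in> (+) (vshift k u0) ` ?D" by blast
  next
    fix x assume "x \<in> (+) (vshift k u0) ` ?D"
    then obtain d where d: "\<forall>i. unif ^ Suc (k i) dvd d $ i" "x = vshift k u0 + d" by auto
    then have "\<forall>i. \<exists>q. d $ i = unif ^ Suc (k i) * q" by (auto simp only: dvd_def)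
    then obtain q where q: "\<And>i. d $ i = unif ^ Suc (k i) * q i" by metis
    define u where "u = u0 + (\<chi> i. unif * q i)"
    have "x = vshift k u" by (simp add: d(2) u_def vec_eq_iff q algebra_simps)
    moreover have "residue_vec u = a" using u0 by (auto simp: u_def vec_eq_iff residue_add residue_mult)
    ultimately show "x \<in> vshift k ` {u. residue_vec u = a}" by blast
  qed
  moreover have "cylinder (1 + sum k UNIV) ?D"
  proof -
    have "?D = vshift k ` {u. residue_vec u = 0}"
    proof (intro Set.set_eqI iffI)
      fix x assume "x \<in> ?D"
      then have "\<forall>i. \<exists>q. x $ i = unif ^ Suc (k i) * q" by (auto simp only: dvd_def mem_Collect_eq)
      then obtain q where q: "\<And>i. x $ i = unif ^ Suc (k i) * q i" by metis
      then have "x = vshift k (\<chi> i. unif * q i)" by (simp add: vec_eq_iff mult_ac)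
      moreover have "residue_vec (\<chi> i. unif * q i) = 0" by (simp add: vec_eq_iff residue_mult)
      ultimately show "x \<in> vshift k ` {u. residue_vec u = 0}" by blast
    qed (auto simp: vec_eq_iff residue_eq_0_iff mult.commute[of unif] mult_dvd_mono)
    then show ?thesis using cylinder_vshift[OF cylinder_residue] by metis
  qed
  ultimately show ?thesis by (simp only: pmeas_translate pmeas_box)
qed

end

section \<open>Equidistribution of polynomial values on a residue box\<close>

context haar_measure
begin

text \<open>R indexes polynomials that vanish at a modulo p, and \<open>surj\<close> says that their
  reduced Jacobian is onto. An arbitrary R lets the cases in which f, g, both or neither vanish at a
  share one proof.\<close>

context
  fixes h :: "'r \<Rightarrow> ('n, 'p padic_int) mpolynomial" and R :: "'r set"
    and k :: "'n \<Rightarrow> nat" and a :: "'p mod_ring ^ 'n"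
  assumes fin: "finite R"
    and zero: "\<And>i. i \<in> R \<Longrightarrow> mp_eval (mp_reduce (h i)) a = 0"
    and surj: "\<And>w. \<exists>v. \<forall>i\<in>R. (\<Sum>j\<in>UNIV. mp_eval (mp_pderiv j (mp_reduce (h i))) a * v $ j) = w i"
begin

definition slab :: "('r \<Rightarrow> nat) \<Rightarrow> ('r \<Rightarrow> 'p padic_int) \<Rightarrow> ('p padic_int ^ 'n) set" where
  "slab e y = vshift k ` {u. residue_vec u = a \<and> (\<forall>i\<in>R. unif ^ e i dvd mp_eval (h i) u - y i)}"

lemma cylinder_slab: "\<exists>M. cylinder M (slab e y)"
  unfolding slab_def using cylinder_shift_congruences[OF fin] .

lemma slab_cong: "(\<And>i. i \<in> R \<Longrightarrow> e i = e' i \<and> y i = y' i) \<Longrightarrow> slab e y = slab e' y'"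
  unfolding slab_def by (intro arg_cong[where f = "(`) (vshift k)"] Collect_cong conj_cong ball_cong) simp_all

lemma slab_iff:
  "vshift k u \<in> slab e y \<longleftrightarrow> residue_vec u = a \<and> (\<forall>i\<in>R. unif ^ e i dvd mp_eval (h i) u - y i)"
  unfolding slab_def by (auto simp: vshift_eq_iff)

text \<open>Values that agree with \<open>y i\<close> modulo p^(e i) are classified by their next
  \<open>d i\<close> digits. This is used with one more digit in the induction on the precision, and
  with different \<open>d i\<close> to bring unequal precisions to a common one.\<close>

lemma slab_refine:
  "pmeas (slab e y) = (\<Sum>r\<in>PiE R (\<lambda>i. {..<CARD('p) ^ d i}).
     pmeas (slab (\<lambda>i. e i + d i) (\<lambda>i. y i + unif ^ e i * of_nat (r i))))"
proof -
  let ?I = "\<Pi>\<^sub>E i\<in>R. {..<CARD('p) ^ d i}"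
  let ?A = "\<lambda>r :: 'r \<Rightarrow> nat. slab (\<lambda>i. e i + d i) (\<lambda>i. y i + unif ^ e i * of_nat (r i))"
  have split: "unif ^ (m + l) dvd z - (w + unif ^ m * of_nat c) \<longleftrightarrow> (\<exists>q. z - w = unif ^ m * q \<and> unif ^ l dvd q - of_nat c)"
    for m l c and z w :: "'p padic_int"
  proof
    assume "unif ^ (m + l) dvd z - (w + unif ^ m * of_nat c)"
    then obtain q where "z - (w + unif ^ m * of_nat c) = unif ^ m * (unif ^ l * q)"
      by (auto simp: power_add mult.assoc)
    then show "\<exists>q. z - w = unif ^ m * q \<and> unif ^ l dvd q - of_nat c"
      by (intro exI[of _ "of_nat c + unif ^ l * q"]) (simp add: algebra_simps)
  next
    assume "\<exists>q. z - w = unif ^ m * q \<and> unif ^ l dvd q - of_nat c"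
    then obtain q where q: "z - w = unif ^ m * q" "unif ^ l dvd q - of_nat c" by blast
    have "z - (w + unif ^ m * of_nat c) = unif ^ m * (q - of_nat c)"
      by (simp only: diff_diff_eq[symmetric] q(1) right_diff_distrib)
    then show "unif ^ (m + l) dvd z - (w + unif ^ m * of_nat c)"
      using mult_dvd_mono[OF dvd_refl q(2)] by (simp only: power_add)
  qed
  have un: "slab e y = (\<Union>r\<in>?I. ?A r)"
  proof (intro equalityI subsetI)
    fix x assume "x \<in> slab e y"
    then obtain u where u: "x = vshift k u" "vshift k u \<in> slab e y" unfolding slab_def by blast
    have "\<forall>i. \<exists>q. i \<in> R \<longrightarrow> mp_eval (h i) u - y i = unif ^ e i * q"
      using u(2) unfolding slab_iff dvd_def by blast
    then obtain q where q: "\<And>i. i \<in> R \<Longrightarrow> mp_eval (h i) u - y i = unif ^ e i * q i" by metis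
    have "\<forall>i. \<exists>r. r < CARD('p) ^ d i \<and> unif ^ d i dvd q i - of_nat r"
      using ex1_residue_mod_power by blast
    then obtain r where r: "\<And>i. r i < CARD('p) ^ d i" "\<And>i. unif ^ d i dvd q i - of_nat (r i)" by metis
    have "x \<in> ?A (restrict r R)"
      using u(2) q r(2) unfolding u(1) slab_iff split by auto
    moreover have "restrict r R \<in> ?I" using r(1) by auto
    ultimately show "x \<in> (\<Union>r\<in>?I. ?A r)" by blast
  next
    fix x assume "x \<in> (\<Union>r\<in>?I. ?A r)"
    then obtain r u where u: "x = vshift k u" "vshift k u \<in> ?A r" unfolding slab_def by blast
    then show "x \<in> slab e y" unfolding u(1) slab_iff split by (metis dvd_triv_left)
  qed
  have dis: "disjoint_family_on ?A ?I"
    unfolding disjoint_family_on_def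
  proof (intro ballI impI, rule ccontr)
    fix r s assume rs: "r \<in> ?I" "s \<in> ?I" "r \<noteq> s" "?A r \<inter> ?A s \<noteq> {}"
    then obtain x where x: "x \<in> ?A r" "x \<in> ?A s" by blast
    then obtain u where "x = vshift k u" unfolding slab_def by blast
    note x = x[unfolded this slab_iff split]
    have "r i = s i" if i: "i \<in> R" for i
    proof -
      obtain q q' where "mp_eval (h i) u - y i = unif ^ e i * q" "unif ^ d i dvd q - of_nat (r i)"
        "mp_eval (h i) u - y i = unif ^ e i * q'" "unif ^ d i dvd q' - of_nat (s i)"
        using x i by blast
      moreover from this have "q' = q" by simp
      moreover have "r i < CARD('p) ^ d i" "s i < CARD('p) ^ d i" using rs(1,2) i by (auto simp: PiE_iff)
      ultimately show ?thesis using ex1_residue_mod_power by metis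
    qed
    then show False using rs(1-3) by (metis PiE_ext)
  qed
  show ?thesis
    unfolding un by (rule pmeas_UN[OF _ dis cylinder_slab]) (intro finite_PiE fin, simp)
qed

text \<open>By Taylor's formula, translation by \<open>p\<^sup>N v\<close> changes \<open>h u\<close> modulo \<open>p\<^sup>N\<^sup>+\<^sup>1\<close> by
  \<open>p\<^sup>N J v\<close>, where the Jacobian \<open>J\<close> at \<open>a\<close> is onto.\<close>

lemma pmeas_fibre_le:
  assumes N: "N \<ge> 1" and y: "\<And>i. i \<in> R \<Longrightarrow> unif ^ N dvd y' i - y i"
  shows "pmeas (slab (\<lambda>_. Suc N) y) \<le> pmeas (slab (\<lambda>_. Suc N) y')"
proof -
  have "\<forall>i. \<exists>w. i \<in> R \<longrightarrow> y' i - y i = unif ^ N * w" using y by (auto simp: dvd_def)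
  then obtain w where w: "\<And>i. i \<in> R \<Longrightarrow> y' i - y i = unif ^ N * w i" by metis
  \<comment> \<open>The Jacobian equation is solved modulo p only. This suffices, since its value is
    multiplied by p^N and matters modulo p^(N+1).\<close>
  obtain v' where v': "\<And>i. i \<in> R \<Longrightarrow>
      (\<Sum>j\<in>UNIV. mp_eval (mp_pderiv j (mp_reduce (h i))) a * v' $ j) = residue (w i)"
    using surj[of "\<lambda>i. residue (w i)"] by blast
  obtain v where v: "residue_vec v = v'" using residue_vec_surj by blast
  define c where "c = vshift k (unif ^ N *s v)"
  have "(+) c ` slab (\<lambda>_. Suc N) y \<subseteq> slab (\<lambda>_. Suc N) y'"
  proof
    fix x assume "x \<in> (+) c ` slab (\<lambda>_. Suc N) y"
    then obtain u where u: "residue_vec u = a" "\<And>i. i \<in> R \<Longrightarrow> unif ^ Suc N dvd mp_eval (h i) u - y i"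
      "x = c + vshift k u" unfolding slab_def by blast
    have x: "x = vshift k (u + unif ^ N *s v)" by (simp add: u(3) c_def vshift_add)
    have "residue_vec (u + unif ^ N *s v) = a"
      using u(1) N by (auto simp: vec_eq_iff residue_add residue_mult residue_power)
    moreover have "unif ^ Suc N dvd mp_eval (h i) (u + unif ^ N *s v) - y' i" if i: "i \<in> R" for i
    proof -
      let ?D = "\<Sum>j\<in>UNIV. mp_eval (mp_pderiv j (h i)) u * v $ j"
      obtain T where T: "mp_eval (h i) (u + unif ^ N *s v)
          = mp_eval (h i) u + unif ^ N * ?D + (unif ^ N)\<^sup>2 * T"
        using mp_eval_taylor by blast
      have "residue ?D = residue (w i)"
        using v'[OF i] u(1) v by (auto simp: residue_sum residue_mult residue_mp_eval_pderiv)
      then have "unif dvd ?D - w i" by (simp add: residue_eq_iff)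
      then have "unif ^ Suc N dvd unif ^ N * (?D - w i)" by (simp add: mult.commute mult_dvd_mono)
      \<comment> \<open>Here N >= 1 enters: the quadratic term is divisible by p^(2N), and 2N >= N +
        1.\<close>
      moreover have "(unif ^ Suc N :: 'p padic_int) dvd (unif ^ N)\<^sup>2 * T"
        unfolding power_mult[symmetric] using N by (intro dvd_mult2 le_imp_power_dvd) simp
      ultimately have "unif ^ Suc N dvd
          (mp_eval (h i) u - y i) + unif ^ N * (?D - w i) + (unif ^ N)\<^sup>2 * T"
        using u(2)[OF i] by (intro dvd_add)
      also have "\<dots> = mp_eval (h i) (u + unif ^ N *s v) - (y i + unif ^ N * w i)"
        unfolding T by (simp add: algebra_simps)
      also have "y i + unif ^ N * w i = y' i" using w[OF i] by (simp add: algebra_simps)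
      finally show ?thesis .
    qed
    ultimately show "x \<in> slab (\<lambda>_. Suc N) y'" unfolding slab_def x by blast
  qed
  moreover obtain M where M: "cylinder M (slab (\<lambda>_. Suc N) y)" using cylinder_slab by blast
  moreover obtain M' where "cylinder M' (slab (\<lambda>_. Suc N) y')" using cylinder_slab by blast
  ultimately have "pmeas ((+) c ` slab (\<lambda>_. Suc N) y) \<le> pmeas (slab (\<lambda>_. Suc N) y')"
    by (meson pmeas_mono cylinder_translate)
  then show ?thesis by (simp add: pmeas_translate[OF M])
qed

text \<open>Translation yields an inclusion and hence an inequality; exchanging y and y' yields the
  other one.\<close>

lemma pmeas_fibre_eq:
  assumes "N \<ge> 1" "\<And>i. i \<in> R \<Longrightarrow> unif ^ N dvd y' i - y i"
  shows "pmeas (slab (\<lambda>_. Suc N) y) = pmeas (slab (\<lambda>_. Suc N) y')"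
proof (rule antisym)
  have "unif ^ N dvd y i - y' i" if "i \<in> R" for i
    using assms(2)[OF that] by (metis dvd_minus_iff minus_diff_eq)
  then show "pmeas (slab (\<lambda>_. Suc N) y') \<le> pmeas (slab (\<lambda>_. Suc N) y)"
    using pmeas_fibre_le[OF assms(1)] by blast
qed (use pmeas_fibre_le assms in blast)

lemma unif_dvd: "i \<in> R \<Longrightarrow> residue_vec u = a \<Longrightarrow> unif dvd mp_eval (h i) u"
  using zero by (simp add: residue_eq_0_iff[symmetric] residue_mp_eval)

text \<open>At precision 1 the congruences hold automatically, both sides being divisible by p. Each
  further digit splits the slab into p^(card R) slabs, which have equal mass because their centres
  agree modulo the previous power.\<close>

lemma pmeas_fibre:
  assumes "\<And>i. i \<in> R \<Longrightarrow> unif dvd y i"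
  shows "pmeas (slab (\<lambda>_. Suc N) y)
    = (\<Prod>i\<in>UNIV. (1 / real CARD('p)) ^ Suc (k i)) * (1 / real CARD('p)) ^ (card R * N)"
proof (induction N)
  case 0
  have "unif ^ 1 dvd mp_eval (h i) u - y i" if "i \<in> R" "residue_vec u = a" for i u
    using unif_dvd[OF that] assms[OF that(1)] by simp
  then have "slab (\<lambda>_. Suc 0) y = vshift k ` {u. residue_vec u = a}" by (auto simp: slab_def)
  then show ?case by (simp only: pmeas_residue_box) simp
next
  case (Suc N)
  let ?I = "\<Pi>\<^sub>E i\<in>R. {..<CARD('p) ^ 1}"
  have eq: "pmeas (slab (\<lambda>_. Suc N + 1) (\<lambda>i. y i + unif ^ Suc N * of_nat (r i))) = pmeas (slab (\<lambda>_. Suc (Suc N)) y)" for r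
    using pmeas_fibre_eq[of "Suc N" "\<lambda>i. y i + unif ^ Suc N * of_nat (r i)" y] by simp
  have "pmeas (slab (\<lambda>_. Suc N) y) = (\<Sum>r\<in>?I. pmeas (slab (\<lambda>_. Suc (Suc N)) y))"
    unfolding slab_refine[of "\<lambda>_. Suc N" y "\<lambda>_. 1"] eq ..
  also have "\<dots> = real CARD('p) ^ card R * pmeas (slab (\<lambda>_. Suc (Suc N)) y)"
    using fin by (simp add: card_PiE)
  finally have "pmeas (slab (\<lambda>_. Suc (Suc N)) y) = (1 / real CARD('p)) ^ card R * pmeas (slab (\<lambda>_. Suc N) y)"
    using int_card_pos[where 'p='p] by (simp add: field_simps)
  then show ?case unfolding Suc.IH by (simp add: power_add)
qed

text \<open>\<open>pmeas_fibre\<close> needs one precision for all components. So every component is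
  refined to a common precision N + 1, where all slabs have the same mass, and the slabs are
  counted.\<close>

lemma pmeas_levels:
  "pmeas (vshift k ` {u. residue_vec u = a \<and> (\<forall>i\<in>R. unif ^ e i dvd mp_eval (h i) u)})
    = (\<Prod>i\<in>UNIV. (1 / real CARD('p)) ^ Suc (k i)) * (\<Prod>i\<in>R. (1 / real CARD('p)) ^ (e i - 1))"
proof -
  let ?q = "1 / real CARD('p)"
  define d where "d i = e i - 1" for i
  define N where "N = sum d R"
  have dN: "d i \<le> N" if "i \<in> R" for i using that fin by (simp add: N_def member_le_sum)
  let ?I = "\<Pi>\<^sub>E i\<in>R. {..<CARD('p) ^ (N - d i)}"
  \<comment> \<open>Exponents 0 and 1 impose the same condition, as the values are divisible by p
    anyway; this accounts for the truncated \<open>e i - 1\<close>.\<close>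
  have e: "unif ^ e i dvd mp_eval (h i) u \<longleftrightarrow> unif ^ Suc (d i) dvd mp_eval (h i) u - 0"
    if "i \<in> R" "residue_vec u = a" for i u
    using unif_dvd[OF that] by (cases "e i") (simp_all add: d_def)
  have V: "vshift k ` {u. residue_vec u = a \<and> (\<forall>i\<in>R. unif ^ e i dvd mp_eval (h i) u)}
      = slab (\<lambda>i. Suc (d i)) (\<lambda>_. 0)"
    unfolding slab_def using e by (intro arg_cong[where f = "(`) (vshift k)"] Collect_cong) blast
  have S: "slab (\<lambda>i. Suc (d i) + (N - d i)) y = slab (\<lambda>_. Suc N) y" for y
    by (rule slab_cong) (use dN in simp)
  have "pmeas (slab (\<lambda>i. Suc (d i)) (\<lambda>_. 0)) = (\<Sum>r\<in>?I. (\<Prod>i\<in>UNIV. ?q ^ Suc (k i)) * ?q ^ (card R * N))"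
    unfolding slab_refine[of "\<lambda>i. Suc (d i)" _ "\<lambda>i. N - d i"] S
    by (intro sum.cong refl pmeas_fibre) simp
  also have "\<dots> = (\<Prod>i\<in>UNIV. ?q ^ Suc (k i)) * (real (card ?I) * ?q ^ (card R * N))"
    by simp
  also have "real (card ?I) = (\<Prod>i\<in>R. real CARD('p) ^ (N - d i))" using fin by (simp add: card_PiE)
  also have "?q ^ (card R * N) = (\<Prod>i\<in>R. ?q ^ N)" by (simp add: mult.commute power_mult)
  also have "(\<Prod>i\<in>R. real CARD('p) ^ (N - d i)) * (\<Prod>i\<in>R. ?q ^ N) = (\<Prod>i\<in>R. ?q ^ d i)"
    unfolding prod.distrib[symmetric]
  proof (rule prod.cong)
    fix i assume "i \<in> R"
    then have "?q ^ N = ?q ^ (N - d i) * ?q ^ d i" using dN by (simp flip: power_add)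
    moreover have "real CARD('p) ^ (N - d i) * ?q ^ (N - d i) = 1"
      using int_card_pos[where 'p='p] by (simp flip: power_mult_distrib)
    ultimately show "real CARD('p) ^ (N - d i) * ?q ^ N = ?q ^ d i"
      by (metis mult.assoc mult_1)
  qed simp
  finally show ?thesis unfolding V by (simp add: d_def)
qed

end

end

section \<open>Newton polyhedra and cells\<close>

lemma exponent_vec_nonneg: "exponent_vec \<omega> $ i \<ge> 0"
  by (simp add: exponent_vec_def)

lemma inner_orthant_nonneg: "\<kappa> \<in> orthant \<Longrightarrow> y \<in> orthant \<Longrightarrow> \<kappa> \<bullet> y \<ge> 0"
  by (simp add: orthant_def inner_vec_def sum_nonneg)

lemma exponent_vec_orthant: "exponent_vec \<omega> \<in> orthant"
  by (simp add: orthant_def exponent_vec_nonneg)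

lemma axis_orthant: "axis i 1 \<in> (orthant :: (real ^ 'n::finite) set)"
  by (simp add: orthant_def axis_def)

text \<open>Together with \<open>zero_coords\<close> this is the finite data of a face: the face cut
  out by \<kappa> is the convex hull of the tight exponents plus the cone of the coordinate
  directions in which \<kappa> vanishes.\<close>

definition tight :: "('n::finite \<Rightarrow>\<^sub>0 nat) set \<Rightarrow> real ^ 'n \<Rightarrow> ('n \<Rightarrow>\<^sub>0 nat) set" where
  "tight \<Omega> \<kappa> = {\<omega> \<in> \<Omega>. \<kappa> \<bullet> exponent_vec \<omega> = Min ((\<lambda>\<omega>. \<kappa> \<bullet> exponent_vec \<omega>) ` \<Omega>)}"

definition zero_coords :: "real ^ 'n \<Rightarrow> 'n set" where
  "zero_coords \<kappa> = {i. \<kappa> $ i = 0}"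

lemma newton_polyhedron_gen:
  "\<omega> \<in> \<Omega> \<Longrightarrow> y \<in> orthant \<Longrightarrow> exponent_vec \<omega> + y \<in> newton_polyhedron \<Omega>"
  unfolding newton_polyhedron_def by (rule hull_inc) blast

lemma newton_polyhedron_vertex: "\<omega> \<in> \<Omega> \<Longrightarrow> exponent_vec \<omega> \<in> newton_polyhedron \<Omega>"
  using newton_polyhedron_gen[of \<omega> \<Omega> 0] by (simp add: orthant_def)

lemma newton_polyhedron_halfspace:
  assumes "\<And>\<omega> y. \<omega> \<in> \<Omega> \<Longrightarrow> y \<in> orthant \<Longrightarrow> c \<bullet> (exponent_vec \<omega> + y) \<ge> b"
    and "x \<in> newton_polyhedron \<Omega>"
  shows "c \<bullet> x \<ge> b"
proof -
  have "newton_polyhedron \<Omega> \<subseteq> {x. c \<bullet> x \<ge> b}"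
    unfolding newton_polyhedron_def
    by (rule hull_minimal) (use assms(1) in \<open>auto simp: convex_halfspace_ge\<close>)
  then show ?thesis using assms(2) by auto
qed

context
  fixes \<Omega> :: "('n::finite \<Rightarrow>\<^sub>0 nat) set"
  assumes fin\<Omega>: "finite \<Omega>" and ne\<Omega>: "\<Omega> \<noteq> {}"
begin

lemma newton_polyhedron_lower_bound:
  assumes "\<kappa> \<in> orthant" "x \<in> newton_polyhedron \<Omega>"
  shows "\<kappa> \<bullet> x \<ge> Min ((\<lambda>\<omega>. \<kappa> \<bullet> exponent_vec \<omega>) ` \<Omega>)"
proof (rule newton_polyhedron_halfspace[OF _ assms(2)])
  fix \<omega> y assume "\<omega> \<in> \<Omega>" "y \<in> (orthant :: (real ^ 'n) set)"
  then have "Min ((\<lambda>\<omega>. \<kappa> \<bullet> exponent_vec \<omega>) ` \<Omega>) \<le> \<kappa> \<bullet> exponent_vec \<omega>" "\<kappa> \<bullet> y \<ge> 0"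
    using fin\<Omega> inner_orthant_nonneg[OF assms(1)] by auto
  then show "Min ((\<lambda>\<omega>. \<kappa> \<bullet> exponent_vec \<omega>) ` \<Omega>) \<le> \<kappa> \<bullet> (exponent_vec \<omega> + y)"
    by (simp add: inner_add_right)
qed

lemma tight_nonempty: "tight \<Omega> \<kappa> \<noteq> {}"
proof -
  have "Min ((\<lambda>\<omega>. \<kappa> \<bullet> exponent_vec \<omega>) ` \<Omega>) \<in> (\<lambda>\<omega>. \<kappa> \<bullet> exponent_vec \<omega>) ` \<Omega>"
    using fin\<Omega> ne\<Omega> by (intro Min_in) auto
  then show ?thesis by (auto simp: tight_def)
qed

lemma min_val_newton:
  assumes "\<kappa> \<in> orthant"
  shows "min_val (newton_polyhedron \<Omega>) \<kappa> = Min ((\<lambda>\<omega>. \<kappa> \<bullet> exponent_vec \<omega>) ` \<Omega>)"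
proof -
  obtain \<omega> where \<omega>: "\<omega> \<in> tight \<Omega> \<kappa>" using tight_nonempty by blast
  show ?thesis
    unfolding min_val_def
  proof (rule cInf_eq_minimum)
    show "Min ((\<lambda>\<omega>. \<kappa> \<bullet> exponent_vec \<omega>) ` \<Omega>) \<in> (\<lambda>x. \<kappa> \<bullet> x) ` newton_polyhedron \<Omega>"
      using \<omega> newton_polyhedron_vertex by (force simp: tight_def intro: image_eqI[of _ _ "exponent_vec \<omega>"])
  qed (use newton_polyhedron_lower_bound[OF assms] in auto)
qed

lemma min_val_le: "\<kappa> \<in> orthant \<Longrightarrow> x \<in> newton_polyhedron \<Omega> \<Longrightarrow> min_val (newton_polyhedron \<Omega>) \<kappa> \<le> \<kappa> \<bullet> x"
  using newton_polyhedron_lower_bound by (simp add: min_val_newton)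

lemma min_val_nonneg:
  assumes "\<kappa> \<in> orthant"
  shows "min_val (newton_polyhedron \<Omega>) \<kappa> \<ge> 0"
  unfolding min_val_newton[OF assms]
  using fin\<Omega> ne\<Omega> inner_orthant_nonneg[OF assms exponent_vec_orthant] by auto

lemma vertex_first_meet_iff:
  assumes "\<kappa> \<in> orthant" "\<omega> \<in> \<Omega>"
  shows "exponent_vec \<omega> \<in> first_meet (newton_polyhedron \<Omega>) \<kappa> \<longleftrightarrow> \<omega> \<in> tight \<Omega> \<kappa>"
  using assms newton_polyhedron_vertex by (auto simp: first_meet_def tight_def min_val_newton)

lemma is_face_first_meet:
  assumes "\<kappa> \<in> orthant"
  shows "is_face (first_meet (newton_polyhedron \<Omega>) \<kappa>) (newton_polyhedron \<Omega>)"
proof -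
  let ?\<Gamma> = "newton_polyhedron \<Omega>"
  have "(?\<Gamma> \<inter> {x. \<kappa> \<bullet> x = min_val ?\<Gamma> \<kappa>}) exposed_face_of ?\<Gamma>"
    by (rule exposed_face_of_Int_supporting_hyperplane_ge)
       (use min_val_le[OF assms] in \<open>auto simp: newton_polyhedron_def\<close>)
  moreover have "?\<Gamma> \<inter> {x. \<kappa> \<bullet> x = min_val ?\<Gamma> \<kappa>} = first_meet ?\<Gamma> \<kappa>"
    by (auto simp: first_meet_def)
  moreover have "first_meet ?\<Gamma> \<kappa> \<noteq> {}"
    using tight_nonempty[of \<kappa>] vertex_first_meet_iff[OF assms] by (auto simp: tight_def)
  ultimately show ?thesis by (simp add: is_face_def)
qed

text \<open>For a large constant C, the excess of \<kappa>' over its minimum is at most C times the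
  excess of \<kappa>: this can be checked at the exponents and along the axes, and it passes to the
  convex hull. At a point where the excess of \<kappa> is 0, so is that of \<kappa>'.\<close>

lemma first_meet_mono:
  assumes \<kappa>: "\<kappa> \<in> orthant" "\<kappa>' \<in> orthant"
    and t: "tight \<Omega> \<kappa> \<subseteq> tight \<Omega> \<kappa>'" and z: "zero_coords \<kappa> \<subseteq> zero_coords \<kappa>'"
  shows "first_meet (newton_polyhedron \<Omega>) \<kappa> \<subseteq> first_meet (newton_polyhedron \<Omega>) \<kappa>'"
proof
  fix x assume x: "x \<in> first_meet (newton_polyhedron \<Omega>) \<kappa>"
  let ?m = "Min ((\<lambda>\<omega>. \<kappa> \<bullet> exponent_vec \<omega>) ` \<Omega>)" and ?m' = "Min ((\<lambda>\<omega>. \<kappa>' \<bullet> exponent_vec \<omega>) ` \<Omega>)"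
  let ?a = "\<lambda>\<omega>. \<kappa> \<bullet> exponent_vec \<omega> - ?m" and ?a' = "\<lambda>\<omega>. \<kappa>' \<bullet> exponent_vec \<omega> - ?m'"
  have nn: "?a \<omega> \<ge> 0" "?a' \<omega> \<ge> 0" if "\<omega> \<in> \<Omega>" for \<omega> using that fin\<Omega> by auto
  have nk: "\<kappa> $ i \<ge> 0" "\<kappa>' $ i \<ge> 0" for i using \<kappa> by (auto simp: orthant_def)
  \<comment> \<open>The sum of all ratios bounds each of them. A ratio with denominator 0 counts as
    0; it belongs to a tight exponent or a zero coordinate, where the hypotheses make the excess of
    \<kappa>' vanish too.\<close>
  define C where "C = (\<Sum>\<omega>\<in>\<Omega>. ?a' \<omega> / ?a \<omega>) + (\<Sum>i\<in>UNIV. \<kappa>' $ i / \<kappa> $ i)"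
  have C1: "?a' \<omega> \<le> C * ?a \<omega>" if "\<omega> \<in> \<Omega>" for \<omega>
  proof (cases "?a \<omega> = 0")
    case True
    then have "\<omega> \<in> tight \<Omega> \<kappa>" using that by (simp add: tight_def)
    then have "\<omega> \<in> tight \<Omega> \<kappa>'" using t by blast
    then have "?a' \<omega> = 0" by (simp add: tight_def)
    then show ?thesis using True by simp
  next
    case False
    have "?a' \<omega> / ?a \<omega> \<le> (\<Sum>\<omega>\<in>\<Omega>. ?a' \<omega> / ?a \<omega>)"
      using fin\<Omega> that nn by (intro member_le_sum) auto
    also have "\<dots> \<le> C" unfolding C_def using nk by (simp add: sum_nonneg)
    finally show ?thesis using False nn(1)[OF that] by (simp add: divide_le_eq split: if_splits)
  qed
  have C2: "\<kappa>' $ i \<le> C * \<kappa> $ i" for i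
  proof (cases "\<kappa> $ i = 0")
    case True
    then show ?thesis using z by (auto simp: zero_coords_def)
  next
    case False
    have "\<kappa>' $ i / \<kappa> $ i \<le> (\<Sum>i\<in>UNIV. \<kappa>' $ i / \<kappa> $ i)" using nk by (intro member_le_sum) auto
    also have "\<dots> \<le> C" unfolding C_def using nn by (simp add: sum_nonneg)
    finally show ?thesis using False nk(1)[of i] by (simp add: divide_le_eq split: if_splits)
  qed
  have "(C *\<^sub>R \<kappa> - \<kappa>') \<bullet> x \<ge> C * ?m - ?m'"
  proof (rule newton_polyhedron_halfspace)
    fix \<omega> y assume \<omega>: "\<omega> \<in> \<Omega>" and y: "y \<in> (orthant :: (real ^ 'n) set)"
    have "(C *\<^sub>R \<kappa> - \<kappa>') \<bullet> y \<ge> 0"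
      by (rule inner_orthant_nonneg) (use y C2 in \<open>auto simp: orthant_def\<close>)
    then show "C * ?m - ?m' \<le> (C *\<^sub>R \<kappa> - \<kappa>') \<bullet> (exponent_vec \<omega> + y)"
      using C1[OF \<omega>] by (simp add: inner_add_right inner_diff_left right_diff_distrib)
  qed (use x in \<open>simp add: first_meet_def\<close>)
  then have "\<kappa>' \<bullet> x \<le> ?m'"
    using x \<kappa> by (simp add: first_meet_def min_val_newton inner_diff_left)
  then show "x \<in> first_meet (newton_polyhedron \<Omega>) \<kappa>'"
    using x newton_polyhedron_lower_bound[OF \<kappa>(2)] \<kappa>
    by (force simp: first_meet_def min_val_newton)
qed

text \<open>Reduces equality of faces to finite data. Conversely to \<open>first_meet_mono\<close>,
  a face reveals the zero coordinates: moving from a tight exponent along the i-th axis stays in the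
  face exactly if the i-th coordinate of \<kappa> is 0.\<close>

lemma first_meet_eq_iff:
  assumes \<kappa>: "\<kappa> \<in> orthant" "\<kappa>' \<in> orthant"
  shows "first_meet (newton_polyhedron \<Omega>) \<kappa> = first_meet (newton_polyhedron \<Omega>) \<kappa>' \<longleftrightarrow>
    tight \<Omega> \<kappa> = tight \<Omega> \<kappa>' \<and> zero_coords \<kappa> = zero_coords \<kappa>'"
proof
  assume eq: "first_meet (newton_polyhedron \<Omega>) \<kappa> = first_meet (newton_polyhedron \<Omega>) \<kappa>'"
  have t: "tight \<Omega> \<kappa> = tight \<Omega> \<kappa>'"
    using vertex_first_meet_iff[OF \<kappa>(1)] vertex_first_meet_iff[OF \<kappa>(2)] eq
    by (auto simp: tight_def)
  obtain \<omega> where \<omega>: "\<omega> \<in> tight \<Omega> \<kappa>" using tight_nonempty by blast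
  then have \<omega>': "\<omega> \<in> \<Omega>" "\<omega> \<in> tight \<Omega> \<kappa>'" using t by (auto simp: tight_def)
  have *: "exponent_vec \<omega> + axis i 1 \<in> first_meet (newton_polyhedron \<Omega>) \<nu> \<longleftrightarrow> \<nu> $ i = 0"
    if "\<omega> \<in> tight \<Omega> \<nu>" "\<nu> \<in> orthant" for \<nu> i
    using that newton_polyhedron_gen[OF \<omega>'(1) axis_orthant]
    by (auto simp: first_meet_def min_val_newton tight_def inner_add_right inner_axis)
  show "tight \<Omega> \<kappa> = tight \<Omega> \<kappa>' \<and> zero_coords \<kappa> = zero_coords \<kappa>'"
    using t *[OF \<omega> \<kappa>(1)] *[OF \<omega>'(2) \<kappa>(2)] eq by (auto simp: zero_coords_def)
qed (use first_meet_mono assms in \<open>metis order_refl subset_antisym\<close>)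

text \<open>That x minimizes the linear form \<kappa>' over the polyhedron is a family of weak
  inequalities in \<kappa>', so it persists in the closure, where the face of \<kappa>' may be
  larger.\<close>

lemma first_meet_min_val_linear:
  assumes "x \<in> first_meet (newton_polyhedron \<Omega>) \<kappa>"
    and "\<delta> \<subseteq> {\<kappa>' \<in> orthant. first_meet (newton_polyhedron \<Omega>) \<kappa>' = first_meet (newton_polyhedron \<Omega>) \<kappa>}"
    and "\<kappa>' \<in> closure \<delta>"
  shows "\<kappa>' \<in> orthant" "min_val (newton_polyhedron \<Omega>) \<kappa>' = \<kappa>' \<bullet> x"
proof -
  let ?\<Gamma> = "newton_polyhedron \<Omega>"
  let ?S = "{k. \<forall>i. k $ i \<ge> 0} \<inter> (\<Inter>y\<in>?\<Gamma>. {k. k \<bullet> x \<le> k \<bullet> y})"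
  have x: "x \<in> ?\<Gamma>" using assms(1) by (simp add: first_meet_def)
  have "closed ?S"
    by (intro closed_Int closed_INT ballI closed_Collect_all closed_Collect_le continuous_intros)
  moreover have "\<delta> \<subseteq> ?S"
  proof
    fix k assume k: "k \<in> \<delta>"
    then have o: "k \<in> orthant" and "x \<in> first_meet ?\<Gamma> k" using assms(1,2) by auto
    then have "k \<bullet> x = min_val ?\<Gamma> k" by (simp add: first_meet_def)
    then show "k \<in> ?S" using min_val_le[OF o] o by (auto simp: orthant_def)
  qed
  ultimately have S: "\<kappa>' \<in> ?S" using assms(3) closure_minimal by blast
  then show o: "\<kappa>' \<in> orthant" by (simp add: orthant_def)
  obtain \<omega> where "\<omega> \<in> tight \<Omega> \<kappa>'" using tight_nonempty by blast
  then have "exponent_vec \<omega> \<in> ?\<Gamma>" "\<kappa>' \<bullet> exponent_vec \<omega> = min_val ?\<Gamma> \<kappa>'"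
    using newton_polyhedron_vertex by (auto simp: tight_def min_val_newton[OF o])
  then have "\<kappa>' \<bullet> x \<le> min_val ?\<Gamma> \<kappa>'" using S by auto
  then show "min_val ?\<Gamma> \<kappa>' = \<kappa>' \<bullet> x" using min_val_le[OF o x] by simp
qed

end

section \<open>The partition of the orthant into cells\<close>

definition map_keys :: "('n::finite, 'a::zero) mpolynomial ^ 't::finite \<Rightarrow> ('n \<Rightarrow>\<^sub>0 nat) set" where
  "map_keys f = (\<Union>i. Poly_Mapping.keys (f $ i))"

lemma finite_map_keys: "finite (map_keys f)"
  by (simp add: map_keys_def)

text \<open>The cell of a vector is its equivalence class under having the same two faces. Naming
  cells by their members avoids quantifying over pairs of faces.\<close>

definition cell :: "('n::finite, 'a::zero) mpolynomial ^ 't::finite \<Rightarrow> ('n, 'a) mpolynomial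
    \<Rightarrow> real ^ 'n \<Rightarrow> (real ^ 'n) set" where
  "cell f g \<kappa> = {\<kappa>' \<in> orthant. first_meet (Gam_f f) \<kappa>' = first_meet (Gam_f f) \<kappa>
     \<and> first_meet (Gam_g g) \<kappa>' = first_meet (Gam_g g) \<kappa>}"

lemma cell_self: "\<kappa> \<in> orthant \<Longrightarrow> \<kappa> \<in> cell f g \<kappa>"
  by (simp add: cell_def)

lemma cell_eqI: "\<kappa>' \<in> cell f g \<kappa> \<Longrightarrow> cell f g \<kappa>' = cell f g \<kappa>"
  by (auto simp: cell_def)

lemma cell_dual_cone:
  "cell f g \<kappa> = dual_cone (Gam_f f) (first_meet (Gam_f f) \<kappa>) \<inter> dual_cone (Gam_g g) (first_meet (Gam_g g) \<kappa>)"
  by (auto simp: cell_def dual_cone_def)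

context
  fixes f :: "('n::finite, 'a::zero) mpolynomial ^ 't::finite" and g :: "('n, 'a) mpolynomial"
  assumes nef: "map_keys f \<noteq> {}" and neg: "Poly_Mapping.keys g \<noteq> {}"
begin

lemma Gam_f_eq: "Gam_f f = newton_polyhedron (map_keys f)"
  by (simp add: Gam_f_def map_keys_def)

lemmas fm_f = finite_map_keys[of f] nef
lemmas fm_g = finite_keys[of g] neg

lemma is_face_f: "\<kappa> \<in> orthant \<Longrightarrow> is_face (first_meet (Gam_f f) \<kappa>) (Gam_f f)"
  unfolding Gam_f_eq by (rule is_face_first_meet[OF fm_f])

lemma is_face_g: "\<kappa> \<in> orthant \<Longrightarrow> is_face (first_meet (Gam_g g) \<kappa>) (Gam_g g)"
  unfolding Gam_g_def by (rule is_face_first_meet[OF fm_g])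

lemma Delta_eq: "Delta f g = cell f g ` orthant"
proof (intro equalityI subsetI)
  fix \<delta> assume "\<delta> \<in> Delta f g"
  then obtain \<tau> \<tau>' where \<delta>: "\<delta> = dual_cone (Gam_f f) \<tau> \<inter> dual_cone (Gam_g g) \<tau>'" "\<delta> \<noteq> {}"
    unfolding Delta_def by blast
  then obtain \<kappa> where "\<kappa> \<in> orthant" "first_meet (Gam_f f) \<kappa> = \<tau>" "first_meet (Gam_g g) \<kappa> = \<tau>'"
    unfolding dual_cone_def by blast
  then show "\<delta> \<in> cell f g ` orthant" using \<delta>(1) cell_dual_cone by blast
next
  fix \<delta> assume "\<delta> \<in> cell f g ` orthant"
  then obtain \<kappa> where \<kappa>: "\<kappa> \<in> orthant" "\<delta> = cell f g \<kappa>" by blast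
  then have "\<delta> \<noteq> {}" using cell_self by blast
  then show "\<delta> \<in> Delta f g"
    unfolding Delta_def using \<kappa> cell_dual_cone[of f g \<kappa>] is_face_f is_face_g by blast
qed

lemma cell_tight:
  assumes "\<kappa> \<in> orthant"
  shows "cell f g \<kappa> = {\<kappa>' \<in> orthant. tight (map_keys f) \<kappa>' = tight (map_keys f) \<kappa>
    \<and> tight (Poly_Mapping.keys g) \<kappa>' = tight (Poly_Mapping.keys g) \<kappa> \<and> zero_coords \<kappa>' = zero_coords \<kappa>}"
  unfolding cell_def Gam_f_eq Gam_g_def
  by (rule Collect_cong) (use first_meet_eq_iff[OF fm_f _ assms] first_meet_eq_iff[OF fm_g _ assms] in blast)

text \<open>A cell is determined by two sets of tight exponents and a set of coordinates, each a
  subset of a fixed finite set.\<close>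

lemma finite_Delta: "finite (Delta f g)"
proof -
  let ?D = "\<lambda>(I, J, Z). {\<kappa>' \<in> (orthant :: (real ^ 'n) set). tight (map_keys f) \<kappa>' = I
    \<and> tight (Poly_Mapping.keys g) \<kappa>' = J \<and> zero_coords \<kappa>' = Z}"
  have "Delta f g \<subseteq> ?D ` (Pow (map_keys f) \<times> Pow (Poly_Mapping.keys g) \<times> UNIV)"
  proof
    fix \<delta> assume "\<delta> \<in> Delta f g"
    then obtain \<kappa> where "\<kappa> \<in> orthant" "\<delta> = cell f g \<kappa>" unfolding Delta_eq by blast
    then have "\<delta> = ?D (tight (map_keys f) \<kappa>, tight (Poly_Mapping.keys g) \<kappa>, zero_coords \<kappa>)"
      by (simp add: cell_tight)
    moreover have "(tight (map_keys f) \<kappa>, tight (Poly_Mapping.keys g) \<kappa>, zero_coords \<kappa>)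
        \<in> Pow (map_keys f) \<times> Pow (Poly_Mapping.keys g) \<times> UNIV" by (auto simp: tight_def)
    ultimately show "\<delta> \<in> ?D ` (Pow (map_keys f) \<times> Pow (Poly_Mapping.keys g) \<times> UNIV)" by blast
  qed
  moreover have "finite (Pow (map_keys f) \<times> Pow (Poly_Mapping.keys g) \<times> (UNIV :: 'n set set))"
    by (simp add: finite_map_keys)
  ultimately show ?thesis by (meson finite_imageI finite_subset)
qed

lemma cell_face_f:
  assumes "\<kappa> \<in> orthant"
  shows "cell_face (Gam_f f) (cell f g \<kappa>) = first_meet (Gam_f f) \<kappa>"
  unfolding cell_face_def
proof (rule the_equality)
  fix \<tau> assume "is_face \<tau> (Gam_f f) \<and> cell f g \<kappa> \<subseteq> dual_cone (Gam_f f) \<tau>"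
  then have "\<kappa> \<in> dual_cone (Gam_f f) \<tau>" using cell_self[OF assms] by blast
  then show "\<tau> = first_meet (Gam_f f) \<kappa>" by (simp add: dual_cone_def)
qed (use is_face_f[OF assms] cell_dual_cone in blast)

lemma cell_face_g:
  assumes "\<kappa> \<in> orthant"
  shows "cell_face (Gam_g g) (cell f g \<kappa>) = first_meet (Gam_g g) \<kappa>"
  unfolding cell_face_def
proof (rule the_equality)
  fix \<tau> assume "is_face \<tau> (Gam_g g) \<and> cell f g \<kappa> \<subseteq> dual_cone (Gam_g g) \<tau>"
  then have "\<kappa> \<in> dual_cone (Gam_g g) \<tau>" using cell_self[OF assms] by blast
  then show "\<tau> = first_meet (Gam_g g) \<kappa>" by (simp add: dual_cone_def)
qed (use is_face_g[OF assms] cell_dual_cone in blast)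

text \<open>Any x and y in the two faces of the cell work: on the closure both minima are attained
  at these fixed points.\<close>

lemma weight_linear:
  assumes "\<delta> \<in> Delta f g"
  obtains x y where "\<And>\<kappa>. \<kappa> \<in> closure \<delta> \<Longrightarrow> \<kappa> \<in> orthant"
    "\<And>s \<kappa>. \<kappa> \<in> closure \<delta> \<Longrightarrow> weight f g s \<kappa> = of_real (\<kappa> \<bullet> x) * s + of_real (\<kappa> \<bullet> y) + of_real (sigma \<kappa>)"
proof -
  obtain \<kappa> where \<kappa>: "\<kappa> \<in> orthant" "\<delta> = cell f g \<kappa>" using assms unfolding Delta_eq by blast
  obtain x y where x: "x \<in> first_meet (Gam_f f) \<kappa>" and y: "y \<in> first_meet (Gam_g g) \<kappa>"
    using is_face_f[OF \<kappa>(1)] is_face_g[OF \<kappa>(1)] unfolding is_face_def by blast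
  have "\<delta> \<subseteq> {\<kappa>' \<in> orthant. first_meet (newton_polyhedron (map_keys f)) \<kappa>' = first_meet (newton_polyhedron (map_keys f)) \<kappa>}"
    "\<delta> \<subseteq> {\<kappa>' \<in> orthant. first_meet (newton_polyhedron (Poly_Mapping.keys g)) \<kappa>'
       = first_meet (newton_polyhedron (Poly_Mapping.keys g)) \<kappa>}"
    using \<kappa>(2) by (auto simp: cell_def Gam_f_eq Gam_g_def)
  note lf = first_meet_min_val_linear[OF fm_f x[unfolded Gam_f_eq] this(1)]
    and lg = first_meet_min_val_linear[OF fm_g y[unfolded Gam_g_def] this(2)]
  show ?thesis
    by (rule that[of x y]) (use lf lg in \<open>auto simp: weight_def Gam_f_eq Gam_g_def\<close>)
qed

end

section \<open>Rescaling the variables of a polynomial\<close>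

text \<open>A natural number version of the inner product with an exponent vector, so that it can
  serve as an exponent of p.\<close>

definition kdot :: "('n::finite \<Rightarrow> nat) \<Rightarrow> ('n \<Rightarrow>\<^sub>0 nat) \<Rightarrow> nat" where
  "kdot k \<omega> = (\<Sum>i\<in>UNIV. k i * Poly_Mapping.lookup \<omega> i)"

definition kvec :: "('n \<Rightarrow> nat) \<Rightarrow> real ^ 'n" where
  "kvec k = (\<chi> i. real (k i))"

lemma kvec_orthant: "kvec k \<in> orthant"
  by (simp add: kvec_def orthant_def)

lemma kvec_inner: "kvec k \<bullet> exponent_vec \<omega> = real (kdot k \<omega>)"
  by (simp add: kvec_def exponent_vec_def kdot_def inner_vec_def)

lemma sigma_kvec: "sigma (kvec k) = real (sum k UNIV)"
  by (simp add: sigma_def kvec_def)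

definition kmin :: "('n::finite \<Rightarrow>\<^sub>0 nat) set \<Rightarrow> ('n \<Rightarrow> nat) \<Rightarrow> nat" where
  "kmin \<Omega> k = Min (kdot k ` \<Omega>)"

lemma Min_kvec:
  assumes "finite \<Omega>" "\<Omega> \<noteq> {}"
  shows "Min ((\<lambda>\<omega>. kvec k \<bullet> exponent_vec \<omega>) ` \<Omega>) = real (kmin \<Omega> k)"
  unfolding kvec_inner kmin_def
  using mono_Min_commute[of real "kdot k ` \<Omega>"] assms by (simp add: mono_def image_image)

lemma kmin_le: "finite \<Omega> \<Longrightarrow> \<omega> \<in> \<Omega> \<Longrightarrow> kmin \<Omega> k \<le> kdot k \<omega>"
  by (simp add: kmin_def)

lemma min_val_kvec:
  assumes "finite \<Omega>" "\<Omega> \<noteq> {}"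
  shows "min_val (newton_polyhedron \<Omega>) (kvec k) = real (kmin \<Omega> k)"
  using min_val_newton[OF assms kvec_orthant] Min_kvec[OF assms] by simp

lemma first_meet_kvec:
  assumes "finite \<Omega>" "\<omega> \<in> \<Omega>"
  shows "exponent_vec \<omega> \<in> first_meet (newton_polyhedron \<Omega>) (kvec k) \<longleftrightarrow> kdot k \<omega> = kmin \<Omega> k"
  using vertex_first_meet_iff[OF assms(1) _ kvec_orthant assms(2), of k] Min_kvec[OF assms(1), of k] assms
  by (auto simp: tight_def kvec_inner)

text \<open>The polynomial h(p^k u) / p^m. The truncated subtraction is exact if m is at most
  \<open>kdot k \<omega>\<close> for every exponent \<omega> of h.\<close>

definition scaled :: "('n::finite \<Rightarrow> nat) \<Rightarrow> nat \<Rightarrow> ('n, 'p::prime_card padic_int) mpolynomial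
    \<Rightarrow> ('n, 'p padic_int) mpolynomial" where
  "scaled k m h = Poly_Mapping.mapp (\<lambda>\<omega> c. c * unif ^ (kdot k \<omega> - m)) h"

lemma lookup_scaled:
  "Poly_Mapping.lookup (scaled k m h) \<omega> = Poly_Mapping.lookup h \<omega> * unif ^ (kdot k \<omega> - m)"
  by (simp add: scaled_def lookup_mapp when_def in_keys_iff)

lemma mp_eval_vshift:
  assumes "\<And>\<omega>. \<omega> \<in> Poly_Mapping.keys h \<Longrightarrow> m \<le> kdot k \<omega>"
  shows "mp_eval h (vshift k u) = unif ^ m * mp_eval (scaled k m h) u"
proof -
  have monom: "mp_monom \<omega> (vshift k u) = unif ^ kdot k \<omega> * mp_monom \<omega> u" for \<omega>
    by (simp add: mp_monom_def kdot_def power_mult_distrib prod.distrib power_sum power_mult)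
  have "mp_eval (scaled k m h) u
      = (\<Sum>\<omega>\<in>Poly_Mapping.keys h. Poly_Mapping.lookup (scaled k m h) \<omega> * mp_monom \<omega> u)"
    by (rule mp_eval_superset) (auto simp: in_keys_iff lookup_scaled)
  also have "unif ^ m * \<dots> = (\<Sum>\<omega>\<in>Poly_Mapping.keys h. Poly_Mapping.lookup h \<omega> * mp_monom \<omega> (vshift k u))"
    unfolding sum_distrib_left
  proof (rule sum.cong)
    fix \<omega> assume "\<omega> \<in> Poly_Mapping.keys h"
    then have "(unif :: 'b padic_int) ^ kdot k \<omega> = unif ^ m * unif ^ (kdot k \<omega> - m)"
      using assms by (simp flip: power_add)
    then show "unif ^ m * (Poly_Mapping.lookup (scaled k m h) \<omega> * mp_monom \<omega> u)
        = Poly_Mapping.lookup h \<omega> * mp_monom \<omega> (vshift k u)"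
      unfolding lookup_scaled monom by (simp add: mult_ac)
  qed simp
  finally show ?thesis by (simp add: mp_eval_keys)
qed

text \<open>A monomial whose exponent lies off the face keeps a positive power of p and disappears
  modulo p.\<close>

lemma mp_reduce_scaled:
  assumes "\<And>\<omega>. \<omega> \<in> Poly_Mapping.keys h \<Longrightarrow> m \<le> kdot k \<omega>"
    and "\<And>\<omega>. \<omega> \<in> Poly_Mapping.keys h \<Longrightarrow> exponent_vec \<omega> \<in> \<tau> \<longleftrightarrow> kdot k \<omega> = m"
  shows "mp_reduce (scaled k m h) = mp_reduce (mp_part \<tau> h)"
proof (rule poly_mapping_eqI)
  fix \<omega>
  show "Poly_Mapping.lookup (mp_reduce (scaled k m h)) \<omega> = Poly_Mapping.lookup (mp_reduce (mp_part \<tau> h)) \<omega>"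
  proof (cases "\<omega> \<in> Poly_Mapping.keys h")
    case True
    show ?thesis
      using assms[OF True]
      by (cases "kdot k \<omega> = m") (auto simp: lookup_mp_reduce lookup_scaled mp_part.rep_eq residue_mult residue_power)
  next
    case False
    then show ?thesis by (simp add: lookup_mp_reduce lookup_scaled mp_part.rep_eq in_keys_iff)
  qed
qed

section \<open>Summation of the level masses\<close>

text \<open>The probability that t equidistributed values all have order at least j, given whether
  all of them vanish modulo p (b). If they do, j = 0 and j = 1 both have probability 1, hence the
  truncated \<open>j - 1\<close>; if not, the minimal order is 0.\<close>

definition level_prob :: "real \<Rightarrow> nat \<Rightarrow> bool \<Rightarrow> nat \<Rightarrow> real" where
  "level_prob q t b j = (if b then q ^ (t * (j - 1)) else if j = 0 then 1 else 0)"

definition level_mass :: "real \<Rightarrow> nat \<Rightarrow> bool \<Rightarrow> nat \<Rightarrow> real" where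
  "level_mass q t b j = level_prob q t b j - level_prob q t b (Suc j)"

text \<open>The generating function of \<open>level_mass\<close>: the expected value of z to the
  power of the order.\<close>

definition level_sum :: "real \<Rightarrow> nat \<Rightarrow> bool \<Rightarrow> complex \<Rightarrow> complex" where
  "level_sum q t b z = (if b then z * (1 - of_real q ^ t) / (1 - of_real q ^ t * z) else 1)"

lemma level_mass_has_sum:
  assumes q: "0 < q" "q < 1" and t: "t > 0" and z: "norm z \<le> 1"
  shows "((\<lambda>j. complex_of_real (level_mass q t b j) * z ^ j) has_sum level_sum q t b z) UNIV"
    and "(\<lambda>j. complex_of_real (level_mass q t b j) * z ^ j) abs_summable_on UNIV"
proof -
  let ?F = "\<lambda>j. complex_of_real (level_mass q t b j) * z ^ j"
  have *: "summable (\<lambda>j. norm (?F j)) \<and> ?F sums level_sum q t b z"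
  proof (cases b)
    case True
    let ?r = "q ^ t"
    have r: "0 < ?r" "?r < 1" using q t by (auto simp: power_less_one_iff)
    have "level_mass q t b (Suc i) = (1 - ?r) * ?r ^ i" for i
      using True by (simp add: level_mass_def level_prob_def algebra_simps power_add flip: power_mult)
    then have F: "?F (Suc i) = z * (1 - of_real ?r) * (of_real ?r * z) ^ i" for i
      by (simp add: power_mult_distrib)
    have nr: "norm (of_real ?r * z) < 1"
    proof -
      have "norm (of_real ?r * z) = ?r * norm z" using q by (simp add: norm_mult norm_power)
      also have "\<dots> \<le> ?r * 1" using r z by (intro mult_left_mono) auto
      finally show ?thesis using r by simp
    qed
    have "(\<lambda>i. ?F (Suc i)) sums (z * (1 - of_real ?r) * (1 / (1 - of_real ?r * z)))"
      unfolding F by (intro sums_mult geometric_sums nr)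
    moreover have "?F 0 = 0" using True by (simp add: level_mass_def level_prob_def)
    ultimately have "?F sums level_sum q t b z"
      using sums_Suc_imp[of ?F] True by (simp add: level_sum_def)
    moreover have "summable (\<lambda>i. norm (?F (Suc i)))"
    proof -
      have "summable (\<lambda>i. norm (of_real ?r * z) ^ i)"
        by (rule summable_geometric) (use nr in simp)
      then show ?thesis unfolding F norm_mult[of "z * _"] norm_power by (rule summable_mult)
    qed
    ultimately show ?thesis using summable_Suc_iff[of "\<lambda>j. norm (?F j)"] by blast
  next
    case False
    have F: "?F j = (if j = 0 then 1 else 0)" for j
      using False by (simp add: level_mass_def level_prob_def)
    have "?F sums 1" unfolding F using sums_single[of 0 "\<lambda>_. 1 :: complex"] by simp
    moreover have "summable (\<lambda>j. norm (?F j))" unfolding F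
      using summable_single[of 0 "\<lambda>_. 1 :: real"] by (simp add: if_distrib cong: if_cong)
    ultimately show ?thesis using False by (simp add: level_sum_def)
  qed
  show "(?F has_sum level_sum q t b z) UNIV"
    by (rule norm_summable_imp_has_sum[OF conjunct1[OF *] conjunct2[OF *]])
  have "summable (\<lambda>j. norm (norm (?F j)))" using * by simp
  then show "?F abs_summable_on UNIV" by (rule norm_summable_imp_summable_on)
qed

lemma abs_summable_times:
  fixes u :: "'a \<Rightarrow> 'c::{banach,real_normed_div_algebra}"
  assumes "u abs_summable_on A" "v abs_summable_on B"
  shows "(\<lambda>(x, y). u x * v y) abs_summable_on A \<times> B"
    and "infsum (\<lambda>(x, y). u x * v y) (A \<times> B) = infsum u A * infsum v B"
proof -
  show s: "(\<lambda>(x, y). u x * v y) abs_summable_on A \<times> B"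
    unfolding Infinite_Sum.abs_summable_on_Sigma_iff
  proof (intro conjI ballI)
    fix x show "(\<lambda>y. case (x, y) of (x, y) \<Rightarrow> u x * v y) abs_summable_on B"
      using assms(2) by (simp add: norm_mult summable_on_cmult_right)
  next
    have "(\<Sum>\<^sub>\<infinity>y\<in>B. norm (u x * v y)) = norm (u x) * (\<Sum>\<^sub>\<infinity>y\<in>B. norm (v y))" for x
      by (simp add: norm_mult infsum_cmult_right')
    then show "(\<lambda>x. \<Sum>\<^sub>\<infinity>y\<in>B. norm (case (x, y) of (x, y) \<Rightarrow> u x * v y)) abs_summable_on A"
      using assms(1) by (simp add: norm_mult abs_mult summable_on_cmult_left)
  qed
  have "infsum (\<lambda>(x, y). u x * v y) (A \<times> B) = (\<Sum>\<^sub>\<infinity>x\<in>A. \<Sum>\<^sub>\<infinity>y\<in>B. u x * v y)"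
    using infsum_Sigma_banach[OF Infinite_Sum.abs_summable_summable[OF s]] by simp
  also have "\<dots> = infsum u A * infsum v B"
    by (simp add: infsum_cmult_right' infsum_cmult_left')
  finally show "infsum (\<lambda>(x, y). u x * v y) (A \<times> B) = infsum u A * infsum v B" .
qed

lemma multi_geometric_has_sum:
  fixes q :: real
  assumes q: "0 < q" "q < 1"
  shows "((\<lambda>k :: 'n::finite \<Rightarrow> nat. \<Prod>i\<in>UNIV. q ^ k i) has_sum (1 / (1 - q)) ^ CARD('n)) UNIV"
proof -
  have s: "(\<lambda>m. q ^ m) abs_summable_on UNIV" and v: "infsum (\<lambda>m. q ^ m) UNIV = 1 / (1 - q)"
  proof -
    have "(\<lambda>m. q ^ m) sums (1 / (1 - q))" using q by (intro geometric_sums) auto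
    moreover have "summable (\<lambda>m. norm (q ^ m))" using q by (simp add: summable_geometric)
    ultimately have "((\<lambda>m. q ^ m) has_sum (1 / (1 - q))) UNIV" by (intro norm_summable_imp_has_sum)
    then show "infsum (\<lambda>m. q ^ m) UNIV = 1 / (1 - q)" "(\<lambda>m. q ^ m) abs_summable_on UNIV"
      using q by (auto simp: infsumI has_sum_imp_summable)
  qed
  have "infsum (\<lambda>k :: 'n \<Rightarrow> nat. \<Prod>i\<in>UNIV. q ^ k i) (PiE UNIV (\<lambda>_. UNIV)) = (\<Prod>i\<in>(UNIV :: 'n set). infsum (\<lambda>m. q ^ m) UNIV)"
    by (rule infsum_prod_PiE_abs) (use s in auto)
  then have eq: "infsum (\<lambda>k :: 'n \<Rightarrow> nat. \<Prod>i\<in>UNIV. q ^ k i) UNIV = (1 / (1 - q)) ^ CARD('n)"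
    by (simp add: v)
  \<comment> \<open>\<open>infsum\<close> is 0 for a family that is not summable, so a nonzero value
    certifies summability.\<close>
  moreover have "(1 / (1 - q)) ^ CARD('n) \<noteq> 0" using q by simp
  ultimately have "(\<lambda>k :: 'n \<Rightarrow> nat. \<Prod>i\<in>UNIV. q ^ k i) summable_on UNIV"
    using infsum_not_exists by metis
  then show ?thesis using eq by (metis has_sum_infsum)
qed

section \<open>Integration over a countable partition\<close>

text \<open>The values of h are prescribed only on the sets \<open>E i\<close>. As their measures
  add up to that of A, what they miss of A is a null set, and no value of h is needed there.\<close>

lemma integral_countable_partition:
  fixes E :: "'i::countable \<Rightarrow> 'a set" and h :: "'a \<Rightarrow> complex"
  assumes E: "\<And>i. E i \<in> sets M" "\<And>i. E i \<subseteq> A" "\<And>i j. i \<noteq> j \<Longrightarrow> E i \<inter> E j = {}"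
    and A: "A \<in> sets M" "emeasure M A < \<infinity>"
    and full: "((\<lambda>i. measure M (E i)) has_sum measure M A) UNIV"
    and meas: "(\<lambda>x. indicator A x *\<^sub>R h x) \<in> borel_measurable M"
    and h: "\<And>i x. x \<in> E i \<Longrightarrow> h x = c i" and bd: "\<And>x. x \<in> A \<Longrightarrow> norm (h x) \<le> B"
  shows "set_integrable M A h"
    and "(\<lambda>i. measure M (E i) *\<^sub>R c i) abs_summable_on UNIV"
    and "(LINT x:A|M. h x) = (\<Sum>\<^sub>\<infinity>i. measure M (E i) *\<^sub>R c i)"
proof -
  show int: "set_integrable M A h"
    unfolding set_integrable_def
    by (rule integrableI_bounded_set[OF A(1) meas A(2), of B]) (use bd in \<open>auto simp: indicator_def\<close>)
  show abs: "(\<lambda>i. measure M (E i) *\<^sub>R c i) abs_summable_on UNIV"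
  proof (rule Infinite_Sum.abs_summable_on_comparison_test)
    show "(\<lambda>i. measure M (E i) * \<bar>B\<bar>) abs_summable_on UNIV"
      using has_sum_imp_summable[OF full] by (simp add: abs_mult summable_on_cmult_left)
    fix i
    show "norm (measure M (E i) *\<^sub>R c i) \<le> norm (measure M (E i) * \<bar>B\<bar>)"
    proof (cases "E i = {}")
      case False
      then obtain x where "x \<in> E i" by blast
      then have "norm (c i) \<le> B" using h bd E(2) by (metis subsetD)
      then show ?thesis by (simp add: abs_mult mult_left_mono)
    qed simp
  qed
  define D where "D n = (if n \<in> range (to_nat :: 'i \<Rightarrow> nat) then E (from_nat n) else {})" for n
  have D_to_nat: "D (to_nat i) = E i" for i by (simp add: D_def)
  have UD: "(\<Union>n. D n) = (\<Union>i. E i)" unfolding D_def by auto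
  have sD: "D n \<in> sets M" for n using E(1) by (simp add: D_def)
  have dD: "D m \<inter> D n = {}" if "m \<noteq> n" for m n
  proof (cases "m \<in> range (to_nat :: 'i \<Rightarrow> nat) \<and> n \<in> range (to_nat :: 'i \<Rightarrow> nat)")
    case True
    then obtain i j :: 'i where "m = to_nat i" "n = to_nat j" by blast
    then show ?thesis using E(3)[of i j] that by (auto simp: D_to_nat)
  qed (auto simp: D_def)
  have emE: "emeasure M (E i) < \<infinity>" for i
    using emeasure_mono[OF E(2) A(1)] A(2) by (metis le_less_trans)
  have "emeasure M (\<Union>n. D n) = suminf (\<lambda>n. emeasure M (D n))"
    by (rule suminf_emeasure[symmetric]) (use sD dD in \<open>auto simp: disjoint_family_on_def\<close>)
  also have "\<dots> = suminf (\<lambda>n. ennreal (measure M (D n)))"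
    using emE by (intro arg_cong[where f = suminf] ext) (auto simp: D_def emeasure_eq_ennreal_measure less_top)
  also have "\<dots> = ennreal (measure M A)"
  proof -
    have "((\<lambda>n. measure M (D n)) has_sum measure M A) (range (to_nat :: 'i \<Rightarrow> nat))"
      using full by (simp add: has_sum_reindex o_def D_to_nat)
    then have "((\<lambda>n. measure M (D n)) has_sum measure M A) UNIV"
      by (rule has_sum_cong_neutral[THEN iffD1, rotated -1]) (auto simp: D_def)
    then have "(\<lambda>n. measure M (D n)) sums measure M A" by (rule has_sum_imp_sums)
    then show ?thesis by (rule suminf_ennreal_eq[rotated]) simp
  qed
  also have "\<dots> = emeasure M A" using A(2) by (simp add: emeasure_eq_ennreal_measure less_top)
  finally have emU: "emeasure M (\<Union>n. D n) = emeasure M A" .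
  have UA: "(\<Union>n. D n) \<subseteq> A" using E(2) unfolding UD by blast
  have sU: "(\<Union>n. D n) \<in> sets M" using sD by blast
  have null: "A - (\<Union>n. D n) \<in> null_sets M"
    using A sU UA emU by (auto simp: null_sets_def emeasure_Diff less_top)
  have "(LINT x:A|M. h x) = (LINT x:(\<Union>n. D n)|M. h x)"
  proof (rule set_integral_cong_set)
    show "AE x in M. (x \<in> (\<Union>n. D n)) = (x \<in> A)"
      using AE_not_in[OF null] by eventually_elim (use UA in auto)
    show "set_borel_measurable M A h" using meas by (simp add: set_borel_measurable_def)
    show "set_borel_measurable M (\<Union>n. D n) h"
      using set_integrable_subset[OF int sU UA]
      by (simp add: set_integrable_def set_borel_measurable_def)
  qed
  also have "\<dots> = suminf (\<lambda>n. (LINT x:D n|M. h x))"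
    by (rule lebesgue_integral_countable_add[OF sD dD set_integrable_subset[OF int sU UA]])
  also have "\<dots> = (\<Sum>\<^sub>\<infinity>i. measure M (E i) *\<^sub>R c i)"
  proof -
    have LE: "(LINT x:E i|M. h x) = measure M (E i) *\<^sub>R c i" for i
    proof -
      have "(LINT x:E i|M. h x) = (LINT x:E i|M. c i)"
        by (rule set_lebesgue_integral_cong) (use E(1) h in auto)
      also have "\<dots> = measure M (E i \<inter> space M) *\<^sub>R c i"
        unfolding set_lebesgue_integral_def using emE[of i] E(1)[of i] by (simp add: less_top)
      finally show ?thesis using sets.sets_into_space[OF E(1)[of i]] by (simp add: Int_absorb2)
    qed
    have LD: "(LINT x:D (to_nat i)|M. h x) = measure M (E i) *\<^sub>R c i" for i
      by (simp add: D_to_nat LE)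
    have "((\<lambda>i. measure M (E i) *\<^sub>R c i) has_sum (\<Sum>\<^sub>\<infinity>i. measure M (E i) *\<^sub>R c i)) UNIV"
      using abs Infinite_Sum.abs_summable_summable by (intro has_sum_infsum)
    then have "((\<lambda>n. LINT x:D n|M. h x) has_sum (\<Sum>\<^sub>\<infinity>i. measure M (E i) *\<^sub>R c i)) (range (to_nat :: 'i \<Rightarrow> nat))"
      by (simp add: has_sum_reindex o_def LD)
    then have "((\<lambda>n. LINT x:D n|M. h x) has_sum (\<Sum>\<^sub>\<infinity>i. measure M (E i) *\<^sub>R c i)) UNIV"
      by (rule has_sum_cong_neutral[THEN iffD1, rotated -1]) (auto simp: D_def set_lebesgue_integral_def)
    then show ?thesis using has_sum_imp_sums sums_unique by metis
  qed
  finally show "(LINT x:A|M. h x) = (\<Sum>\<^sub>\<infinity>i. measure M (E i) *\<^sub>R c i)" .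
qed

section \<open>The zeta function as a sum over lattice points\<close>

lemma card_torus: "card (torus :: ('p::prime_card mod_ring ^ 'n::finite) set) = (CARD('p) - 1) ^ CARD('n)"
proof -
  have "bij_betw vec_nth (torus :: ('p mod_ring ^ 'n) set) (PiE UNIV (\<lambda>_. UNIV - {0}))"
    by (rule bij_betw_byWitness[where f' = vec_lambda])
       (auto simp: torus_def PiE_iff vec_lambda_eta)
  then have "card (torus :: ('p mod_ring ^ 'n) set) = card (PiE (UNIV :: 'n set) (\<lambda>_. UNIV - {0 :: 'p mod_ring}))"
    by (rule bij_betw_same_card)
  also have "\<dots> = card (UNIV - {0 :: 'p mod_ring}) ^ CARD('n)" by (simp add: card_PiE)
  also have "card (UNIV - {0 :: 'p mod_ring}) = CARD('p) - 1"
    by (simp add: card_Diff_singleton)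
  finally show ?thesis .
qed

text \<open>The base is positive, so its logarithm is real and no branch of the complex logarithm
  interferes.\<close>

lemma of_real_power_powr:
  assumes "x > 0"
  shows "complex_of_real (x ^ m) powr s = (complex_of_real x powr s) ^ m"
proof -
  have "complex_of_real (x ^ m) powr s = exp (s * of_real (ln (x ^ m)))"
    using assms by (subst powr_def) (simp add: Ln_of_real del: of_real_power)
  also have "\<dots> = exp (of_nat m * (s * of_real (ln x)))"
    using assms by (simp add: ln_realpow mult_ac)
  also have "\<dots> = (complex_of_real x powr s) ^ m"
    using assms by (subst powr_def) (simp add: Ln_of_real exp_of_nat_mult)
  finally show ?thesis .
qed

text \<open>\<open>q\<close> is a parameter because a constant defined as \<open>1 / CARD('p)\<close> would depend on a hidden type
  variable.\<close>

locale zeta_data = haar_measure \<mu>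
  for \<mu> :: "('p::prime_card padic ^ 'n::finite) measure" +
  fixes f :: "('n, 'p padic_int) mpolynomial ^ 't::finite" and g :: "('n, 'p padic_int) mpolynomial"
    and q :: real
  assumes q_def: "q = 1 / real CARD('p)"
    and map_keys_f: "map_keys f \<noteq> {}" and keys_g: "Poly_Mapping.keys g \<noteq> {}"
    and card_le: "CARD('n) \<ge> CARD('t) + 1"
    and nondeg_g: "nondegenerate g" and nondeg_f: "strongly_nondegenerate f"
    and nondeg_fg: "pair_strongly_nondegenerate f g"
begin

lemma q_bounds: "0 < q" "q < 1"
  unfolding q_def using int_card_gt_1[where 'p='p] by auto

abbreviation kcell :: "('n \<Rightarrow> nat) \<Rightarrow> (real ^ 'n) set" where
  "kcell k \<equiv> cell f g (kvec k)"

definition mf :: "('n \<Rightarrow> nat) \<Rightarrow> nat" where "mf = kmin (map_keys f)"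
definition mg :: "('n \<Rightarrow> nat) \<Rightarrow> nat" where "mg = kmin (Poly_Mapping.keys g)"

definition hpoly :: "('n \<Rightarrow> nat) \<Rightarrow> 't option \<Rightarrow> ('n, 'p padic_int) mpolynomial" where
  "hpoly k i = (case i of None \<Rightarrow> scaled k (mg k) g | Some j \<Rightarrow> scaled k (mf k) (f $ j))"

definition fzero :: "('n \<Rightarrow> nat) \<Rightarrow> 'p mod_ring ^ 'n \<Rightarrow> bool" where
  "fzero k a \<longleftrightarrow> map_eval (map_reduce (f_cell f (kcell k))) a = 0"

definition gzero :: "('n \<Rightarrow> nat) \<Rightarrow> 'p mod_ring ^ 'n \<Rightarrow> bool" where
  "gzero k a \<longleftrightarrow> mp_eval (mp_reduce (g_cell g (kcell k))) a = 0"

lemma mf_le: "\<omega> \<in> Poly_Mapping.keys (f $ j) \<Longrightarrow> mf k \<le> kdot k \<omega>"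
  unfolding mf_def by (rule kmin_le) (auto simp: finite_map_keys map_keys_def)

lemma mg_le: "\<omega> \<in> Poly_Mapping.keys g \<Longrightarrow> mg k \<le> kdot k \<omega>"
  unfolding mg_def by (rule kmin_le) auto

lemma f_cell_kcell: "f_cell f (kcell k) = map_part (first_meet (Gam_f f) (kvec k)) f"
  by (simp add: f_cell_def cell_face_f[OF map_keys_f keys_g kvec_orthant])

lemma g_cell_kcell: "g_cell g (kcell k) = mp_part (first_meet (Gam_g g) (kvec k)) g"
  by (simp add: g_cell_def cell_face_g[OF map_keys_f keys_g kvec_orthant])

lemma mp_reduce_hpoly_Some: "mp_reduce (hpoly k (Some j)) = mp_reduce (f_cell f (kcell k) $ j)"
proof -
  have "mp_reduce (scaled k (mf k) (f $ j)) = mp_reduce (mp_part (first_meet (Gam_f f) (kvec k)) (f $ j))"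
  proof (rule mp_reduce_scaled[OF mf_le])
    fix \<omega> assume "\<omega> \<in> Poly_Mapping.keys (f $ j)"
    then have "\<omega> \<in> map_keys f" by (auto simp: map_keys_def)
    then show "exponent_vec \<omega> \<in> first_meet (Gam_f f) (kvec k) \<longleftrightarrow> kdot k \<omega> = mf k"
      unfolding mf_def Gam_f_eq[OF map_keys_f keys_g] by (rule first_meet_kvec[OF finite_map_keys])
  qed
  then show ?thesis by (simp add: hpoly_def f_cell_kcell map_part_def)
qed

lemma mp_reduce_hpoly_None: "mp_reduce (hpoly k None) = mp_reduce (g_cell g (kcell k))"
proof -
  have "mp_reduce (scaled k (mg k) g) = mp_reduce (mp_part (first_meet (Gam_g g) (kvec k)) g)"
    by (rule mp_reduce_scaled[OF mg_le])
       (simp_all add: mg_def Gam_g_def first_meet_kvec)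
  then show ?thesis by (simp add: hpoly_def g_cell_kcell)
qed

lemma fzero_iff: "fzero k a \<longleftrightarrow> (\<forall>j. mp_eval (mp_reduce (hpoly k (Some j))) a = 0)"
  by (simp add: fzero_def map_eval_def map_reduce_def vec_eq_iff mp_reduce_hpoly_Some)

lemma gzero_iff: "gzero k a \<longleftrightarrow> mp_eval (mp_reduce (hpoly k None)) a = 0"
  by (simp add: gzero_def mp_reduce_hpoly_None)

text \<open>The components of f enter only if all of them vanish at a. Otherwise the norm of f on
  the box is already determined, and a single vanishing component does not matter.\<close>

definition zset :: "('n \<Rightarrow> nat) \<Rightarrow> 'p mod_ring ^ 'n \<Rightarrow> 't option set" where
  "zset k a = (if fzero k a then range Some else {}) \<union> (if gzero k a then {None} else {})"

lemma zset_zero: "i \<in> zset k a \<Longrightarrow> mp_eval (mp_reduce (hpoly k i)) a = 0"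
  using fzero_iff[of k a] gzero_iff[of k a] by (auto simp: zset_def split: if_splits)

text \<open>Each pattern of vanishing calls on its own hypothesis: on the pair, on f, on g, or on
  none. For f alone, n >= t + 1 turns the maximal rank min(t, n) into t.\<close>

lemma hpoly_surj:
  assumes a: "a \<in> torus"
  shows "\<exists>v. \<forall>i\<in>zset k a. (\<Sum>j\<in>UNIV. mp_eval (mp_pderiv j (mp_reduce (hpoly k i))) a * v $ j) = w i"
proof -
  consider "fzero k a" "gzero k a" | "fzero k a" "\<not> gzero k a" | "\<not> fzero k a" "gzero k a" | "\<not> fzero k a" "\<not> gzero k a"
    by blast
  then show ?thesis
  proof cases
    case 1
    let ?h = "map_reduce (adjoin (f_cell f (kcell k)) (g_cell g (kcell k)))"
    have h: "?h $ i = mp_reduce (hpoly k i)" for i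
      by (cases i) (simp_all add: map_reduce_def adjoin_def mp_reduce_hpoly_None mp_reduce_hpoly_Some)
    have "kcell k \<in> Delta f g" unfolding Delta_eq[OF map_keys_f keys_g] using kvec_orthant by blast
    moreover have "map_eval ?h a = 0"
      using 1 fzero_iff[of k a] gzero_iff[of k a]
      by (auto simp: map_eval_def vec_eq_iff h split_option_all)
    ultimately have "rank (jacobian ?h a) = CARD('t) + 1"
      using nondeg_fg a unfolding pair_strongly_nondegenerate_def Let_def by blast
    then have "rank (jacobian ?h a) = CARD('t option)" by simp
    then obtain v where v: "jacobian ?h a *v v = (\<chi> i. w i)" using full_row_rank_surj by blast
    have "(\<Sum>j\<in>UNIV. mp_eval (mp_pderiv j (mp_reduce (hpoly k i))) a * v $ j) = w i" for i
      using arg_cong[OF v, of "\<lambda>x. x $ i"] by (simp add: matrix_vector_mult_def jacobian_def h)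
    then show ?thesis by blast
  next
    case 2
    let ?\<tau> = "first_meet (Gam_f f) (kvec k)"
    let ?h = "map_reduce (map_part ?\<tau> f)"
    have h: "?h $ i = mp_reduce (hpoly k (Some i))" for i
      by (simp add: mp_reduce_hpoly_Some map_reduce_def f_cell_kcell)
    have "is_face ?\<tau> (Gam_f f)" by (rule is_face_f[OF map_keys_f keys_g kvec_orthant])
    moreover have "map_eval ?h a = 0"
      using 2 fzero_iff[of k a] by (auto simp: map_eval_def vec_eq_iff h)
    ultimately have "rank (jacobian ?h a) = min CARD('t) CARD('n)"
      using nondeg_f a unfolding strongly_nondegenerate_def Let_def by blast
    then have "rank (jacobian ?h a) = CARD('t)" using card_le by simp
    then obtain v where v: "jacobian ?h a *v v = (\<chi> i. w (Some i))" using full_row_rank_surj by blast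
    have "(\<Sum>j\<in>UNIV. mp_eval (mp_pderiv j (mp_reduce (hpoly k (Some i)))) a * v $ j) = w (Some i)" for i
      using arg_cong[OF v, of "\<lambda>x. x $ i"] by (simp add: matrix_vector_mult_def jacobian_def h)
    then show ?thesis using 2 by (auto simp: zset_def)
  next
    case 3
    let ?\<tau> = "first_meet (Gam_g g) (kvec k)"
    let ?d = "\<lambda>j. mp_eval (mp_pderiv j (mp_reduce (hpoly k None))) a"
    have h: "mp_reduce (mp_part ?\<tau> g) = mp_reduce (hpoly k None)"
      by (simp add: mp_reduce_hpoly_None g_cell_kcell)
    have "is_face ?\<tau> (Gam_g g)" by (rule is_face_g[OF map_keys_f keys_g kvec_orthant])
    moreover have "mp_eval (mp_reduce (hpoly k None)) a = 0" using 3 gzero_iff by blast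
    ultimately obtain j0 where j0: "?d j0 \<noteq> 0"
      using nondeg_g a unfolding nondegenerate_def Let_def h[symmetric] by blast
    \<comment> \<open>For one equation a single nonzero partial derivative suffices: v is supported
      on its coordinate.\<close>
    define v where "v = (\<chi> j. if j = j0 then w None / ?d j0 else 0)"
    have "(\<Sum>j\<in>UNIV. ?d j * v $ j) = (\<Sum>j\<in>UNIV. if j = j0 then ?d j0 * (w None / ?d j0) else 0)"
      by (intro sum.cong) (auto simp: v_def)
    then have "(\<Sum>j\<in>UNIV. ?d j * v $ j) = w None" using j0 by simp
    then show ?thesis using 3 by (auto simp: zset_def)
  qed (simp add: zset_def)
qed

definition box_mass :: "('n \<Rightarrow> nat) \<Rightarrow> real" where
  "box_mass k = (\<Prod>i\<in>UNIV. q ^ Suc (k i))"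

text \<open>Lower bounds for the orders are congruences, to which \<open>pmeas_levels\<close>
  applies; exact orders are obtained as differences of such sets.\<close>

definition above :: "('n \<Rightarrow> nat) \<Rightarrow> 'p mod_ring ^ 'n \<Rightarrow> nat \<Rightarrow> nat \<Rightarrow> ('p padic_int ^ 'n) set" where
  "above k a j l = vshift k ` {u. residue_vec u = a
     \<and> (\<forall>i. unif ^ j dvd mp_eval (hpoly k (Some i)) u) \<and> unif ^ l dvd mp_eval (hpoly k None) u}"

lemma above_eq: "above k a j l = vshift k ` {u. residue_vec u = a
     \<and> (\<forall>i\<in>UNIV. unif ^ (case i of None \<Rightarrow> l | Some _ \<Rightarrow> j) dvd mp_eval (hpoly k i) u - 0)}"
  by (simp add: above_def split_option_all conj_commute)

lemma cylinder_above: "\<exists>N. cylinder N (above k a j l)"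
  unfolding above_eq by (rule cylinder_shift_congruences) simp

lemma pmeas_above:
  assumes a: "a \<in> torus"
  shows "pmeas (above k a j l)
    = box_mass k * (level_prob q CARD('t) (fzero k a) j * level_prob q 1 (gzero k a) l)"
proof -
  have unit: "\<not> unif dvd mp_eval (hpoly k i) u"
    if "mp_eval (mp_reduce (hpoly k i)) a \<noteq> 0" "residue_vec u = a" for i u
    using that by (simp add: residue_eq_0_iff[symmetric] residue_mp_eval)
  show ?thesis
  proof (cases "(\<not> fzero k a \<and> j > 0) \<or> (\<not> gzero k a \<and> l > 0)")
    case True
    have "above k a j l = {}"
    proof (rule ccontr)
      assume "above k a j l \<noteq> {}"
      then obtain u where u: "residue_vec u = a" "\<forall>i. unif ^ j dvd mp_eval (hpoly k (Some i)) u"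
        "unif ^ l dvd mp_eval (hpoly k None) u" unfolding above_def by blast
      show False
        using True
      proof
        assume "\<not> fzero k a \<and> j > 0"
        then obtain i where i: "mp_eval (mp_reduce (hpoly k (Some i))) a \<noteq> 0" "j > 0"
          using fzero_iff by blast
        have "unif dvd mp_eval (hpoly k (Some i)) u"
          using u(2) i(2) dvd_trans[OF dvd_power[of j unif]] by blast
        then show False using unit[OF i(1) u(1)] by blast
      next
        assume "\<not> gzero k a \<and> l > 0"
        then have i: "mp_eval (mp_reduce (hpoly k None)) a \<noteq> 0" "l > 0"
          using gzero_iff by blast+
        have "unif dvd mp_eval (hpoly k None) u"
          using u(3) i(2) dvd_trans[OF dvd_power[of l unif]] by blast
        then show False using unit[OF i(1) u(1)] by blast
      qed
    qed
    then show ?thesis using True by (auto simp: pmeas_def level_prob_def)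
  next
    case False
    let ?e = "\<lambda>i :: 't option. case i of None \<Rightarrow> l | Some _ \<Rightarrow> j"
    have "above k a j l = vshift k ` {u. residue_vec u = a \<and> (\<forall>i\<in>zset k a. unif ^ ?e i dvd mp_eval (hpoly k i) u)}"
      unfolding above_def using False
      by (intro arg_cong[where f = "(`) (vshift k)"] Collect_cong) (auto simp: zset_def)
    also have "pmeas \<dots> = box_mass k * (\<Prod>i\<in>zset k a. q ^ (?e i - 1))"
      unfolding box_mass_def unfolding q_def
      by (rule pmeas_levels) (use zset_zero hpoly_surj[OF a] in auto)
    also have "(\<Prod>i\<in>zset k a. q ^ (?e i - 1)) = level_prob q CARD('t) (fzero k a) j * level_prob q 1 (gzero k a) l"
    proof -
      have "(\<Prod>i\<in>range (Some :: 't \<Rightarrow> _). q ^ (?e i - 1)) = q ^ (CARD('t) * (j - 1))"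
        by (simp add: prod.reindex mult.commute flip: power_mult)
      moreover have "(\<Prod>i\<in>insert None (range (Some :: 't \<Rightarrow> _)). q ^ (?e i - 1))
          = q ^ (l - 1) * (\<Prod>i\<in>range (Some :: 't \<Rightarrow> _). q ^ (?e i - 1))"
        by (subst prod.insert) auto
      ultimately show ?thesis using False by (auto simp: zset_def level_prob_def)
    qed
    finally show ?thesis .
  qed
qed

text \<open>For a in the torus the coordinates of u are units, so k consists of the valuations of
  the coordinates of x and the whole index is determined by x. The other a get the empty set, so
  that the strata are indexed by a full type.\<close>

definition stratum :: "('n \<Rightarrow> nat) \<times> ('p mod_ring ^ 'n) \<times> nat \<times> nat \<Rightarrow> ('p padic_int ^ 'n) set" where
  "stratum = (\<lambda>(k, a, j, l). if a \<in> torus then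
     above k a j l - (above k a (Suc j) l \<union> above k a j (Suc l)) else {})"

lemma above_mono: "j' \<le> j \<Longrightarrow> l' \<le> l \<Longrightarrow> above k a j l \<subseteq> above k a j' l'"
  unfolding above_def by (intro image_mono Collect_mono impI) (meson le_imp_power_dvd dvd_trans)

lemma above_Int: "above k a j l \<inter> above k a j' l' = above k a (max j j') (max l l')"
proof (intro equalityI subsetI)
  fix x assume "x \<in> above k a j l \<inter> above k a j' l'"
  then obtain u u' where u: "x = vshift k u" "residue_vec u = a"
     "\<forall>i. unif ^ j dvd mp_eval (hpoly k (Some i)) u" "unif ^ l dvd mp_eval (hpoly k None) u"
     and u': "x = vshift k u'"
     "\<forall>i. unif ^ j' dvd mp_eval (hpoly k (Some i)) u'" "unif ^ l' dvd mp_eval (hpoly k None) u'"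
    unfolding above_def by blast
  have "u' = u" using u(1) u'(1) by (simp add: vshift_eq_iff)
  then show "x \<in> above k a (max j j') (max l l')"
    using u u' unfolding above_def by (auto simp: max_def)
qed (meson IntI above_mono max.cobounded1 max.cobounded2 subsetD)

lemma cylinder_stratum: "\<exists>N. cylinder N (stratum x)"
proof (cases x)
  case (fields k a j l)
  obtain N M L where "cylinder N (above k a j l)" "cylinder M (above k a (Suc j) l)"
    "cylinder L (above k a j (Suc l))"
    using cylinder_above by metis
  then have "\<exists>N. cylinder N (above k a j l - (above k a (Suc j) l \<union> above k a j (Suc l)))"
    using cylinder_Un cylinder_Diff by blast
  moreover have "cylinder 0 ({} :: ('p padic_int ^ 'n) set)" by (simp add: cylinder_def)
  ultimately show ?thesis unfolding stratum_def fields by auto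
qed

text \<open>Inclusion and exclusion of four sets, whose masses are products of a factor for f and
  one for g; the alternating sum is the product of the differences.\<close>

lemma pmeas_stratum:
  "pmeas (stratum (k, a, j, l)) = (if a \<in> torus then
     box_mass k * (level_mass q CARD('t) (fzero k a) j * level_mass q 1 (gzero k a) l) else 0)"
proof (cases "a \<in> torus")
  case True
  let ?A = "above k a j l" and ?B = "above k a (Suc j) l" and ?C = "above k a j (Suc l)"
  obtain N where N: "cylinder N ?A" using cylinder_above by blast
  obtain M where M: "cylinder M ?B" using cylinder_above by blast
  obtain L where L: "cylinder L ?C" using cylinder_above by blast
  have BC: "?B \<inter> ?C = above k a (Suc j) (Suc l)" by (simp add: above_Int)
  have sub: "?B \<subseteq> ?A" "?C \<subseteq> ?A" by (rule above_mono; simp)+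
  obtain K where K: "cylinder K (?B \<inter> ?C)" unfolding BC using cylinder_above by blast
  have "stratum (k, a, j, l) = (?A - ?B) - (?C - (?B \<inter> ?C))"
    using True sub unfolding stratum_def by auto
  also have "pmeas \<dots> = pmeas (?A - ?B) - pmeas (?C - (?B \<inter> ?C))"
    by (rule pmeas_Diff[OF _ cylinder_Diff[OF N M] cylinder_Diff[OF L K]]) (use sub in blast)
  also have "\<dots> = (pmeas ?A - pmeas ?B) - (pmeas ?C - pmeas (?B \<inter> ?C))"
    using pmeas_Diff[OF sub(1) N M] pmeas_Diff[OF Int_lower2 L K] by simp
  finally show ?thesis
    unfolding BC pmeas_above[OF True] using True by (simp add: level_mass_def algebra_simps)
qed (simp add: stratum_def pmeas_def)

lemma stratum_disjoint:
  assumes "x \<noteq> y"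
  shows "stratum x \<inter> stratum y = {}"
proof (rule ccontr)
  obtain k a j l where x: "x = (k, a, j, l)" by (cases x)
  obtain k' a' j' l' where y: "y = (k', a', j', l')" by (cases y)
  assume "stratum x \<inter> stratum y \<noteq> {}"
  then obtain z where z: "z \<in> stratum x" "z \<in> stratum y" by blast
  then have t: "a \<in> torus" "a' \<in> torus" and zx: "z \<in> above k a j l" "z \<notin> above k a (Suc j) l" "z \<notin> above k a j (Suc l)"
    and zy: "z \<in> above k' a' j' l'" "z \<notin> above k' a' (Suc j') l'" "z \<notin> above k' a' j' (Suc l')"
    by (auto simp: stratum_def x y split: if_splits)
  obtain u where u: "z = vshift k u" "residue_vec u = a" using zx(1) unfolding above_def by blast
  obtain u' where u': "z = vshift k' u'" "residue_vec u' = a'" using zy(1) unfolding above_def by blast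
  have nu: "\<not> unif dvd u $ i" "\<not> unif dvd u' $ i" for i
    using t u(2) u'(2) by (auto simp: torus_def residue_eq_0_iff[symmetric])
  have le: "k i \<le> k' i" if "unif ^ k i * v = unif ^ k' i * v'" "\<not> unif dvd v'"
    for k k' :: "'n \<Rightarrow> nat" and v v' :: "'p padic_int" and i
  proof (rule ccontr)
    assume "\<not> k i \<le> k' i"
    then have "unif ^ k i = unif ^ k' i * (unif ^ (k i - k' i) :: 'p padic_int)" "k i - k' i > 0"
      by (simp_all flip: power_add)
    then have "unif ^ (k i - k' i) * v = v'" using that(1) by (simp add: mult.assoc)
    then have "unif dvd v'" using \<open>k i - k' i > 0\<close> by (metis dvd_mult2 dvd_power)
    then show False using that(2) by blast
  qed
  have e: "unif ^ k i * u $ i = unif ^ k' i * u' $ i" for i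
    using u(1) u'(1) by (metis vshift_nth)
  have "k = k'"
  proof
    fix i show "k i = k' i" 
      using le[of k i "u $ i" k' "u' $ i"] le[of k' i "u' $ i" k "u $ i"] e[of i] nu[of i] by simp
  qed
  moreover from this have "u = u'" using u(1) u'(1) by (simp add: vshift_eq_iff)
  ultimately have *: "k' = k" "a' = a" using u(2) u'(2) by auto
  have "\<not> j < j'" "\<not> l < l'" "\<not> j' < j" "\<not> l' < l"
  proof -
    \<comment> \<open>A common point satisfies the larger of both bounds, so if the levels differed,
      it would lie in one of the removed sets.\<close>
    have m: "z \<in> above k a (max j j') (max l l')" using zx(1) zy(1) above_Int unfolding * by blast
    show "\<not> j < j'" using m zx(2) above_mono[of "Suc j" "max j j'" l "max l l'" k a] by auto
    show "\<not> l < l'" using m zx(3) above_mono[of j "max j j'" "Suc l" "max l l'" k a] by auto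
    show "\<not> j' < j" using m zy(2) above_mono[of "Suc j'" "max j j'" l' "max l l'" k a] unfolding * by auto
    show "\<not> l' < l" using m zy(3) above_mono[of j' "max j j'" "Suc l'" "max l l'" k a] unfolding * by auto
  qed
  then show False using assms x y * by simp
qed

end

section \<open>The integrand on the strata\<close>

context zeta_data
begin

definition fnorm :: "'p padic_int ^ 'n \<Rightarrow> real" where
  "fnorm u = Max (range (\<lambda>i. padic_int_norm (mp_eval (f $ i) u)))"

definition gnorm :: "'p padic_int ^ 'n \<Rightarrow> real" where
  "gnorm u = padic_int_norm (mp_eval g u)"

lemma padic_int_norm_cases:
  fixes x :: "'p padic_int"
  obtains "padic_int_norm x = 0" | j where "padic_int_norm x = q ^ j"
  by (cases "x = 0") (auto simp: padic_int_norm_def q_def)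

lemma fnorm_cases: obtains "fnorm u = 0" | j where "fnorm u = q ^ j"
proof -
  have "fnorm u \<in> range (\<lambda>i. padic_int_norm (mp_eval (f $ i) u))"
    unfolding fnorm_def by (rule Max_in) auto
  then obtain i where "fnorm u = padic_int_norm (mp_eval (f $ i) u)" by blast
  then show ?thesis using padic_int_norm_cases that by metis
qed

lemma gnorm_cases: obtains "gnorm u = 0" | j where "gnorm u = q ^ j"
  using padic_int_norm_cases that unfolding gnorm_def by metis

lemma fnorm_le_iff: "fnorm u \<le> q ^ j \<longleftrightarrow> (\<forall>i. unif ^ j dvd mp_eval (f $ i) u)"
  unfolding fnorm_def q_def padic_int_norm_le_power_iff[symmetric] by (subst Max_le_iff) auto

lemma gnorm_le_iff: "gnorm u \<le> q ^ j \<longleftrightarrow> unif ^ j dvd mp_eval g u"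
  unfolding gnorm_def q_def padic_int_norm_le_power_iff ..

text \<open>The values are discrete, so two inequalities pin down the power of q; the value 0
  violates the second of them.\<close>

lemma power_norm_eqI:
  assumes "x = 0 \<or> (\<exists>m. x = q ^ m)"
  shows "x = q ^ j \<longleftrightarrow> x \<le> q ^ j \<and> \<not> x \<le> q ^ Suc j"
proof
  assume "x = q ^ j"
  then show "x \<le> q ^ j \<and> \<not> x \<le> q ^ Suc j" using q_bounds by simp
next
  assume *: "x \<le> q ^ j \<and> \<not> x \<le> q ^ Suc j"
  then have "x \<noteq> 0" using q_bounds by (metis zero_le_power less_eq_real_def)
  then obtain m where m: "x = q ^ m" using assms by blast
  have "j \<le> m" using * q_bounds unfolding m by (simp add: power_decreasing_iff)
  moreover have "\<not> Suc j \<le> m" using * q_bounds unfolding m by (metis power_decreasing_iff)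
  ultimately have "m = j" by simp
  then show "x = q ^ j" using m by simp
qed

lemma fnorm_eq_iff: "fnorm u = q ^ j \<longleftrightarrow>
    (\<forall>i. unif ^ j dvd mp_eval (f $ i) u) \<and> \<not> (\<forall>i. unif ^ Suc j dvd mp_eval (f $ i) u)"
  unfolding fnorm_le_iff[symmetric] by (rule power_norm_eqI) (metis fnorm_cases)

lemma gnorm_eq_iff: "gnorm u = q ^ j \<longleftrightarrow>
    unif ^ j dvd mp_eval g u \<and> \<not> unif ^ Suc j dvd mp_eval g u"
  unfolding gnorm_le_iff[symmetric] by (rule power_norm_eqI) (metis gnorm_cases)

lemma fnorm_bounds: "0 \<le> fnorm u" "fnorm u \<le> 1"
  using fnorm_le_iff[of u 0] fnorm_cases[of u] q_bounds by (simp_all, metis order_refl zero_le_power less_eq_real_def)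

lemma gnorm_bounds: "0 \<le> gnorm u" "gnorm u \<le> 1"
  using gnorm_le_iff[of u 0] by (simp_all add: gnorm_def)

lemma zeta_integrand_of_padic_vec:
  "zeta_integrand f g s (of_padic_vec u) = complex_of_real (fnorm u) powr s * complex_of_real (gnorm u)"
proof -
  have "max_norm (padic_map f (of_padic_vec u)) = fnorm u"
    by (simp add: max_norm_def padic_map_def fnorm_def padic_eval_of_padic_vec padic_norm_of_padic_int)
  then show ?thesis
    by (simp add: zeta_integrand_def gnorm_def padic_eval_of_padic_vec padic_norm_of_padic_int)
qed

lemma fnorm_stratum:
  assumes "x \<in> stratum (k, a, j, l)"
  shows "fnorm x = q ^ (mf k + j)" "gnorm x = q ^ (mg k + l)"
proof -
  have x: "x \<in> above k a j l" "x \<notin> above k a (Suc j) l" "x \<notin> above k a j (Suc l)"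
    using assms by (auto simp: stratum_def split: if_splits)
  then obtain u where u: "x = vshift k u" "residue_vec u = a"
    "\<And>i. unif ^ j dvd mp_eval (hpoly k (Some i)) u" "unif ^ l dvd mp_eval (hpoly k None) u"
    unfolding above_def by blast
  have nu: "\<not> (\<forall>i. unif ^ Suc j dvd mp_eval (hpoly k (Some i)) u)" "\<not> unif ^ Suc l dvd mp_eval (hpoly k None) u"
    using x(2,3) u unfolding above_def by blast+
  have F: "mp_eval (f $ i) x = unif ^ mf k * mp_eval (hpoly k (Some i)) u" for i
    unfolding u(1) hpoly_def by (simp add: mp_eval_vshift[OF mf_le])
  have G: "mp_eval g x = unif ^ mg k * mp_eval (hpoly k None) u"
    unfolding u(1) hpoly_def by (simp add: mp_eval_vshift[OF mg_le])
  have d: "unif ^ (m + e) dvd unif ^ m * (y :: 'p padic_int) \<longleftrightarrow> unif ^ e dvd y" for m e y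
    by (simp add: power_add)
  show "fnorm x = q ^ (mf k + j)"
    unfolding fnorm_eq_iff F using u(3) nu(1) d[of "mf k"] by (metis add_Suc_right)
  show "gnorm x = q ^ (mg k + l)"
    unfolding gnorm_eq_iff G using u(4) nu(2) d[of "mg k"] by (metis add_Suc_right)
qed

text \<open>On the cube only the values 0 and \<open>q ^ j\<close> occur. So a superlevel set for c
  >= 0 is a countable union of open sets, and no continuity of polynomial maps on Q_p^n is
  involved.\<close>

lemma measurable_power_norm:
  fixes N :: "'p padic_int ^ 'n \<Rightarrow> real" and G :: "'p padic ^ 'n \<Rightarrow> real"
  assumes G: "\<And>u. G (of_padic_vec u) = N u"
    and N: "\<And>u. N u = 0 \<or> (\<exists>j. N u = q ^ j)" and cyl: "\<And>j. \<exists>M. cylinder M {u. N u = q ^ j}"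
  shows "(\<lambda>x. indicator Zp_cube x * G x) \<in> borel_measurable \<mu>"
proof (subst borel_measurable_iff_greater, intro allI)
  fix c :: real
  let ?H = "\<lambda>x. indicator Zp_cube x * G x"
  have sp: "space \<mu> = UNIV" using sets_eq_imp_space_eq[OF sets_haar] by simp
  have nonneg: "N u \<ge> 0" for u using N[of u] q_bounds by auto
  show "{x \<in> space \<mu>. c < ?H x} \<in> sets \<mu>"
  proof (cases "c < 0")
    case True
    have "?H x \<ge> 0" for x
      using G nonneg by (auto simp: indicator_def range_of_padic_vec[symmetric])
    then have "{x \<in> space \<mu>. c < ?H x} = space \<mu>" using True by (force intro: less_le_trans)
    then show ?thesis by simp
  next
    case False
    have "{x \<in> space \<mu>. c < ?H x} = (\<Union>j\<in>{j. c < q ^ j}. of_padic_vec ` {u. N u = q ^ j})"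
    proof (intro equalityI subsetI)
      fix x assume "x \<in> {x \<in> space \<mu>. c < ?H x}"
      then have c: "c < ?H x" by simp
      have "x \<in> Zp_cube"
      proof (rule ccontr)
        assume "x \<notin> Zp_cube"
        then show False using c False by simp
      qed
      then obtain u where u: "x = of_padic_vec u" by (auto simp: range_of_padic_vec[symmetric])
      then have "c < N u" using c \<open>x \<in> Zp_cube\<close> G by simp
      then have "N u \<noteq> 0" using False by auto
      then obtain j where "N u = q ^ j" using N by blast
      then show "x \<in> (\<Union>j\<in>{j. c < q ^ j}. of_padic_vec ` {u. N u = q ^ j})"
        using u \<open>c < N u\<close> by auto
    qed (auto simp: sp G range_of_padic_vec[symmetric])
    moreover have "of_padic_vec ` {u. N u = q ^ j} \<in> sets \<mu>" for j
      using cyl cylinder_sets by blast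
    ultimately show ?thesis by (simp add: sets.countable_UN')
  qed
qed

lemma cylinder_fnorm: "\<exists>M. cylinder M {u. fnorm u = q ^ j}"
proof -
  have c: "cylinder e (\<Inter>i. {u. unif ^ e dvd mp_eval (f $ i) u - 0})" for e
    by (rule cylinder_INT[OF cylinder_mp_eval])
  have "{u. fnorm u = q ^ j} = (\<Inter>i. {u. unif ^ j dvd mp_eval (f $ i) u - 0})
      - (\<Inter>i. {u. unif ^ Suc j dvd mp_eval (f $ i) u - 0})"
    unfolding fnorm_eq_iff by auto
  then show ?thesis using cylinder_Diff[OF c c] by metis
qed

lemma cylinder_gnorm: "\<exists>M. cylinder M {u. gnorm u = q ^ j}"
proof -
  have "{u. gnorm u = q ^ j} = {u. unif ^ j dvd mp_eval g u - 0} - {u. unif ^ Suc j dvd mp_eval g u - 0}"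
    unfolding gnorm_eq_iff by auto
  then show ?thesis using cylinder_Diff[OF cylinder_mp_eval cylinder_mp_eval] by metis
qed

lemma measurable_zeta_integrand:
  "(\<lambda>x. indicator Zp_cube x *\<^sub>R zeta_integrand f g s x) \<in> borel_measurable \<mu>"
proof -
  define F where "F x = indicator Zp_cube x * max_norm (padic_map f x)" for x
  define G where "G x = indicator Zp_cube x * padic_norm (padic_eval g x)" for x
  have F: "F \<in> borel_measurable \<mu>"
    unfolding F_def
  proof (rule measurable_power_norm[OF _ _ cylinder_fnorm])
    show "fnorm u = 0 \<or> (\<exists>j. fnorm u = q ^ j)" for u using fnorm_cases by metis
  qed (simp add: max_norm_def padic_map_def fnorm_def padic_eval_of_padic_vec padic_norm_of_padic_int)
  have G: "G \<in> borel_measurable \<mu>"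
    unfolding G_def
  proof (rule measurable_power_norm[OF _ _ cylinder_gnorm])
    show "gnorm u = 0 \<or> (\<exists>j. gnorm u = q ^ j)" for u using gnorm_cases by metis
  qed (simp add: gnorm_def padic_eval_of_padic_vec padic_norm_of_padic_int)
  \<comment> \<open>The power is 0 at base 0, and for a positive base its logarithm is real. This
    writes the integrand by measurable functions of F and G.\<close>
  have eq: "indicator Zp_cube x *\<^sub>R zeta_integrand f g s x
      = (if F x = 0 then 0 else exp (s * complex_of_real (ln (F x)))) * complex_of_real (G x)" for x
  proof (cases "x \<in> Zp_cube")
    case True
    then obtain u where u: "x = of_padic_vec u" by (auto simp: range_of_padic_vec[symmetric])
    have Fx: "F x = fnorm u" "G x = gnorm u"
      using True u by (simp_all add: F_def G_def fnorm_def gnorm_def max_norm_def padic_map_def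
          padic_eval_of_padic_vec padic_norm_of_padic_int)
    have "zeta_integrand f g s x = complex_of_real (fnorm u) powr s * complex_of_real (gnorm u)"
      by (simp add: u zeta_integrand_of_padic_vec)
    then show ?thesis
      using True fnorm_bounds(1)[of u] by (auto simp: Fx powr_def Ln_of_real)
  qed (simp add: F_def G_def)
  show ?thesis unfolding eq using F G by measurable
qed

text \<open>This is p^(-s), the variable in which the zeta function is rational.\<close>

definition zpar :: "complex \<Rightarrow> complex" where
  "zpar s = complex_of_real q powr s"

lemma zpar_eq: "zpar s = of_nat CARD('p) powr (- s)"
proof -
  have p: "real CARD('p) > 0" using int_card_pos[where 'p='p] by simp
  have "Ln (complex_of_real q) = of_real (ln q)" using q_bounds by (intro Ln_of_real)
  also have "ln q = - ln (real CARD('p))" using p by (simp add: q_def ln_div)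
  finally have "Ln (complex_of_real q) = - of_real (ln (real CARD('p)))" by simp
  moreover have "Ln (of_nat CARD('p)) = complex_of_real (ln (real CARD('p)))"
    using Ln_of_real[OF p] by simp
  moreover have "complex_of_real q \<noteq> 0" using q_bounds by simp
  ultimately show ?thesis using p unfolding zpar_def powr_def by simp
qed

lemma norm_zpar: "Re s > 0 \<Longrightarrow> norm (zpar s) < 1"
proof -
  assume s: "Re s > 0"
  have "norm (zpar s) = q powr Re s"
    unfolding zpar_def using q_bounds by (simp add: norm_powr_real_powr)
  then show ?thesis using q_bounds s by (simp add: powr_def mult_pos_neg)
qed

text \<open>Used with two choices of the markers: y = z = 1 gives the masses of the strata, y =
  p^(-s) and z = 1/p give the contributions to the integral.\<close>

definition level_factor :: "('n \<Rightarrow> nat) \<Rightarrow> complex \<Rightarrow> complex \<Rightarrow> ('p mod_ring ^ 'n) \<times> nat \<times> nat \<Rightarrow> complex" where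
  "level_factor k y z = (\<lambda>(a, j, l). of_bool (a \<in> torus) *
     ((of_real (level_mass q CARD('t) (fzero k a) j) * y ^ j) * (of_real (level_mass q 1 (gzero k a) l) * z ^ l)))"

lemma level_factor_sum:
  assumes "norm y \<le> 1" "norm z \<le> 1"
  shows "level_factor k y z abs_summable_on UNIV"
    and "infsum (level_factor k y z) UNIV
      = (\<Sum>a\<in>torus. level_sum q CARD('t) (fzero k a) y * level_sum q 1 (gzero k a) z)"
proof -
  let ?u = "\<lambda>a j. complex_of_real (level_mass q CARD('t) (fzero k a) j) * y ^ j"
  let ?v = "\<lambda>a l. complex_of_real (level_mass q 1 (gzero k a) l) * z ^ l"
  have u: "?u a abs_summable_on UNIV" "(?u a has_sum level_sum q CARD('t) (fzero k a) y) UNIV" for a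
    using level_mass_has_sum[OF q_bounds _ assms(1)] by auto
  have v: "?v a abs_summable_on UNIV" "(?v a has_sum level_sum q 1 (gzero k a) z) UNIV" for a
    using level_mass_has_sum[OF q_bounds _ assms(2)] by auto
  have lf: "level_factor k y z (a, jl) = of_bool (a \<in> torus) * (case jl of (j, l) \<Rightarrow> ?u a j * ?v a l)" for a jl
    by (cases jl) (simp add: level_factor_def)
  have inner: "(\<lambda>jl. level_factor k y z (a, jl)) abs_summable_on UNIV" for a
    using abs_summable_times(1)[OF u(1)[of a] v(1)[of a]] unfolding lf
    by (cases "a \<in> torus") simp_all
  have val: "(\<Sum>\<^sub>\<infinity>jl. level_factor k y z (a, jl))
      = of_bool (a \<in> torus) * (level_sum q CARD('t) (fzero k a) y * level_sum q 1 (gzero k a) z)" for a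
    using abs_summable_times(2)[OF u(1)[of a] v(1)[of a]] infsumI[OF u(2)[of a]] infsumI[OF v(2)[of a]]
    unfolding lf by (cases "a \<in> torus") simp_all
  show s: "level_factor k y z abs_summable_on UNIV"
    using Infinite_Sum.abs_summable_on_Sigma_iff[of "level_factor k y z" UNIV "\<lambda>_. UNIV"] inner
    by simp
  have "infsum (level_factor k y z) UNIV = (\<Sum>\<^sub>\<infinity>a. \<Sum>\<^sub>\<infinity>jl. level_factor k y z (a, jl))"
    using infsum_Sigma_banach[of "level_factor k y z" UNIV "\<lambda>_. UNIV"] Infinite_Sum.abs_summable_summable[OF s]
    by simp
  also have "\<dots> = (\<Sum>a\<in>UNIV. of_bool (a \<in> torus) * (level_sum q CARD('t) (fzero k a) y * level_sum q 1 (gzero k a) z))"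
    by (simp add: val)
  also have "\<dots> = (\<Sum>a\<in>torus. level_sum q CARD('t) (fzero k a) y * level_sum q 1 (gzero k a) z)"
    by (intro sum.mono_neutral_cong_right) auto
  finally show "infsum (level_factor k y z) UNIV
      = (\<Sum>a\<in>torus. level_sum q CARD('t) (fzero k a) y * level_sum q 1 (gzero k a) z)" .
qed

lemma pmeas_stratum_factor:
  "of_real (pmeas (stratum (k, x))) = of_real (box_mass k) * level_factor k 1 1 x"
  by (cases x) (simp add: pmeas_stratum level_factor_def)

text \<open>The value is one over the number of points of the torus, as it must be if the boxes of
  all k and a are to have total mass 1.\<close>

lemma box_mass_has_sum: "(box_mass has_sum (1 / (real CARD('p) - 1)) ^ CARD('n)) UNIV"
proof -
  have "box_mass = (\<lambda>k. q ^ CARD('n) * (\<Prod>i\<in>UNIV. q ^ k i))"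
    by (simp add: fun_eq_iff box_mass_def prod.distrib)
  moreover have "((\<lambda>k :: 'n \<Rightarrow> nat. q ^ CARD('n) * (\<Prod>i\<in>UNIV. q ^ k i))
      has_sum q ^ CARD('n) * (1 / (1 - q)) ^ CARD('n)) UNIV"
    by (intro has_sum_cmult_right multi_geometric_has_sum q_bounds)
  moreover have "q ^ CARD('n) * (1 / (1 - q)) ^ CARD('n) = (1 / (real CARD('p) - 1)) ^ CARD('n)"
  proof -
    have "q * (1 / (1 - q)) = 1 / (real CARD('p) - 1)"
      unfolding q_def using int_card_gt_1[where 'p='p] by (simp add: field_simps)
    then show ?thesis by (simp flip: power_mult_distrib)
  qed
  ultimately show ?thesis by simp
qed

lemma pmeas_nonneg: "pmeas A \<ge> 0"
  by (simp add: pmeas_def)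

text \<open>So the complement of the strata, where a coordinate, \<open>f\<close> or \<open>g\<close> vanishes, is a null set.\<close>

lemma stratum_total: "((\<lambda>x. pmeas (stratum x)) has_sum 1) UNIV"
proof -
  have lf: "infsum (level_factor k 1 1) UNIV = of_nat (card (torus :: ('p mod_ring ^ 'n) set))" for k
  proof -
    have nz: "(1 :: complex) - of_real q ^ m \<noteq> 0" if "m > 0" for m
    proof -
      have "q ^ m \<noteq> 1" using q_bounds that power_less_one_iff[of q m] by force
      then have "complex_of_real (q ^ m) \<noteq> 1" by (metis of_real_eq_1_iff)
      then show ?thesis by simp
    qed
    have "(1 :: complex) - of_real q ^ CARD('t) \<noteq> 0" "(1 :: complex) - of_real q \<noteq> 0"
      using nz[of "CARD('t)"] nz[of 1] by simp_all
    then have "level_sum q CARD('t) b 1 = 1" "level_sum q 1 b 1 = 1" for b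
      by (simp_all add: level_sum_def)
    then show ?thesis using level_factor_sum(2)[of 1 1 k] by simp
  qed
  have inner: "((\<lambda>y. pmeas (stratum (k, y))) has_sum box_mass k * real (card (torus :: ('p mod_ring ^ 'n) set))) UNIV" for k
  proof -
    have "(level_factor k 1 1 has_sum of_nat (card (torus :: ('p mod_ring ^ 'n) set))) UNIV"
      using level_factor_sum(1)[of 1 1 k] lf Infinite_Sum.abs_summable_summable by (metis has_sum_infsum norm_one order_refl)
    then have "((\<lambda>y. of_real (box_mass k) * level_factor k 1 1 y)
        has_sum complex_of_real (box_mass k) * of_nat (card (torus :: ('p mod_ring ^ 'n) set))) UNIV"
      by (rule has_sum_cmult_right)
    then have "((\<lambda>y. complex_of_real (pmeas (stratum (k, y))))
        has_sum complex_of_real (box_mass k * real (card (torus :: ('p mod_ring ^ 'n) set)))) UNIV"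
      by (simp add: pmeas_stratum_factor)
    then show ?thesis by (simp only: has_sum_of_real_iff)
  qed
  have outer: "((\<lambda>k. box_mass k * real (card (torus :: ('p mod_ring ^ 'n) set))) has_sum 1) UNIV"
  proof -
    have "((\<lambda>k. box_mass k * real (card (torus :: ('p mod_ring ^ 'n) set)))
        has_sum (1 / (real CARD('p) - 1)) ^ CARD('n) * real (card (torus :: ('p mod_ring ^ 'n) set))) UNIV"
      by (intro has_sum_cmult_left box_mass_has_sum)
    moreover have "(1 / (real CARD('p) - 1)) ^ CARD('n) * real (card (torus :: ('p mod_ring ^ 'n) set)) = 1"
    proof -
      have "real (CARD('p) - 1) = real CARD('p) - 1" "real CARD('p) - 1 \<noteq> 0"
        using int_card_gt_1[where 'p='p] by auto
      then show ?thesis by (simp add: card_torus power_one_over)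
    qed
    ultimately show ?thesis by simp
  qed
  have sm: "(\<lambda>x. pmeas (stratum x)) summable_on (UNIV \<times> UNIV)"
  proof (rule summable_on_SigmaI[of _ _ _ "\<lambda>k. box_mass k * real (card (torus :: ('p mod_ring ^ 'n) set))"])
    show "(\<lambda>k. box_mass k * real (card (torus :: ('p mod_ring ^ 'n) set))) summable_on UNIV"
      using outer by (rule has_sum_imp_summable)
  qed (use inner pmeas_nonneg in auto)
  have "((\<lambda>x. pmeas (stratum x)) has_sum 1) (UNIV \<times> UNIV)"
    by (rule has_sum_SigmaI[OF inner outer sm])
  then show ?thesis by simp
qed

text \<open>The integrand is constant on each stratum, and Re s > 0 bounds it by 1 on the
  cube.\<close>

lemma zeta_integral:
  assumes s: "Re s > 0"
  shows "set_integrable \<mu> Zp_cube (zeta_integrand f g s)"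
    and "(\<lambda>x. of_real (pmeas (stratum x)) * (case x of (k, a, j, l) \<Rightarrow> zpar s ^ (mf k + j) * of_real (q ^ (mg k + l))))
      abs_summable_on UNIV"
    and "zeta \<mu> f g s = (\<Sum>\<^sub>\<infinity>x. of_real (pmeas (stratum x)) *
      (case x of (k, a, j, l) \<Rightarrow> zpar s ^ (mf k + j) * of_real (q ^ (mg k + l))))"
proof -
  let ?c = "\<lambda>x :: ('n \<Rightarrow> nat) \<times> ('p mod_ring ^ 'n) \<times> nat \<times> nat.
    case x of (k, a, j, l) \<Rightarrow> zpar s ^ (mf k + j) * complex_of_real (q ^ (mg k + l))"
  have *: "\<And>x. of_padic_vec ` stratum x \<in> sets \<mu>" "\<And>x. of_padic_vec ` stratum x \<subseteq> Zp_cube"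
    "\<And>x y. x \<noteq> y \<Longrightarrow> of_padic_vec ` stratum x \<inter> of_padic_vec ` stratum y = {}"
    "Zp_cube \<in> sets \<mu>" "emeasure \<mu> Zp_cube < \<infinity>"
    "((\<lambda>x. measure \<mu> (of_padic_vec ` stratum x)) has_sum measure \<mu> Zp_cube) UNIV"
  proof -
    show "of_padic_vec ` stratum x \<in> sets \<mu>" for x using cylinder_stratum cylinder_sets by blast
    show "of_padic_vec ` stratum x \<subseteq> Zp_cube" for x using range_of_padic_vec by blast
    show "of_padic_vec ` stratum x \<inter> of_padic_vec ` stratum y = {}" if "x \<noteq> y" for x y
      using stratum_disjoint[OF that] by (auto simp: of_padic_vec_eq_iff)
    show "((\<lambda>x. measure \<mu> (of_padic_vec ` stratum x)) has_sum measure \<mu> Zp_cube) UNIV"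
      using stratum_total pmeas_UNIV by (simp add: pmeas_def range_of_padic_vec)
  qed (simp_all add: Zp_cube_sets emeasure_cube)
  have h: "zeta_integrand f g s x = ?c i" if x: "x \<in> of_padic_vec ` stratum i" for x i
  proof -
    obtain k a j l where i: "i = (k, a, j, l)" by (cases i)
    obtain u where u: "x = of_padic_vec u" "u \<in> stratum (k, a, j, l)" using x i by blast
    show ?thesis
      unfolding u(1) zeta_integrand_of_padic_vec fnorm_stratum[OF u(2)] i zpar_def
      using of_real_power_powr[OF q_bounds(1)] by simp
  qed
  have bd: "norm (zeta_integrand f g s x) \<le> 1" if x: "x \<in> Zp_cube" for x
  proof -
    obtain u where u: "x = of_padic_vec u" using x by (auto simp: range_of_padic_vec[symmetric])
    have "norm (complex_of_real (fnorm u) powr s) \<le> 1"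
    proof (cases "fnorm u = 0")
      case False
      then have "norm (complex_of_real (fnorm u) powr s) = fnorm u powr Re s"
        using fnorm_bounds[of u] by (simp add: norm_powr_real_powr)
      also have "\<dots> \<le> 1" using fnorm_bounds[of u] s by (intro powr_le1) auto
      finally show ?thesis .
    qed simp
    then show ?thesis
      unfolding u zeta_integrand_of_padic_vec norm_mult
      using gnorm_bounds[of u] mult_mono[of "norm (complex_of_real (fnorm u) powr s)" 1 "gnorm u" 1] by simp
  qed
  note I = integral_countable_partition[OF * measurable_zeta_integrand h bd]
  show "set_integrable \<mu> Zp_cube (zeta_integrand f g s)" by (rule I(1))
  show "(\<lambda>x. of_real (pmeas (stratum x)) * ?c x) abs_summable_on UNIV"
    using I(2) by (simp add: pmeas_def scaleR_conv_of_real)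
  show "zeta \<mu> f g s = (\<Sum>\<^sub>\<infinity>x. of_real (pmeas (stratum x)) * ?c x)"
    using I(3) by (simp add: zeta_def pmeas_def scaleR_conv_of_real)
qed

end

section \<open>From lattice points to cells\<close>

lemma powr_minus_weight:
  fixes c :: nat and s :: complex
  assumes "c > 0"
  shows "of_nat c powr (- (of_nat a * s + of_nat b)) = (of_nat c powr (- s)) ^ a * of_real (1 / real c) ^ b"
proof -
  have c: "complex_of_real (1 / real c) = exp (- Ln (of_nat c))"
    using assms by (subst exp_minus, subst exp_Ln) (auto simp: field_simps)
  show ?thesis
    unfolding c using assms
    by (simp add: powr_def algebra_simps flip: exp_of_nat_mult exp_add)
qed

lemma infsum_finite_disjoint_UN:
  fixes u :: "'a \<Rightarrow> complex"
  assumes "finite D" "disjoint_family_on A D" "u summable_on (\<Union>d\<in>D. A d)"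
  shows "infsum u (\<Union>d\<in>D. A d) = (\<Sum>d\<in>D. infsum u (A d))"
  using assms
proof (induction D rule: finite_induct)
  case (insert d D)
  have s: "u summable_on A d" "u summable_on (\<Union>d\<in>D. A d)"
    using insert.prems(2) by (rule summable_on_subset_banach; blast)+
  have dis: "A d \<inter> (\<Union>d\<in>D. A d) = {}" and "disjoint_family_on A D"
    using insert.prems(1) insert.hyps(2) by (simp_all add: disjoint_family_on_insert)
  then have "infsum u (\<Union>d\<in>D. A d) = (\<Sum>d\<in>D. infsum u (A d))" by (intro insert.IH s(2))
  then show ?case using infsum_Un_disjoint[OF s dis] insert.hyps by simp
qed simp

lemma kvec_nat_points: "{\<kappa> \<in> \<delta>. \<forall>i. \<kappa> $ i \<in> \<nat>} = kvec ` {k. kvec k \<in> \<delta>}"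
proof (intro equalityI subsetI)
  fix \<kappa> assume \<kappa>: "\<kappa> \<in> {\<kappa> \<in> \<delta>. \<forall>i. \<kappa> $ i \<in> \<nat>}"
  then have "\<forall>i. \<exists>m. \<kappa> $ i = real m" by (auto elim: Nats_cases)
  then obtain k where "\<forall>i. \<kappa> $ i = real (k i)" by metis
  then have "\<kappa> = kvec k" by (simp add: kvec_def vec_eq_iff)
  then show "\<kappa> \<in> kvec ` {k. kvec k \<in> \<delta>}" using \<kappa> by auto
qed (auto simp: kvec_def)

lemma inj_kvec: "inj kvec"
  by (auto simp: inj_on_def kvec_def vec_eq_iff fun_eq_iff)

context zeta_data
begin

lemma weight_kvec: "weight f g s (kvec k) = of_nat (mf k) * s + of_nat (mg k + sum k UNIV)"
proof -
  have "min_val (Gam_f f) (kvec k) = real (mf k)"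
    unfolding Gam_f_eq[OF map_keys_f keys_g] mf_def
    by (rule min_val_kvec[OF finite_map_keys map_keys_f])
  moreover have "min_val (Gam_g g) (kvec k) = real (mg k)"
    unfolding Gam_g_def mg_def by (rule min_val_kvec[OF finite_keys keys_g])
  ultimately show ?thesis by (simp add: weight_def sigma_kvec)
qed

lemma powr_weight_kvec:
  "of_nat CARD('p) powr (- weight f g s (kvec k)) = zpar s ^ mf k * of_real q ^ (mg k + sum k UNIV)"
  unfolding weight_kvec zpar_eq unfolding q_def using int_card_pos[where 'p='p]
  by (intro powr_minus_weight) simp

text \<open>The factors coming from m_f and m_g have modulus at most 1, which leaves the geometric
  series in \<sigma>(k).\<close>

lemma powr_weight_summable:
  assumes s: "Re s > 0"
  shows "(\<lambda>k. of_nat CARD('p) powr (- weight f g s (kvec k))) abs_summable_on UNIV"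
proof (rule Infinite_Sum.abs_summable_on_comparison_test)
  have "(\<lambda>k :: 'n \<Rightarrow> nat. \<Prod>i\<in>UNIV. q ^ k i) summable_on UNIV"
    using multi_geometric_has_sum[OF q_bounds] by (rule has_sum_imp_summable)
  then show "(\<lambda>k :: 'n \<Rightarrow> nat. \<Prod>i\<in>UNIV. q ^ k i) abs_summable_on UNIV"
    using q_bounds by (simp add: abs_prod)
  fix k :: "'n \<Rightarrow> nat"
  have "norm (zpar s ^ mf k * of_real q ^ (mg k + sum k UNIV)) \<le> 1 * q ^ (mg k + sum k UNIV)"
    unfolding norm_mult norm_power using q_bounds norm_zpar[OF s]
    by (intro mult_mono power_le_one) auto
  also have "\<dots> \<le> q ^ sum k UNIV" using q_bounds by (simp add: power_decreasing)
  also have "\<dots> = norm (\<Prod>i\<in>UNIV. q ^ k i)" using q_bounds by (simp add: power_sum abs_prod)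
  finally show "norm (of_nat CARD('p) powr (- weight f g s (kvec k))) \<le> norm (\<Prod>i\<in>UNIV. q ^ k i)"
    unfolding powr_weight_kvec .
qed

text \<open>A residue at which neither f nor g vanishes contributes 1. The three terms subtracted in
  L correct this at the residues counted by N, P and Q.\<close>

lemma L_cell_eq:
  assumes s: "Re s > 0"
  shows "of_real q ^ CARD('n) * (\<Sum>a\<in>torus. level_sum q CARD('t) (fzero k a) (zpar s) * level_sum q 1 (gzero k a) (of_real q))
    = L_cell f g s (kcell k)"
proof -
  define p where "p = (of_nat CARD('p) :: complex)"
  define t where "t = CARD('t)"
  define w where "w = p powr s"
  \<comment> \<open>The values of \<open>level_sum\<close> in the vanishing case: \<alpha> for f at
    p^(-s), and \<beta> below for g at 1/p. The coefficients of N, P and Q in L are 1 - \<alpha>, 1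
    - \<beta> and 1 - \<alpha> \<beta>.\<close>
  define \<alpha> where "\<alpha> = (p ^ t - 1) / (w * p ^ t - 1)"
  define \<beta> where "\<beta> = 1 / (p + 1)"
  have p1: "real CARD('p) > 1" using int_card_gt_1[where 'p='p] by simp
  have p0: "p \<noteq> 0" using p1 by (auto simp: p_def)
  have t0: "t > 0" by (simp add: t_def)
  have w0: "w \<noteq> 0" by (simp add: w_def p0)
  have z: "zpar s = 1 / w" by (simp add: zpar_eq w_def p_def powr_minus divide_inverse)
  have qp: "complex_of_real q = 1 / p" by (simp add: q_def p_def)
  have nw: "norm w > 1" using norm_zpar[OF s] w0 unfolding z by (simp add: norm_divide divide_less_eq)
  have np: "norm p > 1" using p1 by (simp add: p_def)
  have "norm (w * p ^ t) > 1"
  proof -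
    have "1 \<le> norm p ^ t" using np by (intro one_le_power) simp
    then have "norm w * 1 \<le> norm w * norm p ^ t" by (intro mult_left_mono) auto
    then show ?thesis using nw by (simp add: norm_mult norm_power)
  qed
  then have wp: "w * p ^ t - 1 \<noteq> 0" by auto
  have pp: "p + 1 \<noteq> 0"
  proof
    assume "p + 1 = 0"
    then have "norm p = 1" by (simp add: add_eq_0_iff2)
    then show False using np by simp
  qed
  have pm: "p - 1 \<noteq> 0" using np by auto
  have A: "level_sum q CARD('t) b (zpar s) = (if b then \<alpha> else 1)" for b
  proof -
    have "1 - (1 / p) ^ t * (1 / w) \<noteq> 0"
      using wp p0 w0 by (simp add: field_simps power_divide)
    then have "(1 / w) * (1 - (1 / p) ^ t) / (1 - (1 / p) ^ t * (1 / w)) = \<alpha>"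
      using wp p0 w0 unfolding \<alpha>_def by (simp add: field_simps power_divide)
    then show ?thesis unfolding level_sum_def z qp t_def[symmetric] by simp
  qed
  have B: "level_sum q 1 b (of_real q) = (if b then \<beta> else 1)" for b
  proof -
    have "1 - (1 / p) * (1 / p) = (p + 1) * (p - 1) / (p * p)" using p0 by (simp add: field_simps)
    then have "(1 / p) * (1 - 1 / p) / (1 - (1 / p) * (1 / p)) = \<beta>"
      using p0 pp pm unfolding \<beta>_def by (simp add: divide_simps)
    then show ?thesis unfolding level_sum_def qp by simp
  qed
  let ?T = "torus :: ('p mod_ring ^ 'n) set"
  have fin: "finite ?T" by simp
  have fac: "level_sum q CARD('t) (fzero k a) (zpar s) * level_sum q 1 (gzero k a) (of_real q)
      = 1 - (1 - \<alpha>) * of_bool (fzero k a \<and> \<not> gzero k a) - (1 - \<beta>) * of_bool (\<not> fzero k a \<and> gzero k a)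
        - (1 - \<alpha> * \<beta>) * of_bool (fzero k a \<and> gzero k a)" for a
    unfolding A B by (auto simp: algebra_simps)
  have card: "(\<Sum>a\<in>?T. of_bool (Q a)) = (of_nat (card {a \<in> ?T. Q a}) :: complex)" for Q
  proof -
    have "(\<Sum>a\<in>?T. of_bool (Q a)) = (\<Sum>a\<in>{a \<in> ?T. Q a}. 1 :: complex)"
      by (intro sum.mono_neutral_cong_right) auto
    then show ?thesis by simp
  qed
  have "(\<Sum>a\<in>?T. level_sum q CARD('t) (fzero k a) (zpar s) * level_sum q 1 (gzero k a) (of_real q))
      = of_nat (card ?T) - (1 - \<alpha>) * of_nat (N_cell f g (kcell k))
        - (1 - \<beta>) * of_nat (P_cell f g (kcell k)) - (1 - \<alpha> * \<beta>) * of_nat (Q_cell f g (kcell k))"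
    unfolding fac sum_subtractf sum_distrib_left[symmetric] card
    by (simp add: N_cell_def P_cell_def Q_cell_def fzero_def gzero_def)
  also have "of_nat (card ?T) = (p - 1) ^ CARD('n)"
    unfolding card_torus p_def using p1 by (simp add: of_nat_diff)
  also have "1 - \<alpha> = p ^ t * ((w - 1) / (w * p ^ t - 1))"
    using wp unfolding \<alpha>_def by (simp add: field_simps)
  also have "1 - \<beta> = p / (p + 1)"
    using pp unfolding \<beta>_def by (simp add: field_simps)
  also have "1 - \<alpha> * \<beta> = p * ((p ^ (t - 1) * (w * (p + 1) - 1) - 1) / ((w * p ^ t - 1) * (p + 1)))"
  proof -
    have "p ^ t = p * p ^ (t - 1)" using t0 by (cases t) auto
    then show ?thesis using wp pp unfolding \<alpha>_def \<beta>_def by (simp add: divide_simps) (simp add: algebra_simps)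
  qed
  also have "w * p ^ t = p powr (s + of_nat t)"
    using p0 by (simp add: w_def powr_add powr_nat')
  finally show ?thesis
    unfolding L_cell_def Let_def p_def[symmetric] t_def[symmetric] w_def[symmetric] qp power_one_over
    by (simp add: mult_ac)
qed

lemma zeta_lattice_sum:
  assumes s: "Re s > 0"
  shows "zeta \<mu> f g s = (\<Sum>\<^sub>\<infinity>k. L_cell f g s (kcell k) * of_nat CARD('p) powr (- weight f g s (kvec k)))"
proof -
  let ?h = "\<lambda>x :: ('n \<Rightarrow> nat) \<times> ('p mod_ring ^ 'n) \<times> nat \<times> nat. complex_of_real (pmeas (stratum x)) *
      (case x of (k, a, j, l) \<Rightarrow> zpar s ^ (mf k + j) * of_real (q ^ (mg k + l)))"
  define T where "T k = of_real (box_mass k) * zpar s ^ mf k * of_real q ^ mg k" for k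
  have h: "?h (k, x) = T k * level_factor k (zpar s) (of_real q) x" for k x
  proof (cases x)
    case (fields a j l)
    then show ?thesis
      by (simp add: pmeas_stratum level_factor_def T_def power_add mult_ac)
  qed
  have bm: "complex_of_real (box_mass k) = of_real q ^ CARD('n) * of_real q ^ sum k UNIV" for k
    by (simp add: box_mass_def prod.distrib power_sum)
  have T: "T k = of_real q ^ CARD('n) * of_nat CARD('p) powr (- weight f g s (kvec k))" for k
    unfolding T_def powr_weight_kvec bm power_add by (simp add: mult_ac)
  have nz: "norm (zpar s) \<le> 1" "norm (complex_of_real q) \<le> 1" using norm_zpar[OF s] q_bounds by auto
  have "zeta \<mu> f g s = (\<Sum>\<^sub>\<infinity>k. \<Sum>\<^sub>\<infinity>x. ?h (k, x))"
    unfolding zeta_integral(3)[OF s]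
    using infsum_Sigma_banach[of ?h UNIV "\<lambda>_. UNIV"] Infinite_Sum.abs_summable_summable[OF zeta_integral(2)[OF s]]
    by simp
  also have "\<dots> = (\<Sum>\<^sub>\<infinity>k. L_cell f g s (kcell k) * of_nat CARD('p) powr (- weight f g s (kvec k)))"
    unfolding h infsum_cmult_right' level_factor_sum(2)[OF nz] T L_cell_eq[OF s, symmetric]
    by (simp add: mult_ac)
  finally show ?thesis .
qed

lemma S_cell_kvec:
  "S_cell f g s \<delta> = (\<Sum>\<^sub>\<infinity>k\<in>{k. kvec k \<in> \<delta>}. of_nat CARD('p) powr (- weight f g s (kvec k)))"
proof -
  have "inj_on kvec {k. kvec k \<in> \<delta>}" using inj_kvec by (rule inj_on_subset) simp
  then show ?thesis unfolding S_cell_def kvec_nat_points by (simp add: infsum_reindex o_def)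
qed

lemma S_cell_summable:
  assumes s: "Re s > 0"
  shows "(\<lambda>\<kappa>. of_nat CARD('p) powr (- weight f g s \<kappa>)) summable_on {\<kappa> \<in> \<delta>. \<forall>i. \<kappa> $ i \<in> \<nat>}"
proof -
  have "inj_on kvec {k. kvec k \<in> \<delta>}" using inj_kvec by (rule inj_on_subset) simp
  moreover have "(\<lambda>k. of_nat CARD('p) powr (- weight f g s (kvec k))) summable_on {k. kvec k \<in> \<delta>}"
    using Infinite_Sum.abs_summable_summable[OF powr_weight_summable[OF s]] by (rule summable_on_subset_banach) simp
  ultimately show ?thesis unfolding kvec_nat_points by (simp add: summable_on_reindex o_def)
qed

text \<open>Every k lies in exactly one cell, and the factor L depends on the cell only; absolute
  summability allows the lattice points to be grouped.\<close>

lemma zeta_formula: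
  assumes s: "Re s > 0"
  shows "zeta \<mu> f g s = (\<Sum>\<delta>\<in>Delta f g. L_cell f g s \<delta> * S_cell f g s \<delta>)"
proof -
  let ?e = "\<lambda>k. of_nat CARD('p) powr (- weight f g s (kvec k))"
  let ?D = "Delta f g" and ?K = "\<lambda>\<delta>. {k. kvec k \<in> \<delta>}"
  have fin: "finite ?D" by (rule finite_Delta[OF map_keys_f keys_g])
  have mem: "kvec k \<in> \<delta> \<longleftrightarrow> kcell k = \<delta>" if \<delta>: "\<delta> \<in> ?D" for k \<delta>
  proof -
    obtain \<kappa> where "\<delta> = cell f g \<kappa>" using \<delta> unfolding Delta_eq[OF map_keys_f keys_g] by blast
    then show ?thesis using cell_eqI cell_self[OF kvec_orthant] by blast
  qed
  have kD: "kcell k \<in> ?D" for k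
    unfolding Delta_eq[OF map_keys_f keys_g] using kvec_orthant by blast
  have un: "(\<Union>\<delta>\<in>?D. ?K \<delta>) = UNIV" using kD mem by blast
  have "(\<lambda>k. L_cell f g s (kcell k) * ?e k) abs_summable_on UNIV"
  proof (rule Infinite_Sum.abs_summable_on_comparison_test)
    let ?B = "\<Sum>\<delta>\<in>?D. norm (L_cell f g s \<delta>)"
    show "(\<lambda>k. of_real ?B * ?e k) abs_summable_on UNIV"
      unfolding norm_mult by (intro summable_on_cmult_right powr_weight_summable s)
    fix k
    have "norm (L_cell f g s (kcell k)) \<le> ?B" using kD fin by (intro member_le_sum) auto
    then have "norm (L_cell f g s (kcell k)) \<le> norm (of_real ?B :: complex)"
      unfolding norm_of_real by linarith
    then show "norm (L_cell f g s (kcell k) * ?e k) \<le> norm (of_real ?B * ?e k)"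
      unfolding norm_mult by (rule mult_right_mono) simp
  qed
  then have sum: "(\<lambda>k. L_cell f g s (kcell k) * ?e k) summable_on (\<Union>\<delta>\<in>?D. ?K \<delta>)"
    unfolding un by (rule Infinite_Sum.abs_summable_summable)
  have "disjoint_family_on ?K ?D" using mem unfolding disjoint_family_on_def by blast
  then have "zeta \<mu> f g s = (\<Sum>\<delta>\<in>?D. \<Sum>\<^sub>\<infinity>k\<in>?K \<delta>. L_cell f g s (kcell k) * ?e k)"
    unfolding zeta_lattice_sum[OF s] un[symmetric] by (rule infsum_finite_disjoint_UN[OF fin _ sum])
  also have "\<dots> = (\<Sum>\<delta>\<in>?D. \<Sum>\<^sub>\<infinity>k\<in>?K \<delta>. L_cell f g s \<delta> * ?e k)"
    by (intro sum.cong infsum_cong refl) (simp add: mem)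
  also have "\<dots> = (\<Sum>\<delta>\<in>?D. L_cell f g s \<delta> * S_cell f g s \<delta>)"
    by (simp only: S_cell_kvec infsum_cmult_right')
  finally show ?thesis .
qed

end

section \<open>Exponential sums over simplicial cones\<close>

definition int_vec :: "real ^ 'n \<Rightarrow> bool" where
  "int_vec x \<longleftrightarrow> (\<forall>i. x $ i \<in> \<int>)"

lemma int_vec_add: "int_vec x \<Longrightarrow> int_vec y \<Longrightarrow> int_vec (x + y)"
  by (simp add: int_vec_def)

lemma int_vec_diff: "int_vec x \<Longrightarrow> int_vec y \<Longrightarrow> int_vec (x - y)"
  by (simp add: int_vec_def)

lemma int_vec_scale: "int_vec x \<Longrightarrow> int_vec (real m *\<^sub>R x)"
  by (simp add: int_vec_def)

lemma int_vec_sum: "(\<And>i. i \<in> I \<Longrightarrow> int_vec (u i)) \<Longrightarrow> int_vec (sum u I)"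
  by (induction I rule: infinite_finite_induct) (auto simp: int_vec_add int_vec_def)

lemma finite_bounded_int_vec: "finite {x :: real ^ 'n::finite. int_vec x \<and> (\<forall>i. \<bar>x $ i\<bar> \<le> B i)}"
proof (rule finite_subset)
  let ?P = "PiE (UNIV :: 'n set) (\<lambda>i. {- \<lceil>B i\<rceil>..\<lceil>B i\<rceil>})"
  show "finite ((\<lambda>m. \<chi> i. real_of_int (m i)) ` ?P)" by (intro finite_imageI finite_PiE) auto
  show "{x. int_vec x \<and> (\<forall>i. \<bar>x $ i\<bar> \<le> B i)} \<subseteq> (\<lambda>m. \<chi> i. real_of_int (m i)) ` ?P"
  proof
    fix x :: "real ^ 'n" assume x: "x \<in> {x. int_vec x \<and> (\<forall>i. \<bar>x $ i\<bar> \<le> B i)}"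
    then have "\<forall>i. \<exists>m. x $ i = of_int m" by (auto simp: int_vec_def Ints_def image_iff)
    then obtain m where m: "\<And>i. x $ i = of_int (m i)" by metis
    have "m i \<in> {- \<lceil>B i\<rceil>..\<lceil>B i\<rceil>}" for i
    proof -
      have "\<bar>x $ i\<bar> \<le> B i" using x by simp
      then have "\<bar>real_of_int (m i)\<bar> \<le> B i" by (simp add: m)
      then have "real_of_int (m i) \<le> of_int \<lceil>B i\<rceil>" "real_of_int (- m i) \<le> of_int \<lceil>B i\<rceil>"
        using le_of_int_ceiling[of "B i"] by (auto simp del: le_of_int_ceiling)
      then show ?thesis unfolding of_int_le_iff by auto
    qed
    moreover have "x = (\<chi> i. of_int (m i))" by (simp add: vec_eq_iff m)
    ultimately show "x \<in> (\<lambda>m. \<chi> i. real_of_int (m i)) ` ?P" by (auto simp: PiE_iff)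
  qed
qed

lemma finite_half_open_box:
  fixes K :: "(real ^ 'n::finite) set"
  assumes "finite K"
  shows "finite {h \<in> half_open_box K. int_vec h}"
proof (rule finite_subset)
  show "finite {x :: real ^ 'n. int_vec x \<and> (\<forall>i. \<bar>x $ i\<bar> \<le> (\<Sum>k\<in>K. \<bar>k $ i\<bar>))}"
    by (rule finite_bounded_int_vec)
  show "{h \<in> half_open_box K. int_vec h} \<subseteq> {x. int_vec x \<and> (\<forall>i. \<bar>x $ i\<bar> \<le> (\<Sum>k\<in>K. \<bar>k $ i\<bar>))}"
  proof safe
    fix h i assume "h \<in> half_open_box K"
    then obtain l where l: "\<forall>k\<in>K. 0 \<le> l k \<and> l k < 1" "h = (\<Sum>k\<in>K. l k *\<^sub>R k)"
      unfolding half_open_box_def by blast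
    have "\<bar>h $ i\<bar> \<le> (\<Sum>k\<in>K. \<bar>l k * k $ i\<bar>)"
      unfolding l(2) by (simp add: sum_abs)
    also have "\<dots> \<le> (\<Sum>k\<in>K. \<bar>k $ i\<bar>)"
      using l(1) by (intro sum_mono) (auto simp: abs_mult intro!: mult_left_le_one_le)
    finally show "\<bar>h $ i\<bar> \<le> (\<Sum>k\<in>K. \<bar>k $ i\<bar>)" .
  qed
qed

text \<open>A point of the box may have vanishing coefficients and lie outside the open cone. Adding
  a small multiple of the sum of the generators moves it inside.\<close>

lemma half_open_box_closure:
  assumes "finite K" "h \<in> half_open_box K"
  shows "h \<in> closure (strict_cone K)"
proof -
  obtain l where l: "\<forall>k\<in>K. 0 \<le> l k \<and> l k < 1" "h = (\<Sum>k\<in>K. l k *\<^sub>R k)"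
    using assms(2) unfolding half_open_box_def by blast
  have "h + (1 / real (Suc m)) *\<^sub>R (\<Sum>k\<in>K. k) = (\<Sum>k\<in>K. (l k + 1 / real (Suc m)) *\<^sub>R k)" for m
    unfolding l(2) by (simp only: scaleR_right.sum scaleR_add_left sum.distrib)
  moreover have "\<forall>k\<in>K. 0 < l k + 1 / real (Suc m)" for m
    using l(1) by (auto intro: add_nonneg_pos)
  ultimately have "h + (1 / real (Suc m)) *\<^sub>R (\<Sum>k\<in>K. k) \<in> strict_cone K" for m
    unfolding strict_cone_def by (intro CollectI exI[of _ "\<lambda>k. l k + 1 / real (Suc m)"] conjI)
  moreover have "(\<lambda>m. h + (1 / real (Suc m)) *\<^sub>R (\<Sum>k\<in>K. k)) \<longlonglongrightarrow> h + 0 *\<^sub>R (\<Sum>k\<in>K. k)"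
    by (intro tendsto_intros LIMSEQ_inverse_real_of_nat[unfolded inverse_eq_divide])
  ultimately have "\<exists>x. (\<forall>m. x m \<in> strict_cone K) \<and> x \<longlonglongrightarrow> h + 0 *\<^sub>R (\<Sum>k\<in>K. k)"
    by (intro exI[of _ "\<lambda>m. h + (1 / real (Suc m)) *\<^sub>R (\<Sum>k\<in>K. k)"]) blast
  then show ?thesis by (simp add: closure_sequential)
qed

lemma sum_scaleR_unique:
  fixes K :: "'a::real_vector set"
  assumes "finite K" "independent K" "(\<Sum>k\<in>K. a k *\<^sub>R k) = (\<Sum>k\<in>K. b k *\<^sub>R k)" "k \<in> K"
  shows "a k = b k"
proof -
  have "(\<Sum>k\<in>K. (a k - b k) *\<^sub>R k) = 0"
    using assms(3) by (simp add: scaleR_diff_left sum_subtractf)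
  then have "a k - b k = 0" by (rule independentD[OF assms(2,1) order_refl _ assms(4)])
  then show ?thesis by simp
qed

text \<open>The inverse sends \<open>\<Sum> l\<^sub>k k\<close> to the pair given by \<open>n\<^sub>k = \<lceil>l\<^sub>k\<rceil>\<close> and \<open>h = \<Sum> (n\<^sub>k - l\<^sub>k) k\<close>.\<close>

lemma strict_cone_lattice_bij:
  fixes K :: "(real ^ 'n::finite) set"
  assumes fin: "finite K" and ind: "independent K" and int: "\<And>k. k \<in> K \<Longrightarrow> int_vec k"
  shows "bij_betw (\<lambda>(h, n). (\<Sum>k\<in>K. real (n k) *\<^sub>R k) - h)
    ({h \<in> half_open_box K. int_vec h} \<times> PiE K (\<lambda>_. {1..})) {x \<in> strict_cone K. int_vec x}"
  (is "bij_betw ?\<phi> (?H \<times> ?P) ?S")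
proof -
  have eq: "n k = nat \<lceil>l k\<rceil>" "\<And>k. k \<in> K \<Longrightarrow> c k = real (n k) - l k"
    if "\<forall>k\<in>K. 0 \<le> c k \<and> c k < 1" "(\<Sum>k\<in>K. real (n k) *\<^sub>R k) - (\<Sum>k\<in>K. c k *\<^sub>R k) = (\<Sum>k\<in>K. l k *\<^sub>R k)" "k \<in> K"
    for n :: "real ^ 'n \<Rightarrow> nat" and c l k
  proof -
    have *: "real (n k) - c k = l k" if "k \<in> K" for k
      by (rule sum_scaleR_unique[OF fin ind _ that])
         (use \<open>_ - _ = (\<Sum>k\<in>K. l k *\<^sub>R k)\<close> in \<open>simp add: scaleR_diff_left sum_subtractf\<close>)
    then show "c k = real (n k) - l k" if "k \<in> K" for k using that by force
    have "real (n k) - 1 < l k" "l k \<le> real (n k)" using *[OF that(3)] that(1,3) by force+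
    then have "\<lceil>l k\<rceil> = int (n k)" by (intro ceiling_unique) auto
    then show "n k = nat \<lceil>l k\<rceil>" by simp
  qed
  show ?thesis
    unfolding bij_betw_def
  proof (intro conjI)
    show "inj_on ?\<phi> (?H \<times> ?P)"
    proof (rule inj_onI, clarify)
      fix h n h' n' assume h: "h \<in> half_open_box K" "h' \<in> half_open_box K"
        and n: "n \<in> ?P" "n' \<in> ?P"
        and e: "(\<Sum>k\<in>K. real (n k) *\<^sub>R k) - h = (\<Sum>k\<in>K. real (n' k) *\<^sub>R k) - h'"
      obtain c where c: "\<forall>k\<in>K. 0 \<le> c k \<and> c k < 1" "h = (\<Sum>k\<in>K. c k *\<^sub>R k)"
        using h(1) unfolding half_open_box_def by blast
      obtain c' where c': "\<forall>k\<in>K. 0 \<le> c' k \<and> c' k < 1" "h' = (\<Sum>k\<in>K. c' k *\<^sub>R k)"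
        using h(2) unfolding half_open_box_def by blast
      define l where "l k = real (n k) - c k" for k
      have l: "(\<Sum>k\<in>K. real (n k) *\<^sub>R k) - (\<Sum>k\<in>K. c k *\<^sub>R k) = (\<Sum>k\<in>K. l k *\<^sub>R k)"
        by (simp add: l_def scaleR_diff_left sum_subtractf)
      have l': "(\<Sum>k\<in>K. real (n' k) *\<^sub>R k) - (\<Sum>k\<in>K. c' k *\<^sub>R k) = (\<Sum>k\<in>K. l k *\<^sub>R k)"
        using l e c(2) c'(2) by simp
      have "n k = n' k" if "k \<in> K" for k
        using eq(1)[OF c(1) l that] eq(1)[OF c'(1) l' that] by simp
      then have "n = n'" using n by (metis PiE_ext)
      then show "h = h' \<and> n = n'" using e by simp
    qed
    show "?\<phi> ` (?H \<times> ?P) = ?S"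
    proof (intro equalityI subsetI)
      fix x assume "x \<in> ?\<phi> ` (?H \<times> ?P)"
      then obtain h n where h: "h \<in> half_open_box K" "int_vec h" and n: "n \<in> ?P"
        and x: "x = (\<Sum>k\<in>K. real (n k) *\<^sub>R k) - h" by auto
      obtain c where c: "\<forall>k\<in>K. 0 \<le> c k \<and> c k < 1" "h = (\<Sum>k\<in>K. c k *\<^sub>R k)"
        using h(1) unfolding half_open_box_def by blast
      have "x = (\<Sum>k\<in>K. (real (n k) - c k) *\<^sub>R k)"
        by (simp add: x c(2) scaleR_diff_left sum_subtractf)
      moreover have "0 < real (n k) - c k" if "k \<in> K" for k
      proof -
        have "real (n k) \<ge> 1" using n that by (auto simp: PiE_iff)
        then show ?thesis using c(1) that by force
      qed
      ultimately have "x \<in> strict_cone K"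
        unfolding strict_cone_def by (intro CollectI exI[of _ "\<lambda>k. real (n k) - c k"]) auto
      moreover have "int_vec x"
        unfolding x using h(2) int by (intro int_vec_diff int_vec_sum int_vec_scale)
      ultimately show "x \<in> ?S" by simp
    next
      fix x assume x: "x \<in> ?S"
      then obtain l where l: "\<forall>k\<in>K. 0 < l k" "x = (\<Sum>k\<in>K. l k *\<^sub>R k)"
        unfolding strict_cone_def by blast
      define n where "n = restrict (\<lambda>k. nat \<lceil>l k\<rceil>) K"
      define h where "h = (\<Sum>k\<in>K. real (n k) *\<^sub>R k) - x"
      have nk: "real (n k) = of_int \<lceil>l k\<rceil>" "n k \<ge> 1" if "k \<in> K" for k
        using that l(1) by (auto simp: n_def nat_le_iff Suc_le_eq)
      have "h = (\<Sum>k\<in>K. (real (n k) - l k) *\<^sub>R k)"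
        by (simp add: h_def l(2) scaleR_diff_left sum_subtractf)
      moreover have "0 \<le> real (n k) - l k \<and> real (n k) - l k < 1" if "k \<in> K" for k
        using nk(1)[OF that] ceiling_correct[of "l k"] by linarith
      ultimately have "h \<in> half_open_box K"
        unfolding half_open_box_def by (intro CollectI exI[of _ "\<lambda>k. real (n k) - l k"]) auto
      moreover have "int_vec h"
        unfolding h_def using x int by (intro int_vec_diff int_vec_sum int_vec_scale) auto
      moreover have "n \<in> ?P" using nk(2) by (auto simp: n_def)
      moreover have "x = ?\<phi> (h, n)" by (simp add: h_def)
      ultimately show "x \<in> ?\<phi> ` (?H \<times> ?P)" by (intro image_eqI[of _ _ "(h, n)"]) auto
    qed
  qed
qed

lemma geometric_from_1_has_sum:
  assumes "norm (z :: complex) < 1"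
  shows "(\<lambda>m. z ^ m) abs_summable_on {1..}" "infsum (\<lambda>m. z ^ m) {1..} = z / (1 - z)"
proof -
  have s: "summable (\<lambda>m. norm (z ^ m))" using assms by (simp add: norm_power summable_geometric)
  have "((\<lambda>m. z ^ m) has_sum (1 / (1 - z))) UNIV"
    by (rule norm_summable_imp_has_sum[OF s geometric_sums[OF assms]])
  then have "((\<lambda>m. z ^ m) has_sum (1 / (1 - z) - (\<Sum>m\<in>{0}. z ^ m))) (UNIV - {0})"
    by (intro has_sum_Diff has_sum_finite) auto
  moreover have "1 / (1 - z) - (\<Sum>m\<in>{0}. z ^ m) = z / (1 - z)"
  proof -
    have "1 - z \<noteq> 0" using assms by auto
    then show ?thesis by (simp add: field_simps)
  qed
  moreover have "UNIV - {0 :: nat} = {1..}" by auto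
  ultimately show "infsum (\<lambda>m. z ^ m) {1..} = z / (1 - z)" by (simp add: infsumI)
  have "(\<lambda>m. norm (z ^ m)) summable_on UNIV"
    using s norm_summable_imp_summable_on[of "\<lambda>m. norm (z ^ m)"] by simp
  then show "(\<lambda>m. z ^ m) abs_summable_on {1..}" by (rule summable_on_subset_banach) simp
qed

lemma multi_geometric_from_1:
  fixes z :: "'a \<Rightarrow> complex"
  assumes fin: "finite K" and z: "\<And>k. k \<in> K \<Longrightarrow> norm (z k) < 1" "\<And>k. k \<in> K \<Longrightarrow> z k \<noteq> 0"
  shows "(\<lambda>n. \<Prod>k\<in>K. z k ^ n k) abs_summable_on PiE K (\<lambda>_. {1..})"
    and "infsum (\<lambda>n. \<Prod>k\<in>K. z k ^ n k) (PiE K (\<lambda>_. {1..})) = (\<Prod>k\<in>K. z k / (1 - z k))"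
proof -
  let ?y = "\<lambda>k. complex_of_real (norm (z k))"
  have ny: "norm (?y k) < 1" if "k \<in> K" for k using z(1)[OF that] by simp
  have "infsum (\<lambda>n. \<Prod>k\<in>K. ?y k ^ n k) (PiE K (\<lambda>_. {1..})) = (\<Prod>k\<in>K. infsum (\<lambda>m. ?y k ^ m) {1..})"
    by (rule infsum_prod_PiE_abs[OF fin geometric_from_1_has_sum(1)[OF ny]])
  also have "\<dots> = (\<Prod>k\<in>K. ?y k / (1 - ?y k))"
    by (rule prod.cong[OF refl geometric_from_1_has_sum(2)[OF ny]])
  \<comment> \<open>A nonzero \<open>infsum\<close> certifies summability, here of the norms; this
    is the purpose of assuming the \<open>z k\<close> to be nonzero.\<close>
  also have "\<dots> \<noteq> 0"
    using z fin by (auto simp: prod_zero_iff) (metis less_irrefl of_real_1 of_real_eq_iff)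
  finally have "(\<lambda>n. \<Prod>k\<in>K. ?y k ^ n k) summable_on PiE K (\<lambda>_. {1..})"
    using infsum_not_exists by blast
  then have "(\<lambda>n. norm (\<Prod>k\<in>K. ?y k ^ n k)) summable_on PiE K (\<lambda>_. {1..})"
    by (rule iffD1[OF summable_on_iff_abs_summable_on_complex])
  then show "(\<lambda>n. \<Prod>k\<in>K. z k ^ n k) abs_summable_on PiE K (\<lambda>_. {1..})"
    by (simp add: prod_norm[symmetric] norm_power)
  have "infsum (\<lambda>n. \<Prod>k\<in>K. z k ^ n k) (PiE K (\<lambda>_. {1..})) = (\<Prod>k\<in>K. infsum (\<lambda>m. z k ^ m) {1..})"
    by (rule infsum_prod_PiE_abs[OF fin geometric_from_1_has_sum(1)[OF z(1)]])
  also have "\<dots> = (\<Prod>k\<in>K. z k / (1 - z k))"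
    by (rule prod.cong[OF refl geometric_from_1_has_sum(2)[OF z(1)]])
  finally show "infsum (\<lambda>n. \<Prod>k\<in>K. z k ^ n k) (PiE K (\<lambda>_. {1..})) = (\<Prod>k\<in>K. z k / (1 - z k))" .
qed

text \<open>Lattice points are written with positive multiples of the generators and h subtracted;
  this is what gives the numerator and the denominator their positive exponents.\<close>

lemma strict_cone_exp_sum:
  fixes K :: "(real ^ 'n::finite) set" and W :: "real ^ 'n \<Rightarrow> complex"
  assumes fin: "finite K" and ind: "independent K" and int: "\<And>k. k \<in> K \<Longrightarrow> int_vec k"
    and lin: "linear W" and pos: "\<And>k. k \<in> K \<Longrightarrow> Re (W k) > 0"
  shows "(\<Sum>\<^sub>\<infinity>x\<in>{x \<in> strict_cone K. int_vec x}. exp (- W x))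
    = (\<Sum>h\<in>{h \<in> half_open_box K. int_vec h}. exp (W h)) / (\<Prod>k\<in>K. exp (W k) - 1)"
proof -
  let ?\<phi> = "\<lambda>(h, n). (\<Sum>k\<in>K. real (n k) *\<^sub>R k) - h"
  let ?H = "{h \<in> half_open_box K. int_vec h}" and ?P = "PiE K (\<lambda>_. {1..}) :: (real ^ 'n \<Rightarrow> nat) set"
  have W: "exp (- W ((\<Sum>k\<in>K. real (n k) *\<^sub>R k) - h)) = exp (W h) * (\<Prod>k\<in>K. exp (- W k) ^ n k)" for h n
  proof -
    have "W (real m *\<^sub>R k) = of_nat m * W k" for m k
      by (subst linear_scale[OF lin]) (simp add: scaleR_conv_of_real)
    then have "- W ((\<Sum>k\<in>K. real (n k) *\<^sub>R k) - h) = W h + (\<Sum>k\<in>K. of_nat (n k) * (- W k))"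
      using lin by (simp add: linear_diff linear_sum sum_negf)
    then show ?thesis using fin by (simp only: exp_add exp_sum exp_of_nat_mult)
  qed
  have z: "norm (exp (- W k)) < 1" if "k \<in> K" for k using pos[OF that] by simp
  have "(\<Sum>\<^sub>\<infinity>x\<in>{x \<in> strict_cone K. int_vec x}. exp (- W x)) = (\<Sum>\<^sub>\<infinity>x\<in>?H \<times> ?P. exp (- W (?\<phi> x)))"
    by (rule infsum_reindex_bij_betw[OF strict_cone_lattice_bij[OF fin ind int], symmetric])
  also have "\<dots> = (\<Sum>\<^sub>\<infinity>(h, n)\<in>?H \<times> ?P. exp (W h) * (\<Prod>k\<in>K. exp (- W k) ^ n k))"
    by (rule infsum_cong) (auto simp: W)
  also have "\<dots> = infsum (\<lambda>h. exp (W h)) ?H * infsum (\<lambda>n. \<Prod>k\<in>K. exp (- W k) ^ n k) ?P"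
    by (rule abs_summable_times(2)[OF _ multi_geometric_from_1(1)[OF fin z]])
       (use finite_half_open_box[OF fin] in auto)
  also have "infsum (\<lambda>n. \<Prod>k\<in>K. exp (- W k) ^ n k) ?P = (\<Prod>k\<in>K. exp (- W k) / (1 - exp (- W k)))"
    by (rule multi_geometric_from_1(2)[OF fin z]) auto
  also have "\<dots> = (\<Prod>k\<in>K. 1 / (exp (W k) - 1))"
    by (intro prod.cong refl) (simp add: exp_minus field_simps)
  finally show ?thesis using finite_half_open_box[OF fin] by (simp add: prod_dividef)
qed

section \<open>Triangulating a finitely generated cone\<close>

definition gcone :: "(real ^ 'n::finite) set \<Rightarrow> (real ^ 'n) set" where
  "gcone S = {\<Sum>k\<in>S. l k *\<^sub>R k | l. \<forall>k\<in>S. 0 \<le> l k}"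

lemma gconeI: "(\<And>k. k \<in> S \<Longrightarrow> 0 \<le> l k) \<Longrightarrow> (\<Sum>k\<in>S. l k *\<^sub>R k) \<in> gcone S"
  unfolding gcone_def by blast

lemma gconeE:
  assumes "x \<in> gcone S"
  obtains l where "x = (\<Sum>k\<in>S. l k *\<^sub>R k)" "\<And>k. k \<in> S \<Longrightarrow> 0 \<le> l k"
  using assms unfolding gcone_def by blast

lemma strict_coneI: "(\<And>k. k \<in> S \<Longrightarrow> 0 < l k) \<Longrightarrow> (\<Sum>k\<in>S. l k *\<^sub>R k) \<in> strict_cone S"
  unfolding strict_cone_def by blast

lemma strict_coneE:
  assumes "x \<in> strict_cone S"
  obtains l where "x = (\<Sum>k\<in>S. l k *\<^sub>R k)" "\<And>k. k \<in> S \<Longrightarrow> 0 < l k"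
  using assms unfolding strict_cone_def by blast

lemma gcone_add: "x \<in> gcone S \<Longrightarrow> y \<in> gcone S \<Longrightarrow> x + y \<in> gcone S"
proof (elim gconeE)
  fix l m assume "x = (\<Sum>k\<in>S. l k *\<^sub>R k)" "y = (\<Sum>k\<in>S. m k *\<^sub>R k)"
    "\<And>k. k \<in> S \<Longrightarrow> 0 \<le> l k" "\<And>k. k \<in> S \<Longrightarrow> 0 \<le> m k"
  then show ?thesis using gconeI[of S "\<lambda>k. l k + m k"] by (simp add: scaleR_add_left sum.distrib)
qed

lemma gcone_scale: "x \<in> gcone S \<Longrightarrow> 0 \<le> c \<Longrightarrow> c *\<^sub>R x \<in> gcone S"
proof (elim gconeE)
  fix l assume "x = (\<Sum>k\<in>S. l k *\<^sub>R k)" "\<And>k. k \<in> S \<Longrightarrow> 0 \<le> l k" "0 \<le> c"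
  then show ?thesis using gconeI[of S "\<lambda>k. c * l k"] by (simp add: scaleR_right.sum)
qed

lemma strict_cone_subset_gcone:
  assumes "finite S" "J \<subseteq> S"
  shows "strict_cone J \<subseteq> gcone S"
proof
  fix x assume "x \<in> strict_cone J"
  then obtain l where l: "x = (\<Sum>k\<in>J. l k *\<^sub>R k)" "\<And>k. k \<in> J \<Longrightarrow> 0 < l k" by (rule strict_coneE) blast
  have "x = (\<Sum>k\<in>S. (if k \<in> J then l k else 0) *\<^sub>R k)"
    unfolding l(1) using assms by (intro sum.mono_neutral_cong_left) auto
  then show "x \<in> gcone S" using gconeI[of S "\<lambda>k. if k \<in> J then l k else 0"] l(2) by force
qed

lemma gcone_generator: "finite S \<Longrightarrow> k \<in> S \<Longrightarrow> k \<in> gcone S"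
  using strict_cone_subset_gcone[of S "{k}"] strict_coneI[of "{k}" "\<lambda>_. 1"] by auto

text \<open>The predicate P covers closed cones (nonnegative coefficients) and open ones (positive
  coefficients) at once.\<close>

lemma combinations_insert:
  fixes P :: "real \<Rightarrow> bool" and S :: "'a::real_vector set"
  assumes "finite S" "y \<notin> S"
  shows "{\<Sum>k\<in>insert y S. l k *\<^sub>R k | l. \<forall>k\<in>insert y S. P (l k)}
    = {x + t *\<^sub>R y | x t. x \<in> {\<Sum>k\<in>S. l k *\<^sub>R k | l. \<forall>k\<in>S. P (l k)} \<and> P t}"
proof (intro equalityI subsetI)
  fix z assume "z \<in> {\<Sum>k\<in>insert y S. l k *\<^sub>R k | l. \<forall>k\<in>insert y S. P (l k)}"
  then obtain l where "z = (\<Sum>k\<in>insert y S. l k *\<^sub>R k)" "\<forall>k\<in>insert y S. P (l k)" by blast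
  then have "z = (\<Sum>k\<in>S. l k *\<^sub>R k) + l y *\<^sub>R y" "\<forall>k\<in>S. P (l k)" "P (l y)"
    using assms by auto
  then show "z \<in> {x + t *\<^sub>R y | x t. x \<in> {\<Sum>k\<in>S. l k *\<^sub>R k | l. \<forall>k\<in>S. P (l k)} \<and> P t}" by blast
next
  fix z assume "z \<in> {x + t *\<^sub>R y | x t. x \<in> {\<Sum>k\<in>S. l k *\<^sub>R k | l. \<forall>k\<in>S. P (l k)} \<and> P t}"
  then obtain l t where l: "z = (\<Sum>k\<in>S. l k *\<^sub>R k) + t *\<^sub>R y" "\<forall>k\<in>S. P (l k)" "P t" by blast
  have "(\<Sum>k\<in>S. (l(y := t)) k *\<^sub>R k) = (\<Sum>k\<in>S. l k *\<^sub>R k)" using assms by (intro sum.cong) auto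
  then have "z = (\<Sum>k\<in>insert y S. (l(y := t)) k *\<^sub>R k)" using assms l(1) by (simp add: add.commute)
  moreover have "\<forall>k\<in>insert y S. P ((l(y := t)) k)" using l(2,3) by simp
  ultimately show "z \<in> {\<Sum>k\<in>insert y S. l k *\<^sub>R k | l. \<forall>k\<in>insert y S. P (l k)}" by blast
qed

lemma gcone_insert:
  "finite S \<Longrightarrow> y \<notin> S \<Longrightarrow> gcone (insert y S) = {x + t *\<^sub>R y | x t. x \<in> gcone S \<and> 0 \<le> t}"
  unfolding gcone_def by (rule combinations_insert)

lemma strict_cone_insert:
  "finite S \<Longrightarrow> y \<notin> S \<Longrightarrow> strict_cone (insert y S) = {x + t *\<^sub>R y | x t. x \<in> strict_cone S \<and> 0 < t}"
  unfolding strict_cone_def by (rule combinations_insert)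

text \<open>Relative openness of the cone. It carries visibility from one point of a simplicial cone
  to all of its points.\<close>

lemma strict_cone_open_segment:
  assumes "finite J" "x \<in> strict_cone J" "x' \<in> strict_cone J"
  obtains e0 where "0 < e0" "\<And>e. 0 < e \<Longrightarrow> e < e0 \<Longrightarrow> x - e *\<^sub>R x' \<in> strict_cone J"
proof -
  obtain l where l: "x = (\<Sum>k\<in>J. l k *\<^sub>R k)" "\<And>k. k \<in> J \<Longrightarrow> 0 < l k"
    using assms(2) by (rule strict_coneE) blast
  obtain m where m: "x' = (\<Sum>k\<in>J. m k *\<^sub>R k)" "\<And>k. k \<in> J \<Longrightarrow> 0 < m k"
    using assms(3) by (rule strict_coneE) blast
  \<comment> \<open>The inserted 1 keeps the minimum meaningful when J is empty.\<close>
  define e0 where "e0 = Min (insert 1 ((\<lambda>k. l k / m k) ` J))"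
  have "0 < e0" unfolding e0_def using assms(1) l(2) m(2) by (subst Min_gr_iff) auto
  moreover have "x - e *\<^sub>R x' \<in> strict_cone J" if e: "0 < e" "e < e0" for e
  proof -
    have "0 < l k - e * m k" if "k \<in> J" for k
    proof -
      have "e0 \<le> l k / m k" unfolding e0_def using assms(1) that by (intro Min_le) auto
      then have "e < l k / m k" using e by simp
      then show ?thesis using m(2)[OF that] by (simp add: less_divide_eq)
    qed
    moreover have "x - e *\<^sub>R x' = (\<Sum>k\<in>J. (l k - e * m k) *\<^sub>R k)"
      by (simp add: l(1) m(1) scaleR_right.sum scaleR_diff_left sum_subtractf)
    ultimately show ?thesis using strict_coneI[of J "\<lambda>k. l k - e * m k"] by simp
  qed
  ultimately show ?thesis using that by blast
qed

lemma sigma_add: "sigma (x + y) = sigma x + sigma y"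
  by (simp add: sigma_def sum.distrib)

lemma sigma_scale: "sigma (c *\<^sub>R x) = c * sigma x"
  by (simp add: sigma_def sum_distrib_left)

lemma sigma_diff: "sigma (x - y) = sigma x - sigma y"
  by (simp add: sigma_def sum_subtractf)

lemma sigma_nonneg: "x \<in> orthant \<Longrightarrow> 0 \<le> sigma x"
  by (simp add: sigma_def orthant_def sum_nonneg)

lemma sigma_pos:
  assumes "x \<in> orthant" "x \<noteq> 0"
  shows "0 < sigma x"
proof -
  obtain i where "x $ i \<noteq> 0" using assms(2) by (auto simp: vec_eq_iff)
  then have "0 < x $ i" using assms(1) by (simp add: orthant_def order.strict_iff_order)
  also have "x $ i \<le> sigma x"
    unfolding sigma_def using assms(1) by (intro member_le_sum) (auto simp: orthant_def)
  finally show ?thesis .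
qed

lemma continuous_sigma: "continuous_on UNIV sigma"
  unfolding sigma_def[abs_def] by (intro continuous_intros)

lemma gcone_orthant: "S \<subseteq> orthant \<Longrightarrow> gcone S \<subseteq> orthant"
  by (auto simp: gcone_def orthant_def subset_iff intro!: sum_nonneg mult_nonneg_nonneg)

text \<open>A sum of a closed cone and a ray need not be closed in general. Here everything lies in
  the orthant, so \<sigma> bounds the coefficient of y along a convergent sequence, and a
  subsequence of the coefficients converges.\<close>

lemma closed_gcone:
  assumes "finite S" "S \<subseteq> orthant - {0}"
  shows "closed (gcone S)"
  using assms
proof (induction S rule: finite_induct)
  case empty
  then show ?case by (simp add: gcone_def)
next
  case (insert y S)
  have y: "y \<in> orthant" "0 < sigma y" using insert.prems sigma_pos by auto
  show ?case
    unfolding closed_sequential_limits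
  proof (intro allI impI)
    fix u x assume u: "(\<forall>n. u n \<in> gcone (insert y S)) \<and> u \<longlonglongrightarrow> x"
    then have "\<forall>n. \<exists>z t. u n = z + t *\<^sub>R y \<and> z \<in> gcone S \<and> 0 \<le> t"
      unfolding gcone_insert[OF insert.hyps] by blast
    then obtain z t where zt: "\<And>n. u n = z n + t n *\<^sub>R y" "\<And>n. z n \<in> gcone S" "\<And>n. 0 \<le> t n" by metis
    have "(\<lambda>n. sigma (u n)) \<longlonglongrightarrow> sigma x"
      using u continuous_sigma by (auto intro: continuous_on_tendsto_compose)
    then have "Bseq (\<lambda>n. sigma (u n))" by (rule convergent_imp_Bseq[OF convergentI])
    then obtain B where B: "\<And>n. \<bar>sigma (u n)\<bar> \<le> B" unfolding Bseq_def by auto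
    have "t n \<in> {0..B / sigma y}" for n
    proof -
      have "0 \<le> sigma (z n)" using zt(2)[of n] gcone_orthant insert.prems sigma_nonneg by blast
      then have "t n * sigma y \<le> B" using B[of n] by (simp add: zt(1) sigma_add sigma_scale)
      then show ?thesis using zt(3) y(2) by (simp add: le_divide_eq)
    qed
    then obtain t0 r where r: "t0 \<in> {0..B / sigma y}" "strict_mono r" "(t \<circ> r) \<longlonglongrightarrow> t0"
      using compact_Icc[of 0 "B / sigma y"] unfolding compact_def by metis
    have "(u \<circ> r) \<longlonglongrightarrow> x" using u r(2) LIMSEQ_subseq_LIMSEQ by blast
    then have "(\<lambda>n. (u \<circ> r) n - (t \<circ> r) n *\<^sub>R y) \<longlonglongrightarrow> x - t0 *\<^sub>R y"
      using r(3) by (intro tendsto_intros)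
    moreover have "(u \<circ> r) n - (t \<circ> r) n *\<^sub>R y \<in> gcone S" for n by (simp add: zt)
    moreover have "closed (gcone S)" using insert by simp
    ultimately have "x - t0 *\<^sub>R y \<in> gcone S"
      using closed_sequentially[of "gcone S" "\<lambda>n. (u \<circ> r) n - (t \<circ> r) n *\<^sub>R y"] by blast
    moreover have "x = (x - t0 *\<^sub>R y) + t0 *\<^sub>R y" "0 \<le> t0" using r(1) by auto
    ultimately show "x \<in> gcone (insert y S)" unfolding gcone_insert[OF insert.hyps] by blast
  qed
qed

text \<open>The placing triangulation: adding a generator \<open>y\<close> keeps all old cones and adds the
  cones over those old cones \<open>J\<close> that are visible from \<open>y\<close>, in the sense that moving from \<open>J\<close> in
  the direction \<open>y\<close> leaves the old cone at once.\<close>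

lemma gcone_triangulation:
  fixes S :: "(real ^ 'n::finite) set"
  assumes "finite S" "S \<subseteq> orthant - {0}"
  shows "\<exists>\<K>. finite \<K> \<and> (\<forall>K\<in>\<K>. K \<subseteq> S \<and> independent K) \<and> disjoint_family_on strict_cone \<K>
    \<and> (\<Union>K\<in>\<K>. strict_cone K) = gcone S"
  using assms
proof (induction S rule: finite_induct)
  case empty
  have "strict_cone {} = (gcone {} :: (real ^ 'n) set)" by (simp add: strict_cone_def gcone_def)
  then show ?case by (intro exI[of _ "{{}}"]) (auto simp: disjoint_family_on_def independent_empty)
next
  case (insert y S)
  then obtain \<K> where \<K>: "finite \<K>" "\<And>K. K \<in> \<K> \<Longrightarrow> K \<subseteq> S" "\<And>K. K \<in> \<K> \<Longrightarrow> independent K"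
    "\<And>K K'. K \<in> \<K> \<Longrightarrow> K' \<in> \<K> \<Longrightarrow> K \<noteq> K' \<Longrightarrow> strict_cone K \<inter> strict_cone K' = {}"
    "(\<Union>K\<in>\<K>. strict_cone K) = gcone S"
    unfolding disjoint_family_on_def by (metis insert_subset subset_insertI2 insert.prems)
  define vis where "vis J \<longleftrightarrow> (\<forall>x\<in>strict_cone J. \<forall>s>0. x + s *\<^sub>R y \<notin> gcone S)" for J
  let ?N = "insert y ` {J \<in> \<K>. vis J}"
  have fJ: "finite J" "y \<notin> J" if "J \<in> \<K>" for J
    using \<K>(2)[OF that] insert.hyps finite_subset by auto
  have sc: "strict_cone (insert y J) = {x + t *\<^sub>R y | x t. x \<in> strict_cone J \<and> 0 < t}" if "J \<in> \<K>" for J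
    by (rule strict_cone_insert[OF fJ[OF that]])
  have sub: "strict_cone J \<subseteq> gcone S" if "J \<in> \<K>" for J using \<K>(5) that by blast
  have indep: "independent (insert y J)" if J: "J \<in> \<K>" "vis J" for J
  proof -
    have "y \<notin> span J"
    proof
      assume "y \<in> span J"
      then obtain b where b: "y = (\<Sum>k\<in>J. b k *\<^sub>R k)" using fJ(1)[OF J(1)] by (auto simp: span_finite)
      \<comment> \<open>M exceeds every coefficient of y in absolute value, so a point with all
        coefficients M stays in the cone of J when y is added, against visibility.\<close>
      define M where "M = (\<Sum>k\<in>J. \<bar>b k\<bar>) + 1"
      have bM: "\<bar>b k\<bar> < M" if "k \<in> J" for k
        using member_le_sum[of k J "\<lambda>k. \<bar>b k\<bar>"] fJ(1)[OF J(1)] that by (simp add: M_def)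
      have x: "(\<Sum>k\<in>J. M *\<^sub>R k) \<in> strict_cone J" by (rule strict_coneI) (use bM in force)
      have "(\<Sum>k\<in>J. M *\<^sub>R k) + 1 *\<^sub>R y = (\<Sum>k\<in>J. (M + b k) *\<^sub>R k)"
        by (simp add: b scaleR_add_left sum.distrib)
      also have "\<dots> \<in> strict_cone J" by (rule strict_coneI) (use bM in force)
      finally show False using J(2) x sub[OF J(1)] unfolding vis_def by (metis subsetD zero_less_one)
    qed
    then show ?thesis using \<K>(3)[OF J(1)] by (simp add: independent_insertI)
  qed
  have dis: "strict_cone A \<inter> strict_cone B = {}" if AB: "A \<in> \<K> \<union> ?N" "B \<in> \<K> \<union> ?N" "A \<noteq> B" for A B
  proof -
    have old_new: "strict_cone K \<inter> strict_cone (insert y J) = {}" if "K \<in> \<K>" "J \<in> \<K>" "vis J" for K J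
      using sub[OF that(1)] that(3) unfolding sc[OF that(2)] vis_def by blast
    have new_new: "strict_cone (insert y J) \<inter> strict_cone (insert y J') = {}"
      if J: "J \<in> \<K>" "vis J" "J' \<in> \<K>" "vis J'" "J \<noteq> J'" for J J'
    proof (rule ccontr)
      assume "strict_cone (insert y J) \<inter> strict_cone (insert y J') \<noteq> {}"
      then obtain x s x' s' where e: "x + s *\<^sub>R y = x' + s' *\<^sub>R y"
        "x \<in> strict_cone J" "x' \<in> strict_cone J'" unfolding sc[OF J(1)] sc[OF J(3)] by blast
      \<comment> \<open>If s > s', a positive multiple of y would lead from x to a point x' of the
        old cone, which the visibility of J forbids; likewise for J'.\<close>
      have "x + (s - s') *\<^sub>R y = x'" "x' + (s' - s) *\<^sub>R y = x"
        using e(1) by (simp_all add: algebra_simps)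
      then have "\<not> s > s'" "\<not> s' > s"
        using J(2,4) e(2,3) sub[OF J(1)] sub[OF J(3)] unfolding vis_def
        by (metis diff_gt_0_iff_gt subsetD)+
      then have "x = x'" using e(1) by simp
      then show False using e(2,3) \<K>(4)[OF J(1,3,5)] by blast
    qed
    consider "A \<in> \<K>" "B \<in> \<K>" | J where "A \<in> \<K>" "J \<in> \<K>" "vis J" "B = insert y J"
      | J where "B \<in> \<K>" "J \<in> \<K>" "vis J" "A = insert y J"
      | J J' where "J \<in> \<K>" "vis J" "J' \<in> \<K>" "vis J'" "A = insert y J" "B = insert y J'"
      using AB(1,2) by blast
    then show ?thesis
    proof cases
      case 1
      then show ?thesis using \<K>(4) AB(3) by blast
    next
      case 2
      then show ?thesis using old_new by blast
    next
      case 3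
      then show ?thesis using old_new by blast
    next
      case 4
      then show ?thesis using new_new AB(3) by blast
    qed
  qed
  have union: "(\<Union>K\<in>\<K> \<union> ?N. strict_cone K) = gcone (insert y S)"
  proof (intro equalityI subsetI)
    fix z assume "z \<in> (\<Union>K\<in>\<K> \<union> ?N. strict_cone K)"
    then obtain K where K: "K \<in> \<K> \<union> ?N" "z \<in> strict_cone K" by blast
    have "K \<subseteq> insert y S" using K(1) \<K>(2) by blast
    then show "z \<in> gcone (insert y S)"
      using K(2) strict_cone_subset_gcone[of "insert y S" K] insert.hyps by auto
  next
    fix z assume z: "z \<in> gcone (insert y S)"
    \<comment> \<open>The amounts of y that can be removed from z with the rest in the old cone. The
      least one is attained because that cone is closed. If it is 0, z is an old point; otherwise
      minimality makes the cone J that contains the rest visible.\<close>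
    let ?T = "{t. 0 \<le> t \<and> z - t *\<^sub>R y \<in> gcone S}"
    have "closed ?T"
    proof -
      have "closed (gcone S)" using closed_gcone[OF insert.hyps(1)] insert.prems by simp
      then have "closed ((\<lambda>t. z - t *\<^sub>R y) -` gcone S)"
        by (intro continuous_closed_vimage) (auto intro!: continuous_intros)
      moreover have "?T = {0..} \<inter> (\<lambda>t. z - t *\<^sub>R y) -` gcone S" by auto
      ultimately show ?thesis by (metis closed_Int closed_atLeast)
    qed
    moreover have "?T \<noteq> {}" using z unfolding gcone_insert[OF insert.hyps] by force
    moreover have "bdd_below ?T" by (rule bdd_belowI[of _ 0]) simp
    ultimately have t: "Inf ?T \<in> ?T" by (intro closed_contains_Inf)
    define t where "t = Inf ?T"
    have tmin: "t \<le> s" if "s \<in> ?T" for s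
      unfolding t_def using that \<open>bdd_below ?T\<close> by (rule cInf_lower)
    have t0: "0 \<le> t" and "z - t *\<^sub>R y \<in> gcone S" using t unfolding t_def by auto
    then obtain J where J: "J \<in> \<K>" "z - t *\<^sub>R y \<in> strict_cone J" unfolding \<K>(5)[symmetric] by blast
    show "z \<in> (\<Union>K\<in>\<K> \<union> ?N. strict_cone K)"
    proof (cases "t = 0")
      case True
      then show ?thesis using J by auto
    next
      case False
      then have tp: "0 < t" using t0 by simp
      have "vis J"
        unfolding vis_def
      proof (intro ballI allI impI notI)
        fix x' s assume x': "x' \<in> strict_cone J" "0 < s" "x' + s *\<^sub>R y \<in> gcone S"
        obtain e0 where e0: "0 < e0" "\<And>e. 0 < e \<Longrightarrow> e < e0 \<Longrightarrow> (z - t *\<^sub>R y) - e *\<^sub>R x' \<in> strict_cone J"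
          using strict_cone_open_segment[OF fJ(1)[OF J(1)] J(2) x'(1)] by blast
        \<comment> \<open>The bound \<open>e0\<close> keeps the point in the cone of J after
          subtracting e x', and e s <= t keeps t - e s nonnegative. Then t - e s lies in
          \<open>?T\<close>, against minimality.\<close>
        define e where "e = min (e0 / 2) (t / s)"
        have e: "0 < e" "e < e0" "e * s \<le> t"
          using e0(1) tp x'(2) by (auto simp: e_def min_def field_simps)
        have "(z - t *\<^sub>R y) - e *\<^sub>R x' + e *\<^sub>R (x' + s *\<^sub>R y) \<in> gcone S"
          by (rule gcone_add[OF subsetD[OF sub[OF J(1)] e0(2)[OF e(1,2)]] gcone_scale[OF x'(3)]])
             (use e(1) in simp)
        also have "(z - t *\<^sub>R y) - e *\<^sub>R x' + e *\<^sub>R (x' + s *\<^sub>R y) = z - (t - e * s) *\<^sub>R y"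
          by (simp add: algebra_simps)
        finally have "t - e * s \<in> ?T" using e(3) by simp
        then have "t \<le> t - e * s" by (rule tmin)
        then show False using e(1) x'(2) by (simp add: mult_le_0_iff)
      qed
      moreover have "z \<in> strict_cone (insert y J)"
        unfolding sc[OF J(1)] using J(2) tp by (intro CollectI exI[of _ "z - t *\<^sub>R y"] exI[of _ t]) simp
      ultimately show ?thesis using J(1) by blast
    qed
  qed
  show ?case
  proof (intro exI conjI)
    show "finite (\<K> \<union> ?N)" using \<K>(1) by simp
    show "\<forall>K\<in>\<K> \<union> ?N. K \<subseteq> insert y S \<and> independent K" using \<K>(2,3) indep by blast
    show "disjoint_family_on strict_cone (\<K> \<union> ?N)" unfolding disjoint_family_on_def using dis by blast
  qed (rule union)
qed

section \<open>Primitive generators of rational polyhedral cones\<close>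

text \<open>Expand the coordinates of \<open>y\<close> in a \<open>\<rat>\<close>-basis of their \<open>\<rat>\<close>-linear span: the coefficient
  vectors are rational and satisfy every rational linear relation that \<open>y\<close> satisfies.\<close>

lemma rational_kernel_vector:
  fixes y :: "real ^ 'n::finite"
  assumes y: "y \<noteq> 0" and T: "\<And>v. v \<in> T \<Longrightarrow> int_vec v \<and> v \<bullet> y = 0"
  shows "\<exists>q. q \<noteq> 0 \<and> (\<forall>i. q $ i \<in> \<rat>) \<and> (\<forall>v\<in>T. v \<bullet> q = 0)"
proof -
  interpret Q: vector_space "\<lambda>(r :: rat) (x :: real). of_rat r * x"
    by unfold_locales (auto simp: algebra_simps of_rat_add of_rat_mult)
  obtain B where B: "B \<subseteq> range (\<lambda>i. y $ i)" "Q.independent B" "range (\<lambda>i. y $ i) \<subseteq> Q.span B"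
    by (rule Q.maximal_independent_subset)
  have fB: "finite B" by (rule finite_subset[OF B(1)]) simp
  have "\<forall>i. \<exists>u. y $ i = (\<Sum>b\<in>B. of_rat (u b) * b)"
  proof
    fix i
    have "y $ i \<in> Q.span B" using B(3) by (rule subsetD) simp
    then have "y $ i \<in> range (\<lambda>u. \<Sum>b\<in>B. of_rat (u b) * b)" by (simp only: Q.span_finite[OF fB])
    then show "\<exists>u. y $ i = (\<Sum>b\<in>B. of_rat (u b) * b)" by (simp only: image_iff) simp
  qed
  then obtain r where r: "\<And>i. y $ i = (\<Sum>b\<in>B. of_rat (r i b) * b)" by metis
  define q where "q b = (\<chi> i. real_of_rat (r i b))" for b
  have ker: "v \<bullet> q b = 0" if v: "v \<in> T" and b: "b \<in> B" for v b
  proof -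
    have "\<forall>i. \<exists>m. v $ i = of_int m" using T[OF v] by (auto simp: int_vec_def Ints_def image_iff)
    then obtain m where m: "\<And>i. v $ i = of_int (m i)" by metis
    have "(\<Sum>b\<in>B. of_rat (\<Sum>i\<in>UNIV. of_int (m i) * r i b) * b)
        = (\<Sum>b\<in>B. \<Sum>i\<in>UNIV. of_int (m i) * (of_rat (r i b) * b))"
      by (simp add: of_rat_sum of_rat_mult sum_distrib_right mult.assoc)
    also have "\<dots> = (\<Sum>i\<in>UNIV. v $ i * y $ i)"
      unfolding r m sum_distrib_left by (rule sum.swap)
    also have "\<dots> = 0" using T[OF v] by (simp add: inner_vec_def)
    finally have "(\<Sum>i\<in>UNIV. of_int (m i) * r i b) = 0"
      using Q.independentD[OF B(2) fB order_refl _ b, of "\<lambda>b. \<Sum>i\<in>UNIV. of_int (m i) * r i b"] by blast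
    moreover have "v \<bullet> q b = of_rat (\<Sum>i\<in>UNIV. of_int (m i) * r i b)"
      by (simp add: inner_vec_def q_def m of_rat_sum of_rat_mult)
    ultimately show ?thesis by simp
  qed
  have "\<exists>b\<in>B. q b \<noteq> 0"
  proof (rule ccontr)
    assume "\<not> (\<exists>b\<in>B. q b \<noteq> 0)"
    then have "r i b = 0" if "b \<in> B" for i b using that by (auto simp: q_def vec_eq_iff)
    then have "y $ i = 0" for i by (simp add: r)
    then show False using y by (simp add: vec_eq_iff)
  qed
  then obtain b where "b \<in> B" "q b \<noteq> 0" by blast
  moreover have "q b $ i \<in> \<rat>" for i by (simp add: q_def)
  ultimately show ?thesis using ker by blast
qed

lemma primitive_multiple:
  fixes q :: "real ^ 'n::finite"
  assumes q: "q \<noteq> 0" "\<And>i. q $ i \<in> \<rat>"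
  shows "\<exists>c>0. primitive (c *\<^sub>R q)"
proof -
  have "\<forall>i. \<exists>a b. q $ i = of_int a / of_int b \<and> b > 0"
    using q(2) by (metis Rats_cases')
  then obtain a b where ab: "\<And>i. q $ i = of_int (a i) / of_int (b i)" "\<And>i. b i > 0" by metis
  define D where "D = (\<Prod>i\<in>UNIV. b i)"
  have D: "D > 0" unfolding D_def using ab(2) by (intro prod_pos) auto
  define m where "m i = a i * (\<Prod>j\<in>UNIV - {i}. b j)" for i
  have m: "of_int D * q $ i = of_int (m i)" for i
  proof -
    have "D = b i * (\<Prod>j\<in>UNIV - {i}. b j)" unfolding D_def by (rule prod.remove) auto
    then show ?thesis using ab(2)[of i] by (simp add: ab(1) m_def)
  qed
  define g where "g = Gcd (range m)"
  have "g \<noteq> 0"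
  proof
    assume "g = 0"
    then have "m i = 0" for i by (auto simp: g_def)
    then have "q $ i = 0" for i using m[of i] D by simp
    then show False using q(1) by (simp add: vec_eq_iff)
  qed
  then have g: "g > 0" by (simp add: g_def order.not_eq_order_implies_strict Gcd_int_greater_eq_0)
  have "\<forall>i. \<exists>k. m i = g * k" unfolding g_def by (metis Gcd_dvd dvdE rangeI)
  then obtain m' where m': "\<And>i. m i = g * m' i" by metis
  have "g = Gcd (range m)" by (rule g_def)
  also have "range m = (*) g ` range m'" by (simp add: image_image m')
  also have "Gcd \<dots> = normalize (g * Gcd (range m'))" by (rule Gcd_mult)
  finally have "Gcd (range m') = 1"
    using g by (simp add: abs_mult Gcd_int_greater_eq_0)
  moreover have "(of_int D / of_int g) *\<^sub>R q = (\<chi> i. of_int (m' i))"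
    using m m' g by (simp add: vec_eq_iff field_simps)
  ultimately have "primitive ((of_int D / of_int g) *\<^sub>R q)"
    unfolding primitive_def by (intro exI[of _ "\<chi> i. m' i"]) simp
  moreover have "0 < real_of_int D / of_int g" using D g by simp
  ultimately show ?thesis by blast
qed

lemma primitive_nonzero: "primitive k \<Longrightarrow> k \<noteq> 0"
proof
  assume "primitive k" "k = 0"
  then obtain m :: "int ^ 'a" where m: "\<And>i. m $ i = 0" "Gcd (range (\<lambda>i. m $ i)) = 1"
    unfolding primitive_def by (auto simp: vec_eq_iff)
  then show False by simp
qed

lemma primitive_int_vec: "primitive k \<Longrightarrow> int_vec k"
  by (auto simp: primitive_def int_vec_def)

lemma primitive_scale_unique:
  fixes x :: "real ^ 'n::finite"
  assumes "primitive x" "primitive (c *\<^sub>R x)" "c > 0"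
  shows "c = 1"
proof -
  obtain m :: "int ^ 'n" where m: "x = (\<chi> i. of_int (m $ i))" "Gcd (range (\<lambda>i. m $ i)) = 1"
    using assms(1) unfolding primitive_def by blast
  obtain m' :: "int ^ 'n" where m': "c *\<^sub>R x = (\<chi> i. of_int (m' $ i))" "Gcd (range (\<lambda>i. m' $ i)) = 1"
    using assms(2) unfolding primitive_def by blast
  have e: "c * of_int (m $ i) = of_int (m' $ i)" for i
    using arg_cong[OF m'(1), of "\<lambda>v. v $ i"] by (simp add: m(1))
  have "x \<noteq> 0" using primitive_nonzero[OF assms(1)] .
  then obtain i0 where i0: "m $ i0 \<noteq> 0" by (auto simp: m(1) vec_eq_iff)
  define a b where "a = m $ i0" and "b = m' $ i0"
  have cab: "c * of_int a = of_int b" using e[of i0] by (simp add: a_def b_def)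
  \<comment> \<open>Cross multiplication removes the real factor c, so that greatest common divisors
    can be compared over the integers.\<close>
  have ab: "b * m $ i = a * m' $ i" for i
  proof -
    have "real_of_int (b * m $ i) = of_int (a * m' $ i)"
      using e[of i] cab by (simp add: mult_ac flip: e cab)
    then show ?thesis by (simp only: of_int_eq_iff)
  qed
  have "normalize (b * Gcd (range (\<lambda>i. m $ i))) = Gcd ((*) b ` range (\<lambda>i. m $ i))"
    by (rule Gcd_mult[symmetric])
  also have "(*) b ` range (\<lambda>i. m $ i) = (*) a ` range (\<lambda>i. m' $ i)" by (simp add: image_image ab)
  also have "Gcd \<dots> = normalize (a * Gcd (range (\<lambda>i. m' $ i)))" by (rule Gcd_mult)
  finally have "\<bar>b\<bar> = \<bar>a\<bar>" by (simp add: m(2) m'(2))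
  then have "\<bar>c\<bar> * \<bar>real_of_int a\<bar> = \<bar>real_of_int a\<bar>"
    using cab by (metis abs_mult of_int_abs)
  then show ?thesis using assms(3) i0 by (simp add: a_def)
qed

definition vcone :: "(real ^ 'n::finite) set \<Rightarrow> (real ^ 'n) set" where
  "vcone V = {x. \<forall>v\<in>V. 0 \<le> v \<bullet> x}"

definition vtight :: "(real ^ 'n::finite) set \<Rightarrow> real ^ 'n \<Rightarrow> (real ^ 'n) set" where
  "vtight V x = {v \<in> V. v \<bullet> x = 0}"

text \<open>An edge of the cone: the inequalities tight at y, read as equations, have only the
  multiples of y as solutions.\<close>

definition extreme :: "(real ^ 'n::finite) set \<Rightarrow> real ^ 'n \<Rightarrow> bool" where
  "extreme V y \<longleftrightarrow> y \<in> vcone V \<and> y \<noteq> 0 \<and> (\<forall>z. (\<forall>v\<in>vtight V y. v \<bullet> z = 0) \<longrightarrow> (\<exists>c. z = c *\<^sub>R y))"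

definition vgens :: "(real ^ 'n::finite) set \<Rightarrow> (real ^ 'n) set" where
  "vgens V = {y. extreme V y \<and> primitive y}"

text \<open>Having the unit vectors among the inequalities keeps the cone in the orthant. So it
  contains no line, which is what allows it to be generated by its edges.\<close>

context
  fixes V :: "(real ^ 'n::finite) set"
  assumes finV: "finite V" and intV: "\<forall>v\<in>V. int_vec v" and axisV: "\<forall>i. axis i 1 \<in> V"
begin

lemma vcone_orthant: "vcone V \<subseteq> orthant"
proof
  fix x assume "x \<in> vcone V"
  then have "0 \<le> axis i 1 \<bullet> x" for i using axisV by (simp add: vcone_def)
  then show "x \<in> orthant" by (simp add: orthant_def inner_axis')
qed

lemma vtight_scale: "c \<noteq> 0 \<Longrightarrow> vtight V (c *\<^sub>R x) = vtight V x"
  by (simp add: vtight_def)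

lemma extreme_scale:
  assumes "extreme V y" "c > 0"
  shows "extreme V (c *\<^sub>R y)"
proof -
  have "c *\<^sub>R y \<in> vcone V" using assms by (auto simp: extreme_def vcone_def)
  moreover have "\<exists>d. z = d *\<^sub>R c *\<^sub>R y" if z: "\<forall>v\<in>vtight V y. v \<bullet> z = 0" for z
  proof -
    obtain e where "z = e *\<^sub>R y" using assms(1) z unfolding extreme_def by blast
    then show ?thesis using assms(2) by (intro exI[of _ "e / c"]) simp
  qed
  ultimately show ?thesis using assms by (auto simp: extreme_def vtight_scale)
qed

lemma extreme_primitive:
  assumes "extreme V y"
  obtains c k where "c > 0" "y = c *\<^sub>R k" "k \<in> vgens V"
proof -
  have y: "y \<in> vcone V" "y \<noteq> 0" using assms by (auto simp: extreme_def)
  obtain q where q: "q \<noteq> 0" "\<And>i. q $ i \<in> \<rat>" "\<And>v. v \<in> vtight V y \<Longrightarrow> v \<bullet> q = 0"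
    using rational_kernel_vector[OF y(2), of "vtight V y"] intV by (auto simp: vtight_def)
  obtain e where e: "q = e *\<^sub>R y" using assms q(3) unfolding extreme_def by blast
  have "e \<noteq> 0" using q(1) e by auto
  \<comment> \<open>The rational kernel vector is a multiple of y by extremality, possibly a
    negative one.\<close>
  define q' where "q' = (if e > 0 then q else - q)"
  have q': "q' = \<bar>e\<bar> *\<^sub>R y" "q' \<noteq> 0" "\<And>i. q' $ i \<in> \<rat>"
    using e q \<open>e \<noteq> 0\<close> by (auto simp: q'_def)
  obtain c where c: "c > 0" "primitive (c *\<^sub>R q')" using primitive_multiple[OF q'(2,3)] by blast
  define d where "d = c * \<bar>e\<bar>"
  have d: "d > 0" using c(1) \<open>e \<noteq> 0\<close> by (simp add: d_def)
  have "d *\<^sub>R y \<in> vgens V"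
    using extreme_scale[OF assms d] c(2) unfolding q'(1) by (simp add: vgens_def d_def)
  moreover have "y = (1 / d) *\<^sub>R (d *\<^sub>R y)" using d by simp
  moreover have "1 / d > 0" using d by simp
  ultimately show ?thesis using that by metis
qed

text \<open>A generator is determined by its set of tight inequalities: these fix it up to a factor,
  the orthant makes the factor positive, and primitivity makes it 1.\<close>

lemma finite_vgens: "finite (vgens V)"
proof (rule inj_on_finite[of "vtight V" "vgens V" "Pow V"])
  show "inj_on (vtight V) (vgens V)"
  proof (rule inj_onI)
    fix x y assume xy: "x \<in> vgens V" "y \<in> vgens V" "vtight V x = vtight V y"
    have "\<forall>v\<in>vtight V x. v \<bullet> y = 0" unfolding xy(3) by (simp add: vtight_def)
    then obtain c where c: "y = c *\<^sub>R x" using xy(1) unfolding vgens_def extreme_def by blast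
    have o: "x \<in> orthant" "y \<in> orthant" "x \<noteq> 0" "y \<noteq> 0"
      using xy(1,2) vcone_orthant by (auto simp: vgens_def extreme_def)
    have "c * sigma x = sigma y" by (simp add: c sigma_scale)
    then have "c > 0" using sigma_pos[OF o(1,3)] sigma_pos[OF o(2,4)] by (metis zero_less_mult_pos2)
    then have "c = 1" using primitive_scale_unique xy(1,2) c by (auto simp: vgens_def)
    then show "x = y" using c by simp
  qed
qed (auto simp: finV vtight_def)

text \<open>If \<open>x\<close> is not extreme, it lies between two points of the cone in a direction \<open>w\<close> with
  \<open>\<sigma>(w) = 0\<close>. Leaving the cone along \<open>\<plusminus>w\<close>, which happens since the cone lies in the orthant,
  makes a further inequality tight.\<close>

lemma vcone_step:
  assumes x: "x \<in> vcone V" and w: "w \<noteq> 0" "sigma w = 0" "\<And>v. v \<in> vtight V x \<Longrightarrow> v \<bullet> w = 0"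
  obtains t where "t > 0" "x + t *\<^sub>R w \<in> vcone V" "vtight V x \<subset> vtight V (x + t *\<^sub>R w)"
proof -
  let ?N = "{v \<in> V. v \<bullet> w < 0}"
  have "\<exists>i. w $ i < 0"
  proof (rule ccontr)
    assume "\<not> (\<exists>i. w $ i < 0)"
    then have "w \<in> orthant" by (auto simp: orthant_def not_less)
    then show False using sigma_pos w(1,2) by fastforce
  qed
  then obtain i where "w $ i < 0" by blast
  then have "axis i 1 \<in> ?N" using axisV by (simp add: inner_axis')
  then have ne: "?N \<noteq> {}" by blast
  have fin: "finite ?N" using finV by simp
  let ?r = "\<lambda>v. (v \<bullet> x) / (- (v \<bullet> w))"
  define t where "t = Min (?r ` ?N)"
  have "t \<in> ?r ` ?N" unfolding t_def using ne fin by (intro Min_in) auto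
  then obtain v0 where v0: "v0 \<in> V" "v0 \<bullet> w < 0" "t = ?r v0" by blast
  have vx: "0 < v \<bullet> x" if "v \<in> ?N" for v
  proof -
    have "v \<notin> vtight V x" using that w(3) by force
    then show ?thesis using that x by (auto simp: vtight_def vcone_def order.strict_iff_order)
  qed
  have t: "t > 0" using vx[of v0] v0 by (simp add: divide_pos_neg)
  have "0 \<le> v \<bullet> (x + t *\<^sub>R w)" if v: "v \<in> V" for v
  proof (cases "v \<bullet> w < 0")
    case True
    have "t \<le> ?r v" unfolding t_def using v True fin by (intro Min_le) auto
    then have "t * (- (v \<bullet> w)) \<le> v \<bullet> x"
      using True pos_le_divide_eq[of "- (v \<bullet> w)" t "v \<bullet> x"] by simp
    then show ?thesis by (simp add: inner_add_right)
  next
    case False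
    then show ?thesis using v x t by (simp add: inner_add_right vcone_def)
  qed
  then have "x + t *\<^sub>R w \<in> vcone V" by (simp add: vcone_def)
  moreover have "vtight V x \<subseteq> vtight V (x + t *\<^sub>R w)" using w(3) by (auto simp: vtight_def inner_add_right)
  moreover have "t * (v0 \<bullet> w) = - (v0 \<bullet> x)" using v0(2) by (simp add: v0(3))
  then have "v0 \<in> vtight V (x + t *\<^sub>R w)" using v0(1) by (simp add: vtight_def inner_add_right)
  moreover have "v0 \<notin> vtight V x" using v0(2) w(3)[of v0] by auto
  ultimately show ?thesis using that t by blast
qed

text \<open>Induction on the number of inequalities that are not tight at x. The set T remembers a
  face containing x, so that only generators on this face are used.\<close>

lemma vcone_gcone:
  assumes "x \<in> vcone V" "T \<subseteq> vtight V x"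
  shows "x \<in> gcone {y \<in> vgens V. T \<subseteq> vtight V y}"
  using assms
proof (induction "card (V - vtight V x)" arbitrary: x rule: less_induct)
  case less
  let ?G = "{y \<in> vgens V. T \<subseteq> vtight V y}"
  have finG: "finite ?G" using finite_vgens by simp
  have smaller: "x' \<in> gcone ?G" if "x' \<in> vcone V" "vtight V x \<subset> vtight V x'" for x'
  proof (rule less.hyps)
    show "card (V - vtight V x') < card (V - vtight V x)"
      using that finV by (intro psubset_card_mono) (auto simp: vtight_def)
  qed (use that less.prems in auto)
  consider "x = 0" | "x \<noteq> 0" "extreme V x" | "x \<noteq> 0" "\<not> extreme V x" by blast
  then show ?case
  proof cases
    case 1
    then show ?thesis using gconeI[of ?G "\<lambda>_. 0"] by simp
  next
    case 2
    obtain c k where c: "c > 0" "x = c *\<^sub>R k" "k \<in> vgens V" using extreme_primitive[OF 2(2)] .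
    have "k \<in> ?G" using c less.prems(2) vtight_scale[of c k] by auto
    then show ?thesis unfolding c(2) using c(1) gcone_generator[OF finG] by (intro gcone_scale) auto
  next
    case 3
    then obtain z where z: "\<forall>v\<in>vtight V x. v \<bullet> z = 0" "\<And>c. z \<noteq> c *\<^sub>R x"
      using less.prems(1) unfolding extreme_def by blast
    have sx: "sigma x > 0" using sigma_pos less.prems(1) vcone_orthant 3 by blast
    \<comment> \<open>Subtracting a multiple of x makes \<sigma> vanish, as
      \<open>vcone_step\<close> requires, and w is nonzero because z is no multiple of x.\<close>
    define w where "w = z - (sigma z / sigma x) *\<^sub>R x"
    have w: "w \<noteq> 0" "sigma w = 0"
      using z(2) sx by (auto simp: w_def sigma_diff sigma_scale)
    have wt: "v \<bullet> w = 0" if "v \<in> vtight V x" for v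
      using z(1) that by (auto simp: w_def inner_diff_right vtight_def)
    obtain t where t: "t > 0" "x + t *\<^sub>R w \<in> vcone V" "vtight V x \<subset> vtight V (x + t *\<^sub>R w)"
      by (rule vcone_step[OF less.prems(1) w wt])
    have "sigma (- w) = 0" using w(2) sigma_scale[of "-1" w] by simp
    then obtain s where s: "s > 0" "x + s *\<^sub>R (- w) \<in> vcone V" "vtight V x \<subset> vtight V (x + s *\<^sub>R (- w))"
      using vcone_step[OF less.prems(1), of "- w"] w(1) wt by auto
    \<comment> \<open>x is the convex combination of the two exit points in which the contributions
      of w cancel.\<close>
    have "(s / (s + t)) *\<^sub>R (x + t *\<^sub>R w) + (t / (s + t)) *\<^sub>R (x + s *\<^sub>R (- w)) \<in> gcone ?G"
      by (rule gcone_add[OF gcone_scale[OF smaller[OF t(2,3)]] gcone_scale[OF smaller[OF s(2,3)]]])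
         (use s(1) t(1) in auto)
    also have "(s / (s + t)) *\<^sub>R (x + t *\<^sub>R w) + (t / (s + t)) *\<^sub>R (x + s *\<^sub>R (- w))
        = (s / (s + t) + t / (s + t)) *\<^sub>R x"
      by (simp add: algebra_simps)
    also have "s / (s + t) + t / (s + t) = 1" using s(1) t(1) by (simp flip: add_divide_distrib)
    finally show ?thesis by simp
  qed
qed

lemma gcone_vcone: "S \<subseteq> vcone V \<Longrightarrow> gcone S \<subseteq> vcone V"
  by (auto simp: gcone_def vcone_def inner_sum_right subset_iff intro!: sum_nonneg mult_nonneg_nonneg)

text \<open>A positive combination of nonnegative numbers vanishes only if all of them do. So the
  tight set is constant on an open simplicial cone.\<close>

lemma vtight_strict_cone:
  assumes "finite J" "J \<subseteq> vcone V" "x \<in> strict_cone J"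
  shows "vtight V x = {v \<in> V. \<forall>y\<in>J. v \<bullet> y = 0}"
proof -
  obtain l where l: "x = (\<Sum>k\<in>J. l k *\<^sub>R k)" "\<And>k. k \<in> J \<Longrightarrow> 0 < l k"
    using assms(3) by (rule strict_coneE) blast
  have "v \<bullet> x = 0 \<longleftrightarrow> (\<forall>y\<in>J. v \<bullet> y = 0)" if v: "v \<in> V" for v
  proof -
    have "v \<bullet> x = (\<Sum>k\<in>J. l k * (v \<bullet> k))" by (simp add: l(1) inner_sum_right)
    also have "\<dots> = 0 \<longleftrightarrow> (\<forall>k\<in>J. l k * (v \<bullet> k) = 0)"
      by (rule sum_nonneg_eq_0_iff[OF assms(1)])
         (use less_imp_le[OF l(2)] assms(2) v in \<open>auto simp: vcone_def subset_iff intro!: mult_nonneg_nonneg\<close>)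
    also have "\<dots> \<longleftrightarrow> (\<forall>k\<in>J. v \<bullet> k = 0)" using l(2) by fastforce
    finally show ?thesis .
  qed
  then show ?thesis by (auto simp: vtight_def)
qed

text \<open>Triangulate the closed face and keep the open cones that meet its relative interior.
  Since tight sets are constant on open cones, the kept ones lie in it entirely.\<close>

lemma vcone_face_triangulation:
  assumes x: "x \<in> vcone V"
  shows "\<exists>\<K>. finite \<K> \<and> (\<forall>K\<in>\<K>. K \<subseteq> {y \<in> vgens V. vtight V x \<subseteq> vtight V y} \<and> independent K)
    \<and> disjoint_family_on strict_cone \<K> \<and> (\<Union>K\<in>\<K>. strict_cone K) = {z \<in> vcone V. vtight V z = vtight V x}"
proof -
  let ?G = "{y \<in> vgens V. vtight V x \<subseteq> vtight V y}"
  have finG: "finite ?G" using finite_vgens by simp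
  have Gv: "?G \<subseteq> vcone V" "?G \<subseteq> orthant - {0}"
    using vcone_orthant by (auto simp: vgens_def extreme_def)
  obtain \<K> where \<K>: "finite \<K>" "\<And>K. K \<in> \<K> \<Longrightarrow> K \<subseteq> ?G" "\<And>K. K \<in> \<K> \<Longrightarrow> independent K"
    "disjoint_family_on strict_cone \<K>" "(\<Union>K\<in>\<K>. strict_cone K) = gcone ?G"
    using gcone_triangulation[OF finG Gv(2)] by auto
  let ?F = "{z \<in> vcone V. vtight V z = vtight V x}"
  define \<K>' where "\<K>' = {K \<in> \<K>. strict_cone K \<inter> ?F \<noteq> {}}"
  have "(\<Union>K\<in>\<K>'. strict_cone K) = ?F"
  proof (intro equalityI subsetI)
    fix z assume "z \<in> (\<Union>K\<in>\<K>'. strict_cone K)"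
    then obtain K z' where K: "K \<in> \<K>" "z \<in> strict_cone K" "z' \<in> strict_cone K" "z' \<in> ?F"
      unfolding \<K>'_def by blast
    have fK: "finite K" "K \<subseteq> vcone V" using \<K>(2)[OF K(1)] finG Gv(1) finite_subset by blast+
    have "vtight V z = vtight V z'" using vtight_strict_cone[OF fK] K(2,3) by simp
    moreover have "z \<in> vcone V" using K(1,2) \<K>(5) gcone_vcone[OF Gv(1)] by blast
    ultimately show "z \<in> ?F" using K(4) by simp
  next
    fix z assume z: "z \<in> ?F"
    then have "z \<in> gcone ?G" using vcone_gcone[of z "vtight V x"] by simp
    then show "z \<in> (\<Union>K\<in>\<K>'. strict_cone K)" using z unfolding \<K>(5)[symmetric] \<K>'_def by blast
  qed
  moreover have "finite \<K>'" "\<forall>K\<in>\<K>'. K \<subseteq> ?G \<and> independent K" "disjoint_family_on strict_cone \<K>'"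
    using \<K> by (auto simp: \<K>'_def disjoint_family_on_def)
  ultimately show ?thesis by blast
qed

end

section \<open>Cells as faces of rational cones\<close>

text \<open>Comparing with a fixed exponent replaces the minimum by linear inequalities with integer
  normals.\<close>

lemma tight_ref_iff:
  assumes "finite \<Omega>" "\<omega>0 \<in> \<Omega>"
  shows "\<omega>0 \<in> tight \<Omega> z \<longleftrightarrow> (\<forall>\<omega>\<in>\<Omega>. 0 \<le> (exponent_vec \<omega> - exponent_vec \<omega>0) \<bullet> z)"
proof -
  have "Min ((\<lambda>\<omega>. z \<bullet> exponent_vec \<omega>) ` \<Omega>) \<le> z \<bullet> exponent_vec \<omega>0" using assms by auto
  then have "\<omega>0 \<in> tight \<Omega> z \<longleftrightarrow> z \<bullet> exponent_vec \<omega>0 \<le> Min ((\<lambda>\<omega>. z \<bullet> exponent_vec \<omega>) ` \<Omega>)"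
    using assms(2) by (auto simp: tight_def)
  also have "\<dots> \<longleftrightarrow> (\<forall>\<omega>\<in>\<Omega>. z \<bullet> exponent_vec \<omega>0 \<le> z \<bullet> exponent_vec \<omega>)"
    using assms by (subst Min_ge_iff) auto
  finally show ?thesis by (simp add: inner_diff_right inner_commute[of _ z])
qed

lemma tight_eq_ref:
  assumes "\<omega>0 \<in> tight \<Omega> z"
  shows "tight \<Omega> z = {\<omega> \<in> \<Omega>. (exponent_vec \<omega> - exponent_vec \<omega>0) \<bullet> z = 0}"
  using assms by (auto simp: tight_def inner_diff_right inner_commute[of _ z])

lemma int_vec_exponent_vec: "int_vec (exponent_vec \<omega>)"
  by (simp add: int_vec_def exponent_vec_def)

context
  fixes f :: "('n::finite, 'a::zero) mpolynomial ^ 't::finite" and g :: "('n, 'a) mpolynomial"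
  assumes nef: "map_keys f \<noteq> {}" and neg: "Poly_Mapping.keys g \<noteq> {}"
begin

text \<open>The generators are placed in \<open>ray_generators\<close>, by which the candidate real
  parts are defined, and in the closure of the cell, where the weight is linear.\<close>

lemma cell_triangulation:
  assumes "\<delta> \<in> Delta f g"
  shows "\<exists>\<K>. finite \<K> \<and> (\<forall>K\<in>\<K>. K \<subseteq> ray_generators f g \<inter> closure \<delta> \<and> independent K)
    \<and> disjoint_family_on strict_cone \<K> \<and> (\<Union>K\<in>\<K>. strict_cone K) = \<delta>"
proof -
  obtain \<kappa> where \<kappa>: "\<kappa> \<in> orthant" "\<delta> = cell f g \<kappa>" using assms unfolding Delta_eq[OF nef neg] by blast
  obtain \<omega>0 where \<omega>0: "\<omega>0 \<in> tight (map_keys f) \<kappa>" using tight_nonempty[OF finite_map_keys nef] by blast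
  obtain \<omega>1 where \<omega>1: "\<omega>1 \<in> tight (Poly_Mapping.keys g) \<kappa>" using tight_nonempty[OF finite_keys neg] by blast
  have \<omega>: "\<omega>0 \<in> map_keys f" "\<omega>1 \<in> Poly_Mapping.keys g" using \<omega>0 \<omega>1 by (auto simp: tight_def)
  \<comment> \<open>The inequalities say that the chosen exponents stay minimal for f and g and that
    the coordinates are nonnegative.\<close>
  define V where "V = (\<lambda>\<omega>. exponent_vec \<omega> - exponent_vec \<omega>0) ` map_keys f
    \<union> (\<lambda>\<omega>. exponent_vec \<omega> - exponent_vec \<omega>1) ` Poly_Mapping.keys g \<union> range (\<lambda>i. axis i 1)"
  have finV: "finite V" by (simp add: V_def finite_map_keys)
  have "int_vec (axis i 1 :: real ^ 'n)" for i by (simp add: int_vec_def axis_def)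
  then have intV: "\<forall>v\<in>V. int_vec v" unfolding V_def using int_vec_exponent_vec int_vec_diff by blast
  have axisV: "\<forall>i. axis i 1 \<in> V" by (simp add: V_def)
  note V = finV intV axisV
  have vc_iff: "z \<in> vcone V \<longleftrightarrow> z \<in> orthant \<and> \<omega>0 \<in> tight (map_keys f) z \<and> \<omega>1 \<in> tight (Poly_Mapping.keys g) z" for z
  proof -
    have "z \<in> orthant \<longleftrightarrow> (\<forall>i. 0 \<le> axis i 1 \<bullet> z)" by (simp add: orthant_def inner_axis')
    then show ?thesis
      unfolding tight_ref_iff[OF finite_map_keys \<omega>(1)] tight_ref_iff[OF finite_keys \<omega>(2)] vcone_def
      unfolding V_def by (auto simp: ball_Un)
  qed
  have face: "cell f g y = {z \<in> vcone V. vtight V z = vtight V y}" if y: "y \<in> vcone V" for y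
  proof -
    have yo: "y \<in> orthant" "\<omega>0 \<in> tight (map_keys f) y" "\<omega>1 \<in> tight (Poly_Mapping.keys g) y"
      using y vc_iff by auto
    have zc: "zero_coords z = {i. axis i 1 \<bullet> z = 0}" for z :: "real ^ 'n"
      by (simp add: zero_coords_def inner_axis')
    have "z \<in> cell f g y \<longleftrightarrow> z \<in> vcone V \<and> vtight V z = vtight V y" for z
    proof -
      have eq: "vtight V z = vtight V y \<longleftrightarrow> tight (map_keys f) z = tight (map_keys f) y
        \<and> tight (Poly_Mapping.keys g) z = tight (Poly_Mapping.keys g) y \<and> zero_coords z = zero_coords y"
        if z: "z \<in> vcone V"
      proof -
        have zo: "\<omega>0 \<in> tight (map_keys f) z" "\<omega>1 \<in> tight (Poly_Mapping.keys g) z" using z vc_iff by auto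
        have "vtight V z = vtight V y \<longleftrightarrow> (\<forall>v\<in>V. v \<bullet> z = 0 \<longleftrightarrow> v \<bullet> y = 0)"
          unfolding vtight_def by blast
        also have "\<dots> \<longleftrightarrow> (\<forall>\<omega>\<in>map_keys f. (exponent_vec \<omega> - exponent_vec \<omega>0) \<bullet> z = 0 \<longleftrightarrow> (exponent_vec \<omega> - exponent_vec \<omega>0) \<bullet> y = 0)
            \<and> (\<forall>\<omega>\<in>Poly_Mapping.keys g. (exponent_vec \<omega> - exponent_vec \<omega>1) \<bullet> z = 0 \<longleftrightarrow> (exponent_vec \<omega> - exponent_vec \<omega>1) \<bullet> y = 0)
            \<and> (\<forall>i. axis i 1 \<bullet> z = 0 \<longleftrightarrow> axis i 1 \<bullet> y = 0)"
          unfolding V_def by blast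
        also have "\<dots> \<longleftrightarrow> tight (map_keys f) z = tight (map_keys f) y
            \<and> tight (Poly_Mapping.keys g) z = tight (Poly_Mapping.keys g) y \<and> zero_coords z = zero_coords y"
          unfolding tight_eq_ref[OF zo(1)] tight_eq_ref[OF yo(2)] tight_eq_ref[OF zo(2)] tight_eq_ref[OF yo(3)] zc
          by blast
        finally show ?thesis .
      qed
      show ?thesis
      proof
        assume z: "z \<in> cell f g y"
        then have zz: "z \<in> orthant" "tight (map_keys f) z = tight (map_keys f) y"
          "tight (Poly_Mapping.keys g) z = tight (Poly_Mapping.keys g) y" "zero_coords z = zero_coords y"
          unfolding cell_tight[OF nef neg yo(1)] by auto
        then have "z \<in> vcone V" using yo by (simp add: vc_iff)
        then show "z \<in> vcone V \<and> vtight V z = vtight V y" using eq zz by simp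
      next
        assume "z \<in> vcone V \<and> vtight V z = vtight V y"
        then show "z \<in> cell f g y"
          unfolding cell_tight[OF nef neg yo(1)] using eq vc_iff by simp
      qed
    qed
    then show ?thesis by blast
  qed
  have \<kappa>V: "\<kappa> \<in> vcone V" using \<kappa>(1) \<omega>0 \<omega>1 by (simp add: vc_iff)
  have gens: "y \<in> ray_generators f g \<inter> closure \<delta>" if y: "y \<in> vgens V" "vtight V \<kappa> \<subseteq> vtight V y" for y
  proof -
    have ey: "extreme V y" "primitive y" using y(1) by (auto simp: vgens_def)
    then have yV: "y \<in> vcone V" "y \<noteq> 0" by (auto simp: extreme_def)
    have yo: "y \<in> orthant" using yV(1) vc_iff by blast
    \<comment> \<open>Members of the cell of y satisfy the equations tight at y, whose solutions
      form a line by extremality. So an edge of the cone is a ray of the partition.\<close>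
    have sub: "cell f g y \<subseteq> span {y}"
    proof
      fix z assume "z \<in> cell f g y"
      then have "\<forall>v\<in>vtight V y. v \<bullet> z = 0" unfolding face[OF yV(1)] by (auto simp: vtight_def)
      then obtain c where "z = c *\<^sub>R y" using ey(1) unfolding extreme_def by blast
      then show "z \<in> span {y}" by (simp add: span_mul span_base)
    qed
    have "dim (cell f g y) = 1"
    proof -
      have "span (cell f g y) = span {y}"
        using sub cell_self[OF yo, of f g] by (intro span_eq[THEN iffD2]) (auto intro: span_base)
      then have "dim (cell f g y) = dim {y}" by (metis dim_span)
      also have "\<dots> = 1" using yV(2) by (simp add: dim_eq_card_independent)
      finally show ?thesis .
    qed
    moreover have "cell f g y \<in> Delta f g" unfolding Delta_eq[OF nef neg] using yo by blast
    ultimately have "y \<in> ray_generators f g"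
      unfolding ray_generators_def using ey(2) cell_self[OF yo] by blast
    moreover have "y \<in> closure \<delta>"
    proof -
      \<comment> \<open>What is tight at \<kappa> is tight at y, so a small multiple of \<kappa>
        added to y gives exactly the tight set of \<kappa>, that is, a point of the cell.\<close>
      have mem: "y + (1 / real (Suc m)) *\<^sub>R \<kappa> \<in> \<delta>" for m
      proof -
        let ?c = "1 / real (Suc m)"
        have c: "?c > 0" by simp
        have nn: "0 \<le> v \<bullet> y" "0 \<le> v \<bullet> \<kappa>" if "v \<in> V" for v
          using that yV(1) \<kappa>V by (auto simp: vcone_def)
        have in_eq: "v \<bullet> (y + ?c *\<^sub>R \<kappa>) = v \<bullet> y + ?c * (v \<bullet> \<kappa>)" for v
          by (simp add: inner_add_right)
        have "0 \<le> v \<bullet> (y + ?c *\<^sub>R \<kappa>)" if "v \<in> V" for v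
          unfolding in_eq using nn[OF that] c by (intro add_nonneg_nonneg mult_nonneg_nonneg) auto
        then have "y + ?c *\<^sub>R \<kappa> \<in> vcone V" by (simp add: vcone_def)
        moreover have "vtight V (y + ?c *\<^sub>R \<kappa>) = vtight V \<kappa>"
        proof (intro equalityI subsetI)
          fix v assume "v \<in> vtight V (y + ?c *\<^sub>R \<kappa>)"
          then have v: "v \<in> V" "v \<bullet> y + ?c * (v \<bullet> \<kappa>) = 0"
            unfolding vtight_def in_eq by auto
          have "0 \<le> ?c * (v \<bullet> \<kappa>)" using nn(2)[OF v(1)] c by (intro mult_nonneg_nonneg) auto
          then have "?c * (v \<bullet> \<kappa>) = 0" using v(2) nn(1)[OF v(1)] by linarith
          then show "v \<in> vtight V \<kappa>" using v(1) by (simp add: vtight_def)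
        next
          fix v assume v: "v \<in> vtight V \<kappa>"
          then have "v \<in> vtight V y" using y(2) by blast
          then show "v \<in> vtight V (y + ?c *\<^sub>R \<kappa>)"
            using v unfolding vtight_def in_eq by auto
        qed
        ultimately show ?thesis unfolding \<kappa>(2) face[OF \<kappa>V] by blast
      qed
      have "(\<lambda>m. y + (1 / real (Suc m)) *\<^sub>R \<kappa>) \<longlonglongrightarrow> y + 0 *\<^sub>R \<kappa>"
        by (intro tendsto_intros LIMSEQ_inverse_real_of_nat[unfolded inverse_eq_divide])
      then have "\<exists>u. (\<forall>m. u m \<in> \<delta>) \<and> u \<longlonglongrightarrow> y"
        using mem by (intro exI[of _ "\<lambda>m. y + (1 / real (Suc m)) *\<^sub>R \<kappa>"]) simp
      then show ?thesis by (simp add: closure_sequential)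
    qed
    ultimately show ?thesis by blast
  qed
  have \<delta>: "\<delta> = {z \<in> vcone V. vtight V z = vtight V \<kappa>}" unfolding \<kappa>(2) by (rule face[OF \<kappa>V])
  obtain \<K> where \<K>: "finite \<K>" "\<forall>K\<in>\<K>. K \<subseteq> {y \<in> vgens V. vtight V \<kappa> \<subseteq> vtight V y} \<and> independent K"
    "disjoint_family_on strict_cone \<K>" "(\<Union>K\<in>\<K>. strict_cone K) = \<delta>"
    using vcone_face_triangulation[OF V \<kappa>V] unfolding \<delta> by (elim exE conjE)
  have "\<forall>K\<in>\<K>. K \<subseteq> ray_generators f g \<inter> closure \<delta> \<and> independent K"
  proof (intro ballI conjI subsetI)
    fix K y assume "K \<in> \<K>" "y \<in> K"
    then show "y \<in> ray_generators f g \<inter> closure \<delta>" using \<K>(2) by (intro gens) blast+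
  qed (use \<K>(2) in blast)
  then show ?thesis using \<K>(1,3,4) by (intro exI[of _ \<K>] conjI)
qed

lemma Delta_orthant: "\<delta> \<in> Delta f g \<Longrightarrow> \<delta> \<subseteq> orthant"
  unfolding Delta_eq[OF nef neg] by (auto simp: cell_def)

lemma ray_generatorsD:
  assumes "k \<in> ray_generators f g"
  shows "k \<in> orthant" "k \<noteq> 0" "int_vec k"
  using assms Delta_orthant primitive_nonzero primitive_int_vec by (auto simp: ray_generators_def)

lemma Re_weight: "Re (weight f g s k) = min_val (Gam_f f) k * Re s + (min_val (Gam_g g) k + sigma k)"
  by (simp add: weight_def)

lemma min_val_g_sigma_pos:
  assumes "k \<in> orthant" "k \<noteq> 0"
  shows "0 < min_val (Gam_g g) k + sigma k"
  using min_val_nonneg[OF finite_keys neg assms(1)] sigma_pos[OF assms] by (simp add: Gam_g_def)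

lemma Re_weight_pos:
  assumes "k \<in> orthant" "k \<noteq> 0" "Re s > 0"
  shows "0 < Re (weight f g s k)"
proof -
  have "0 \<le> min_val (Gam_f f) k"
    using min_val_nonneg[OF finite_map_keys nef assms(1)] by (simp add: Gam_f_eq[OF nef neg])
  then have "0 \<le> min_val (Gam_f f) k * Re s" using assms(3) by simp
  then show ?thesis
    unfolding Re_weight using min_val_g_sigma_pos[OF assms(1,2)] by linarith
qed

lemma min_val_rat:
  assumes "finite \<Omega>" "\<Omega> \<noteq> {}" "k \<in> orthant" "int_vec k"
  shows "min_val (newton_polyhedron \<Omega>) k \<in> \<rat>"
proof -
  have "min_val (newton_polyhedron \<Omega>) k \<in> (\<lambda>\<omega>. k \<bullet> exponent_vec \<omega>) ` \<Omega>"
    unfolding min_val_newton[OF assms(1-3)] using assms(1,2) by (intro Min_in) auto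
  moreover have "k \<bullet> exponent_vec \<omega> \<in> \<int>" for \<omega>
    using assms(4) unfolding inner_vec_def by (auto simp: int_vec_def exponent_vec_def intro!: Ints_sum)
  ultimately show ?thesis using Ints_subset_Rats by auto
qed

lemma candidate_real_parts_rat: "candidate_real_parts f g \<subseteq> \<rat>"
proof -
  have "- (min_val (Gam_g g) k + sigma k) / min_val (Gam_f f) k \<in> \<rat>" if "k \<in> ray_generators f g" for k
  proof -
    note k = ray_generatorsD[OF that]
    have "sigma k \<in> \<int>" using k(3) unfolding sigma_def by (auto simp: int_vec_def intro!: Ints_sum)
    then have "sigma k \<in> \<rat>" using Ints_subset_Rats by blast
    then show ?thesis
      using min_val_rat[OF finite_map_keys nef k(1,3)] min_val_rat[OF finite_keys neg k(1,3)]
      by (simp add: Gam_f_eq[OF nef neg] Gam_g_def)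
  qed
  then show ?thesis unfolding candidate_real_parts_def by auto
qed

text \<open>Taking norms gives Re(weight) = 0. Since m_g + \<sigma> is positive on nonzero vectors
  of the orthant, m_f cannot vanish, and the equation can be solved for Re s.\<close>

lemma powr_weight_eq_1_imp:
  assumes "k \<in> ray_generators f g" "(of_nat c :: complex) powr weight f g s k = 1" "c > 1"
  shows "Re s \<in> candidate_real_parts f g"
proof -
  note k = ray_generatorsD[OF assms(1)]
  have "norm ((of_nat c :: complex) powr weight f g s k) = real c powr Re (weight f g s k)"
    using assms(3) by (subst norm_powr_real_powr) auto
  then have "real c powr Re (weight f g s k) = 1" using assms(2) by simp
  then have "Re (weight f g s k) = 0" using assms(3) by (simp add: powr_def)
  then have e: "min_val (Gam_f f) k * Re s = - (min_val (Gam_g g) k + sigma k)"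
    unfolding Re_weight by simp
  have nz: "min_val (Gam_f f) k \<noteq> 0"
    using e min_val_g_sigma_pos[OF k(1,2)] by auto
  then have "Re s = - (min_val (Gam_g g) k + sigma k) / min_val (Gam_f f) k"
    using e by (simp add: field_simps)
  then show ?thesis using assms(1) nz unfolding candidate_real_parts_def by blast
qed

end

section \<open>The closed form of S on simplicial cones\<close>

context zeta_data
begin

definition cone_term :: "complex \<Rightarrow> (real ^ 'n) set \<Rightarrow> complex" where
  "cone_term s K = (\<Sum>h\<in>{h \<in> half_open_box K. \<forall>i. h $ i \<in> \<int>}. of_nat CARD('p) powr weight f g s h)
     / (\<Prod>k\<in>K. of_nat CARD('p) powr weight f g s k - 1)"

text \<open>The hypotheses are those shared by a given simplicial partition and by the constructed
  triangulation, so both are covered.\<close>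

lemma S_cell_simplicial:
  assumes s: "Re s > 0" and \<delta>: "\<delta> \<in> Delta f g" and fin: "finite \<K>"
    and K: "\<And>K. K \<in> \<K> \<Longrightarrow> K \<subseteq> closure \<delta>" "\<And>K k. K \<in> \<K> \<Longrightarrow> k \<in> K \<Longrightarrow> int_vec k \<and> k \<noteq> 0"
      "\<And>K. K \<in> \<K> \<Longrightarrow> independent K"
    and dis: "disjoint_family_on strict_cone \<K>" and un: "(\<Union>K\<in>\<K>. strict_cone K) = \<delta>"
  shows "S_cell f g s \<delta> = (\<Sum>K\<in>\<K>. cone_term s K)"
proof -
  obtain x y where o: "\<And>\<kappa>. \<kappa> \<in> closure \<delta> \<Longrightarrow> \<kappa> \<in> orthant"
    and w: "\<And>s \<kappa>. \<kappa> \<in> closure \<delta> \<Longrightarrow> weight f g s \<kappa> = of_real (\<kappa> \<bullet> x) * s + of_real (\<kappa> \<bullet> y) + of_real (sigma \<kappa>)"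
    by (rule weight_linear[OF map_keys_f keys_g \<delta>]) blast
  \<comment> \<open>A globally linear function that agrees with log p times the weight on the
    closure of the cell.\<close>
  define W where "W \<kappa> = Ln (of_nat CARD('p)) * (of_real (\<kappa> \<bullet> x) * s + of_real (\<kappa> \<bullet> y) + of_real (sigma \<kappa>))" for \<kappa>
  have p1: "real CARD('p) > 1" using int_card_gt_1[where 'p='p] by simp
  have linW: "linear W"
    by (rule linearI) (simp_all add: W_def inner_add_left sigma_add sigma_scale algebra_simps scaleR_conv_of_real[where 'a = complex])
  have W: "of_nat CARD('p) powr weight f g s \<kappa> = exp (W \<kappa>)" "of_nat CARD('p) powr (- weight f g s \<kappa>) = exp (- W \<kappa>)"
    if "\<kappa> \<in> closure \<delta>" for \<kappa>
    using w[OF that, of s] p1 by (simp_all only: powr_def W_def mult.commute[of _ "Ln _"] mult_minus_right) auto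
  have posW: "Re (W k) > 0" if "k \<in> closure \<delta>" "k \<noteq> 0" for k
  proof -
    have "Ln (of_nat CARD('p)) = complex_of_real (ln (real CARD('p)))"
      using Ln_of_real[of "real CARD('p)"] p1 by simp
    then have "W k = of_real (ln (real CARD('p))) * weight f g s k" using w[OF that(1), of s] by (simp add: W_def)
    then have "Re (W k) = ln (real CARD('p)) * Re (weight f g s k)" by simp
    moreover have "Re (weight f g s k) > 0" by (rule Re_weight_pos[OF map_keys_f keys_g o[OF that(1)] that(2) s])
    ultimately show ?thesis using p1 by simp
  qed
  have nat_int: "{\<kappa> \<in> \<delta>. \<forall>i. \<kappa> $ i \<in> \<nat>} = (\<Union>K\<in>\<K>. {x \<in> strict_cone K. int_vec x})"
  proof -
    have "(\<forall>i. \<kappa> $ i \<in> \<nat>) \<longleftrightarrow> int_vec \<kappa>" if "\<kappa> \<in> \<delta>" for \<kappa>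
    proof -
      have "\<kappa> \<in> orthant" using o closure_subset that by blast
      then show ?thesis by (auto simp: int_vec_def orthant_def Nats_altdef2)
    qed
    then show ?thesis using un by blast
  qed
  have "S_cell f g s \<delta> = (\<Sum>K\<in>\<K>. \<Sum>\<^sub>\<infinity>\<kappa>\<in>{x \<in> strict_cone K. int_vec x}. of_nat CARD('p) powr (- weight f g s \<kappa>))"
    unfolding S_cell_def nat_int
  proof (rule infsum_finite_disjoint_UN[OF fin])
    show "disjoint_family_on (\<lambda>K. {x \<in> strict_cone K. int_vec x}) \<K>"
      using dis unfolding disjoint_family_on_def by blast
    show "(\<lambda>\<kappa>. of_nat CARD('p) powr (- weight f g s \<kappa>)) summable_on (\<Union>K\<in>\<K>. {x \<in> strict_cone K. int_vec x})"
      using S_cell_summable[OF s, of \<delta>] unfolding nat_int .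
  qed
  also have "\<dots> = (\<Sum>K\<in>\<K>. cone_term s K)"
  proof (rule sum.cong)
    fix K assume KK: "K \<in> \<K>"
    have finK: "finite K" using K(3)[OF KK] by (rule independent_imp_finite)
    have sc: "strict_cone K \<subseteq> \<delta>" using KK un by blast
    have hb: "h \<in> closure \<delta>" if "h \<in> half_open_box K" for h
      using half_open_box_closure[OF finK that] closure_mono[OF sc] by blast
    have "(\<Sum>\<^sub>\<infinity>\<kappa>\<in>{x \<in> strict_cone K. int_vec x}. of_nat CARD('p) powr (- weight f g s \<kappa>))
        = (\<Sum>\<^sub>\<infinity>\<kappa>\<in>{x \<in> strict_cone K. int_vec x}. exp (- W \<kappa>))"
      by (rule infsum_cong) (use sc closure_subset W(2) in blast)
    also have "\<dots> = (\<Sum>h\<in>{h \<in> half_open_box K. int_vec h}. exp (W h)) / (\<Prod>k\<in>K. exp (W k) - 1)"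
      by (rule strict_cone_exp_sum[OF finK K(3)[OF KK] _ linW])
         (use K(1,2) KK posW in blast)+
    also have "\<dots> = (\<Sum>h\<in>{h \<in> half_open_box K. int_vec h}. of_nat CARD('p) powr weight f g s h)
        / (\<Prod>k\<in>K. of_nat CARD('p) powr weight f g s k - 1)"
      using hb K(1)[OF KK] W(1)
      by (intro arg_cong2[where f = "(/)"] sum.cong prod.cong) auto
    finally show "(\<Sum>\<^sub>\<infinity>\<kappa>\<in>{x \<in> strict_cone K. int_vec x}. of_nat CARD('p) powr (- weight f g s \<kappa>)) = cone_term s K"
      by (simp add: cone_term_def int_vec_def)
  qed simp
  finally show ?thesis .
qed

lemma S_cell_simplicial_partition:
  assumes s: "Re s > 0" and \<delta>: "\<delta> \<in> Delta f g" and P: "simplicial_partition \<delta> \<K>"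
  shows "S_cell f g s \<delta> = (\<Sum>K\<in>\<K>. cone_term s K)"
proof (rule S_cell_simplicial[OF s \<delta>])
  have e: "k \<in> closure \<delta> \<and> int_vec k \<and> k \<noteq> 0" if "K \<in> \<K>" "k \<in> K" for K k
  proof -
    have k: "k \<in> edge_generators \<delta>" using P that unfolding simplicial_partition_def by blast
    then obtain F where "is_face F (closure \<delta>)" "k \<in> F" unfolding edge_generators_def by blast
    then have "k \<in> closure \<delta>"
      unfolding is_face_def exposed_face_of_def using face_of_imp_subset by blast
    then show ?thesis
      using k primitive_nonzero primitive_int_vec unfolding edge_generators_def by blast
  qed
  then show "K \<subseteq> closure \<delta>" if "K \<in> \<K>" for K using that by blast
  show "int_vec k \<and> k \<noteq> 0" if "K \<in> \<K>" "k \<in> K" for K k using e that by blast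
qed (use P in \<open>auto simp: simplicial_partition_def\<close>)

end

section \<open>Meromorphic continuation\<close>

text \<open>The identity theorem applies after the singularities of the difference have been
  removed; the original functions may still differ at isolated points.\<close>

lemma meromorphic_eq_on_open_imp_eventually_eq:
  fixes F G :: "complex \<Rightarrow> complex"
  assumes F: "F meromorphic_on UNIV" and G: "G meromorphic_on UNIV"
    and U: "open U" "U \<noteq> {}" "\<And>z. z \<in> U \<Longrightarrow> F z = G z"
  shows "eventually (\<lambda>w. F w = G w) (at z)"
proof -
  define D where "D z = F z - G z" for z
  have D: "D meromorphic_on UNIV" unfolding D_def[abs_def] by (intro meromorphic_intros F G)
  have near: "eventually (\<lambda>w. w \<in> U) (at z0)" if "z0 \<in> U" for z0
    using U(1) that by (rule eventually_at_in_open')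
  have R0: "remove_sings D z0 = 0" if "z0 \<in> U" for z0
  proof (rule remove_sings_eqI, rule tendsto_eventually)
    show "eventually (\<lambda>w. D w = 0) (at z0)"
      using near[OF that] by eventually_elim (simp add: D_def U(3))
  qed
  obtain z0 where z0: "z0 \<in> U" using U(2) by blast
  have "eventually (\<lambda>w. remove_sings D w = 0) (at z0)"
    using near[OF z0] by eventually_elim (rule R0)
  then have "frequently (\<lambda>w. remove_sings D w = 0) (at z0)"
    by (rule eventually_frequently[rotated]) simp
  then have R: "remove_sings D w = 0" for w
    by (rule frequently_eq_meromorphic_imp_constant[OF _ remove_sings_nicely_meromorphic[OF D]]) auto
  have "isolated_singularity_at D z"
    by (rule meromorphic_on_isolated_singularity[OF meromorphic_on_subset[OF D]]) simp
  from eventually_remove_sings_eq_at[OF this]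
  show ?thesis by eventually_elim (simp add: R D_def)
qed

lemma analytic_powr_weight:
  assumes "c > 0"
  shows "(\<lambda>s. of_nat c powr weight f g s k) analytic_on A"
  unfolding weight_def using assms by (intro analytic_intros) auto

context zeta_data
begin

lemma analytic_L_cell:
  assumes "(of_nat CARD('p) :: complex) powr (s0 + of_nat CARD('t)) \<noteq> 1"
  shows "(\<lambda>s. L_cell f g s \<delta>) analytic_on {s0}"
proof -
  have p: "(of_nat CARD('p) :: complex) \<notin> \<real>\<^sub>\<le>\<^sub>0"
    using int_card_pos[where 'p='p] by simp
  have p1: "(of_nat CARD('p) :: complex) + 1 \<noteq> 0" by (metis of_nat_Suc of_nat_neq_0 add.commute)
  show ?thesis
    unfolding L_cell_def Let_def using assms p p1 by (intro analytic_intros) auto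
qed

lemma meromorphic_L_cell: "(\<lambda>s. L_cell f g s \<delta>) meromorphic_on A"
proof -
  have p: "(of_nat CARD('p) :: complex) \<notin> \<real>\<^sub>\<le>\<^sub>0"
    using int_card_pos[where 'p='p] by simp
  have m: "(\<lambda>s. of_nat CARD('p) powr s) meromorphic_on A"
    "(\<lambda>s. of_nat CARD('p) powr (s + of_nat CARD('t))) meromorphic_on A"
    by (rule analytic_on_imp_meromorphic_on, intro analytic_intros p)+
  show ?thesis
    unfolding L_cell_def Let_def by (intro meromorphic_intros m)
qed

lemma analytic_cone_term:
  assumes "\<And>k. k \<in> K \<Longrightarrow> (of_nat CARD('p) :: complex) powr weight f g s0 k \<noteq> 1" "finite K"
  shows "(\<lambda>s. cone_term s K) analytic_on {s0}"
  unfolding cone_term_def using assms int_card_pos[where 'p='p]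
  by (intro analytic_intros analytic_powr_weight) (auto simp: prod_zero_iff)

lemma meromorphic_cone_term: "(\<lambda>s. cone_term s K) meromorphic_on A"
  unfolding cone_term_def using int_card_pos[where 'p='p]
  by (intro meromorphic_intros analytic_on_imp_meromorphic_on[OF analytic_powr_weight]) simp_all

text \<open>The triangulations are chosen independently of s, so one formula serves everywhere. Its
  denominators come from L and from ray generators, the two sources of
  \<open>candidate_real_parts\<close>.\<close>

lemma zeta_continuation:
  "\<exists>Z. meromorphic_continuation (zeta \<mu> f g) Z
     \<and> (\<forall>s. Re s \<notin> candidate_real_parts f g \<longrightarrow> Z analytic_on {s})"
proof -
  have "\<forall>\<delta>\<in>Delta f g. \<exists>\<K>. finite \<K> \<and> (\<forall>K\<in>\<K>. K \<subseteq> ray_generators f g \<inter> closure \<delta> \<and> independent K)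
    \<and> disjoint_family_on strict_cone \<K> \<and> (\<Union>K\<in>\<K>. strict_cone K) = \<delta>"
    by (intro ballI cell_triangulation[OF map_keys_f keys_g])
  then obtain \<T> where \<T>: "\<forall>\<delta>\<in>Delta f g. finite (\<T> \<delta>)
    \<and> (\<forall>K\<in>\<T> \<delta>. K \<subseteq> ray_generators f g \<inter> closure \<delta> \<and> independent K)
    \<and> disjoint_family_on strict_cone (\<T> \<delta>) \<and> (\<Union>K\<in>\<T> \<delta>. strict_cone K) = \<delta>"
    by (rule bchoice[THEN exE])
  define Z where "Z s = (\<Sum>\<delta>\<in>Delta f g. L_cell f g s \<delta> * (\<Sum>K\<in>\<T> \<delta>. cone_term s K))" for s
  have p1: "CARD('p) > 1" using int_card_gt_1[where 'p='p] by simp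
  have "Z s = zeta \<mu> f g s" if s: "Re s > 0" for s
  proof -
    have "S_cell f g s \<delta> = (\<Sum>K\<in>\<T> \<delta>. cone_term s K)" if "\<delta> \<in> Delta f g" for \<delta>
      by (rule S_cell_simplicial[OF s that])
         (use \<T>[rule_format, OF that] ray_generatorsD[OF map_keys_f keys_g] in blast)+
    then show ?thesis unfolding Z_def zeta_formula[OF s] by simp
  qed
  moreover have "Z meromorphic_on UNIV"
    unfolding Z_def[abs_def] by (intro meromorphic_intros meromorphic_L_cell meromorphic_cone_term)
  moreover have "Z analytic_on {s0}" if s0: "Re s0 \<notin> candidate_real_parts f g" for s0
  proof -
    have L: "(of_nat CARD('p) :: complex) powr (s0 + of_nat CARD('t)) \<noteq> 1"
    proof
      assume e: "(of_nat CARD('p) :: complex) powr (s0 + of_nat CARD('t)) = 1"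
      have "norm ((of_nat CARD('p) :: complex) powr (s0 + of_nat CARD('t)))
          = real CARD('p) powr Re (s0 + of_nat CARD('t))"
        using p1 by (subst norm_powr_real_powr) auto
      then have "real CARD('p) powr Re (s0 + of_nat CARD('t)) = 1" using e by simp
      then have "Re (s0 + of_nat CARD('t)) = 0" using p1 by (simp add: powr_def)
      then have "Re s0 = - real CARD('t)" by simp
      then show False using s0 by (simp add: candidate_real_parts_def)
    qed
    have W: "(of_nat CARD('p) :: complex) powr weight f g s0 k \<noteq> 1" if "k \<in> ray_generators f g" for k
      using powr_weight_eq_1_imp[OF map_keys_f keys_g that _ p1] s0 by blast
    show ?thesis
      unfolding Z_def[abs_def]
    proof (intro analytic_on_sum analytic_on_mult analytic_L_cell[OF L] analytic_cone_term)
      fix \<delta> K assume "\<delta> \<in> Delta f g" "K \<in> \<T> \<delta>"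
      then have K: "K \<subseteq> ray_generators f g" "independent K" using \<T> by blast+
      show "finite K" using K(2) by (rule independent_imp_finite)
      show "(of_nat CARD('p) :: complex) powr weight f g s0 k \<noteq> 1" if "k \<in> K" for k
        using W K(1) that by blast
    qed
  qed
  ultimately show ?thesis unfolding meromorphic_continuation_def by blast
qed

text \<open>An arbitrary continuation agrees with the constructed one on a punctured neighbourhood
  of s, and this decides whether s is a pole.\<close>

lemma zeta_pole_real_part:
  assumes W: "meromorphic_continuation (zeta \<mu> f g) W" and pole: "is_pole W s"
  shows "Re s \<in> candidate_real_parts f g"
proof (rule ccontr)
  assume n: "Re s \<notin> candidate_real_parts f g"
  obtain Z where Z: "meromorphic_continuation (zeta \<mu> f g) Z" "Z analytic_on {s}"
    using zeta_continuation n by blast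
  have "eventually (\<lambda>w. W w = Z w) (at s)"
  proof (rule meromorphic_eq_on_open_imp_eventually_eq)
    show "open {z. Re z > 0}" by (rule open_halfspace_Re_gt)
    show "{z. Re z > 0} \<noteq> {}" by (auto intro: exI[of _ 1])
  qed (use W Z(1) in \<open>auto simp: meromorphic_continuation_def\<close>)
  then have "is_pole Z s" using is_pole_transform[OF pole] by blast
  then show False using analytic_at_imp_no_pole[OF Z(2)] by blast
qed

end

theorem theorem5p6:
  fixes p :: nat
    and f :: "('n::finite, 'p::prime_card padic_int) mpolynomial ^ 't::finite"
    and g :: "('n, 'p padic_int) mpolynomial"
    and \<mu> :: "('p padic ^ 'n) measure"
  assumes "p = CARD('p)"
    and "CARD('n) \<ge> CARD('t) + 1"
    and "\<not> padic_map f constant_on UNIV"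
    and "\<forall>i. mp_eval (f $ i) 0 = 0"
    and "\<not> Poly_Mapping.keys g \<subseteq> {0}"
    and "mp_eval g 0 = 0"
    and "nondegenerate g"
    and "strongly_nondegenerate f"
    and "pair_strongly_nondegenerate f g"
    and "normalized_haar \<mu>"
  shows "finite (Delta f g)
    \<and> (\<forall>s. Re s > 0 \<longrightarrow>
         set_integrable \<mu> Zp_cube (zeta_integrand f g s)
         \<and> (\<forall>\<delta>\<in>Delta f g.
              (\<lambda>k. of_nat p powr (- weight f g s k)) summable_on {k \<in> \<delta>. \<forall>i. k $ i \<in> \<nat>})
         \<and> zeta \<mu> f g s = (\<Sum>\<delta>\<in>Delta f g. L_cell f g s \<delta> * S_cell f g s \<delta>))
    \<and> (\<forall>s \<delta> \<K>. Re s > 0 \<longrightarrow> \<delta> \<in> Delta f g \<longrightarrow> simplicial_partition \<delta> \<K> \<longrightarrow>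
         S_cell f g s \<delta> =
           (\<Sum>K\<in>\<K>. (\<Sum>h\<in>{h \<in> half_open_box K. \<forall>i. h $ i \<in> \<int>}. of_nat p powr weight f g s h)
                    / (\<Prod>k\<in>K. of_nat p powr weight f g s k - 1)))
    \<and> (\<exists>W. meromorphic_continuation (zeta \<mu> f g) W)
    \<and> candidate_real_parts f g \<subseteq> \<rat>
    \<and> (\<forall>W s. meromorphic_continuation (zeta \<mu> f g) W \<longrightarrow> is_pole W s
         \<longrightarrow> Re s \<in> candidate_real_parts f g)"
proof -
  \<comment> \<open>An empty support would make f the zero map, which is constant. Nonempty supports
    are what the minima over Newton polyhedra need.\<close>
  have nef: "map_keys f \<noteq> {}"
  proof
    assume "map_keys f = {}"
    then have "f $ i = 0" for i by (simp add: map_keys_def keys_eq_empty)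
    moreover have "Poly_Mapping.map of_padic_int (0 :: ('n, 'p padic_int) mpolynomial) = 0"
      by (rule poly_mapping_eqI) (simp add: map.rep_eq)
    ultimately have "padic_map f x = 0" for x
      by (simp add: padic_map_def padic_eval_def vec_eq_iff)
    then have "padic_map f constant_on UNIV" unfolding constant_on_def by blast
    then show False using assms(3) by blast
  qed
  have neg: "Poly_Mapping.keys g \<noteq> {}" using assms(5) by auto
  interpret zeta_data \<mu> f g "1 / real CARD('p)"
    by unfold_locales (use assms nef neg in auto)
  show ?thesis
    unfolding assms(1)
  proof (intro conjI allI impI ballI)
    show "finite (Delta f g)" by (rule finite_Delta[OF nef neg])
    show "\<exists>W. meromorphic_continuation (zeta \<mu> f g) W" using zeta_continuation by blast
    show "candidate_real_parts f g \<subseteq> \<rat>" by (rule candidate_real_parts_rat[OF nef neg])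
    fix W s assume "meromorphic_continuation (zeta \<mu> f g) W" "is_pole W s"
    then show "Re s \<in> candidate_real_parts f g" by (rule zeta_pole_real_part)
  next
    fix s :: complex assume s: "Re s > 0"
    show "set_integrable \<mu> Zp_cube (zeta_integrand f g s)" by (rule zeta_integral(1)[OF s])
    show "(\<lambda>k. of_nat CARD('p) powr (- weight f g s k)) summable_on {k \<in> \<delta>. \<forall>i. k $ i \<in> \<nat>}" for \<delta>
      by (rule S_cell_summable[OF s])
    show "zeta \<mu> f g s = (\<Sum>\<delta>\<in>Delta f g. L_cell f g s \<delta> * S_cell f g s \<delta>)"
      by (rule zeta_formula[OF s])
    fix \<delta> \<K> assume "\<delta> \<in> Delta f g" "simplicial_partition \<delta> \<K>"
    then show "S_cell f g s \<delta> =
           (\<Sum>K\<in>\<K>. (\<Sum>h\<in>{h \<in> half_open_box K. \<forall>i. h $ i \<in> \<int>}. of_nat CARD('p) powr weight f g s h)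
                    / (\<Prod>k\<in>K. of_nat CARD('p) powr weight f g s k - 1))"
      by (rule S_cell_simplicial_partition[OF s, unfolded cone_term_def])
  qed
qed

end
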